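(* Let $G$ be a connected non-abelian nilpotent Lie group. For any conformal class $c$ on $G$ containing a left-invariant Riemannian metric, and any left-invariant Weyl structure $\nabla$ on $(G,c)$, $\nabla$ is not Weyl-Einstein.
   Context: A conformal Lie group $(G,c)$ is a Lie group $G$ with a conformal class $c$ containing a left-invariant Riemannian metric (unique up to constant rescaling). A Weyl structure on a conformal manifold $(M,c)$ is a torsion-free linear connection $\nabla$ on $M$ preserving $c$; equivalently, for each metric $g\in c$ there is a 1-form $\theta$ on $M$ (the Lee form of $\nabla$ with respect to $g$) with $\nabla g=-2\theta\otimes g$. One then has $\nabla_XY=\nabla^g_XY+\theta(X)Y+\theta(Y)X-g(X,Y)T$, where $\nabla^g$ is the Levi-Civita connection of $g$ and $T$ is the $g$-dual vector field of $\theta$; conversely any 1-form $\theta$ defines a Weyl structure by this formula. A Weyl structure on a conformal Lie group is left-invariant if its Lee form with respect to any left-invariant metric in $c$ is left-invariant. The curvature of $\nabla$ is $R^\nabla(X,Y)Z=\nabla_{[X,Y]}Z-\nabla_X\nabla_YZ+\nabla_Y\nabla_XZ$ and its Ricci tensor is $\mathrm{Ric}^\nabla(X,Y)=\mathrm{Tr}(Z\mapsto R^\nabla(X,Z)Y)$ (in general not symmetric). $\nabla$ is Weyl-Einstein if the trace-free symmetric part of $\mathrm{Ric}^\nabla$ (with respect to some, equivalently any, metric in $c$) vanishes. *)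

theory Defs
  imports "HOL-Analysis.Analysis" "HOL-Algebra.Generated_Groups"
begin

section \<open>Smooth maps between open subsets of Euclidean spaces\<close>

text \<open>For an open set \<open>S\<close> of a Euclidean space, \<open>Ck_on k S f\<close> says that \<open>f\<close> is \<open>k\<close> times
  continuously differentiable on \<open>S\<close>: all iterated directional derivatives up to order \<open>k\<close>
  exist and are continuous.\<close>

primrec Ck_on ::
  "nat \<Rightarrow> 'a::real_normed_vector set \<Rightarrow> ('a \<Rightarrow> 'b::real_normed_vector) \<Rightarrow> bool" where
  "Ck_on 0 S f \<longleftrightarrow> continuous_on S f"
| "Ck_on (Suc k) S f \<longleftrightarrow>
     (\<forall>x\<in>S. f differentiable (at x)) \<and> (\<forall>v. Ck_on k S (\<lambda>x. frechet_derivative f (at x) v))"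

definition smooth_on ::
  "'a::real_normed_vector set \<Rightarrow> ('a \<Rightarrow> 'b::real_normed_vector) \<Rightarrow> bool" where
  "smooth_on S f \<longleftrightarrow> (\<forall>k. Ck_on k S f)"

section \<open>Smooth manifolds\<close>

text \<open>A chart is a pair of an open domain and a coordinate map, whose values outside the domain
  are irrelevant.  The manifold is the whole type \<open>'m\<close>; Hausdorffness and second countability
  are imposed by type classes where needed.  A smooth structure is given by any (not
  necessarily maximal) smooth atlas.\<close>

type_synonym ('m, 'e) chart = "'m set \<times> ('m \<Rightarrow> 'e)"

definition chart_inv :: "('m, 'e) chart \<Rightarrow> 'e \<Rightarrow> 'm" where
  "chart_inv c = inv_into (fst c) (snd c)"

definition is_chart :: "('m::topological_space, 'e::euclidean_space) chart \<Rightarrow> bool" where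
  "is_chart c \<longleftrightarrow> open (fst c) \<and> open (snd c ` fst c) \<and>
     homeomorphism (fst c) (snd c ` fst c) (snd c) (chart_inv c)"

definition smooth_atlas :: "('m::topological_space, 'e::euclidean_space) chart set \<Rightarrow> bool" where
  "smooth_atlas A \<longleftrightarrow> (\<forall>c\<in>A. is_chart c) \<and> (\<Union>c\<in>A. fst c) = UNIV \<and>
     (\<forall>c\<in>A. \<forall>d\<in>A. smooth_on (snd c ` (fst c \<inter> fst d)) (snd d \<circ> chart_inv c))"

definition smooth_map ::
  "('m::topological_space, 'e::euclidean_space) chart set \<Rightarrow>
   ('n::topological_space, 'f::euclidean_space) chart set \<Rightarrow> ('m \<Rightarrow> 'n) \<Rightarrow> bool" where
  "smooth_map A B F \<longleftrightarrow> continuous_on UNIV F \<and>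
     (\<forall>c\<in>A. \<forall>d\<in>B. smooth_on (snd c ` (fst c \<inter> F -` fst d)) (snd d \<circ> F \<circ> chart_inv c))"

definition prod_atlas ::
  "('m, 'e) chart set \<Rightarrow> ('n, 'f) chart set \<Rightarrow> ('m \<times> 'n, 'e \<times> 'f) chart set" where
  "prod_atlas A B =
     {(fst c \<times> fst d, \<lambda>(x, y). (snd c x, snd d y)) | c d. c \<in> A \<and> d \<in> B}"

definition smooth_fun ::
  "('m::topological_space, 'e::euclidean_space) chart set \<Rightarrow> ('m \<Rightarrow> real) \<Rightarrow> bool" where
  "smooth_fun A f \<longleftrightarrow> (\<forall>c\<in>A. smooth_on (snd c ` fst c) (f \<circ> chart_inv c))"

definition chart_at :: "('m, 'e) chart set \<Rightarrow> 'm \<Rightarrow> ('m, 'e) chart" where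
  "chart_at A p = (SOME c. c \<in> A \<and> p \<in> fst c)"

section \<open>Tangent vectors and vector fields\<close>

text \<open>A tangent vector at \<open>p\<close> is the family of its coordinate vectors in all charts around \<open>p\<close>
  (and \<open>0\<close> at all other charts), related by the differentials of the coordinate changes.\<close>

type_synonym ('m, 'e) tvec = "('m, 'e) chart \<Rightarrow> 'e"
type_synonym ('m, 'e) vfield = "'m \<Rightarrow> ('m, 'e) tvec"

definition tangent_space ::
  "('m::topological_space, 'e::euclidean_space) chart set \<Rightarrow> 'm \<Rightarrow> ('m, 'e) tvec set" where
  "tangent_space A p = {v.
     (\<forall>c. \<not> (c \<in> A \<and> p \<in> fst c) \<longrightarrow> v c = 0) \<and>
     (\<forall>c\<in>A. \<forall>d\<in>A. p \<in> fst c \<and> p \<in> fst d \<longrightarrow>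
        v d = frechet_derivative (snd d \<circ> chart_inv c) (at (snd c p)) (v c))}"

definition lincomb ::
  "real \<Rightarrow> ('m, 'e::euclidean_space) tvec \<Rightarrow> real \<Rightarrow> ('m, 'e) tvec \<Rightarrow> ('m, 'e) tvec" where
  "lincomb a u b v = (\<lambda>c. a *\<^sub>R u c + b *\<^sub>R v c)"

text \<open>The coordinate vector \<open>\<Sum>\<^sub>i b\<^sub>i \<partial>/\<partial>x\<^sub>i\<close> at \<open>p\<close> of the chart \<open>c\<close>.\<close>

definition coord_vec ::
  "('m::topological_space, 'e::euclidean_space) chart set \<Rightarrow> ('m, 'e) chart \<Rightarrow> 'm \<Rightarrow> 'e \<Rightarrow>
   ('m, 'e) tvec" where
  "coord_vec A c p b = (\<lambda>d. if d \<in> A \<and> p \<in> fst d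
     then frechet_derivative (snd d \<circ> chart_inv c) (at (snd c p)) b else 0)"

definition differential ::
  "('m::topological_space, 'e::euclidean_space) chart set \<Rightarrow>
   ('n::topological_space, 'f::euclidean_space) chart set \<Rightarrow> ('m \<Rightarrow> 'n) \<Rightarrow> 'm \<Rightarrow>
   ('m, 'e) tvec \<Rightarrow> ('n, 'f) tvec" where
  "differential A B F p v = (let c = chart_at A p in
     (\<lambda>d. if d \<in> B \<and> F p \<in> fst d
       then frechet_derivative (snd d \<circ> F \<circ> chart_inv c) (at (snd c p)) (v c) else 0))"

definition smooth_vfield ::
  "('m::topological_space, 'e::euclidean_space) chart set \<Rightarrow> ('m, 'e) vfield \<Rightarrow> bool" where
  "smooth_vfield A X \<longleftrightarrow> (\<forall>p. X p \<in> tangent_space A p) \<and>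
     (\<forall>c\<in>A. smooth_on (snd c ` fst c) (\<lambda>x. X (chart_inv c x) c))"

definition vf_add :: "('m, 'e::euclidean_space) vfield \<Rightarrow> ('m, 'e) vfield \<Rightarrow> ('m, 'e) vfield" where
  "vf_add X Y = (\<lambda>p c. X p c + Y p c)"

definition vf_diff :: "('m, 'e::euclidean_space) vfield \<Rightarrow> ('m, 'e) vfield \<Rightarrow> ('m, 'e) vfield" where
  "vf_diff X Y = (\<lambda>p c. X p c - Y p c)"

definition vf_scale :: "('m \<Rightarrow> real) \<Rightarrow> ('m, 'e::euclidean_space) vfield \<Rightarrow> ('m, 'e) vfield" where
  "vf_scale f X = (\<lambda>p c. f p *\<^sub>R X p c)"

definition vf_apply ::
  "('m::topological_space, 'e::euclidean_space) chart set \<Rightarrow> ('m, 'e) vfield \<Rightarrow>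
   ('m \<Rightarrow> real) \<Rightarrow> 'm \<Rightarrow> real" where
  "vf_apply A X f p = (let c = chart_at A p in
     frechet_derivative (f \<circ> chart_inv c) (at (snd c p)) (X p c))"

text \<open>The Lie bracket, in coordinates
  \<open>[X, Y]\<^sup>i = \<Sum>\<^sub>j (X\<^sup>j \<partial>\<^sub>j Y\<^sup>i - Y\<^sup>j \<partial>\<^sub>j X\<^sup>i)\<close>, so that \<open>[X, Y] f = X (Y f) - Y (X f)\<close>.\<close>

definition lie_bracket ::
  "('m::topological_space, 'e::euclidean_space) chart set \<Rightarrow> ('m, 'e) vfield \<Rightarrow> ('m, 'e) vfield \<Rightarrow>
   ('m, 'e) vfield" where
  "lie_bracket A X Y = (\<lambda>p c. if c \<in> A \<and> p \<in> fst c
     then frechet_derivative (\<lambda>x. Y (chart_inv c x) c) (at (snd c p)) (X p c)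
        - frechet_derivative (\<lambda>x. X (chart_inv c x) c) (at (snd c p)) (Y p c)
     else 0)"

section \<open>One-forms, metrics and conformal classes\<close>

text \<open>Tensor fields are functions on all of the types \<open>tvec\<close>; only their values on tangent
  spaces matter.\<close>

type_synonym ('m, 'e) one_form = "'m \<Rightarrow> ('m, 'e) tvec \<Rightarrow> real"
type_synonym ('m, 'e) bilin_form = "'m \<Rightarrow> ('m, 'e) tvec \<Rightarrow> ('m, 'e) tvec \<Rightarrow> real"

definition smooth_one_form ::
  "('m::topological_space, 'e::euclidean_space) chart set \<Rightarrow> ('m, 'e) one_form \<Rightarrow> bool" where
  "smooth_one_form A \<theta> \<longleftrightarrow>
     (\<forall>p. \<forall>u\<in>tangent_space A p. \<forall>v\<in>tangent_space A p. \<forall>a b.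
        \<theta> p (lincomb a u b v) = a * \<theta> p u + b * \<theta> p v) \<and>
     (\<forall>X. smooth_vfield A X \<longrightarrow> smooth_fun A (\<lambda>p. \<theta> p (X p)))"

definition riemannian_metric ::
  "('m::topological_space, 'e::euclidean_space) chart set \<Rightarrow> ('m, 'e) bilin_form \<Rightarrow> bool" where
  "riemannian_metric A g \<longleftrightarrow>
     (\<forall>p. \<forall>u\<in>tangent_space A p. \<forall>v\<in>tangent_space A p.
        g p u v = g p v u \<and>
        (\<forall>w\<in>tangent_space A p. \<forall>a b.
           g p (lincomb a u b v) w = a * g p u w + b * g p v w)) \<and>
     (\<forall>p. \<forall>u\<in>tangent_space A p. u \<noteq> (\<lambda>c. 0) \<longrightarrow> g p u u > 0) \<and>
     (\<forall>X Y. smooth_vfield A X \<and> smooth_vfield A Y \<longrightarrow> smooth_fun A (\<lambda>p. g p (X p) (Y p)))"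

definition conformal_to ::
  "('m::topological_space, 'e::euclidean_space) chart set \<Rightarrow> ('m, 'e) bilin_form \<Rightarrow>
   ('m, 'e) bilin_form \<Rightarrow> bool" where
  "conformal_to A g h \<longleftrightarrow> (\<exists>f. smooth_fun A f \<and> (\<forall>p. f p > 0) \<and>
     (\<forall>p. \<forall>u\<in>tangent_space A p. \<forall>v\<in>tangent_space A p. h p u v = f p * g p u v))"

definition conformal_class ::
  "('m::topological_space, 'e::euclidean_space) chart set \<Rightarrow> ('m, 'e) bilin_form set \<Rightarrow> bool" where
  "conformal_class A C \<longleftrightarrow> (\<exists>g. riemannian_metric A g \<and>
     C = {h. riemannian_metric A h \<and> conformal_to A g h})"

section \<open>Linear connections and curvature\<close>

type_synonym ('m, 'e) connection = "('m, 'e) vfield \<Rightarrow> ('m, 'e) vfield \<Rightarrow> ('m, 'e) vfield"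

definition linear_connection ::
  "('m::topological_space, 'e::euclidean_space) chart set \<Rightarrow> ('m, 'e) connection \<Rightarrow> bool" where
  "linear_connection A nab \<longleftrightarrow>
     (\<forall>X Y. smooth_vfield A X \<and> smooth_vfield A Y \<longrightarrow> smooth_vfield A (nab X Y)) \<and>
     (\<forall>X Y Z. smooth_vfield A X \<and> smooth_vfield A Y \<and> smooth_vfield A Z \<longrightarrow>
        nab (vf_add X Y) Z = vf_add (nab X Z) (nab Y Z) \<and>
        nab X (vf_add Y Z) = vf_add (nab X Y) (nab X Z)) \<and>
     (\<forall>f X Y. smooth_fun A f \<and> smooth_vfield A X \<and> smooth_vfield A Y \<longrightarrow>
        nab (vf_scale f X) Y = vf_scale f (nab X Y) \<and>
        nab X (vf_scale f Y) = vf_add (vf_scale (vf_apply A X f) Y) (vf_scale f (nab X Y)))"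

definition torsion_free ::
  "('m::topological_space, 'e::euclidean_space) chart set \<Rightarrow> ('m, 'e) connection \<Rightarrow> bool" where
  "torsion_free A nab \<longleftrightarrow> (\<forall>X Y. smooth_vfield A X \<and> smooth_vfield A Y \<longrightarrow>
     vf_diff (nab X Y) (nab Y X) = lie_bracket A X Y)"

text \<open>\<open>R(X, Y) Z = \<nabla>\<^bsub>[X, Y]\<^esub> Z - \<nabla>\<^sub>X \<nabla>\<^sub>Y Z + \<nabla>\<^sub>Y \<nabla>\<^sub>X Z\<close>; note the sign.\<close>

definition curvature ::
  "('m::topological_space, 'e::euclidean_space) chart set \<Rightarrow> ('m, 'e) connection \<Rightarrow>
   ('m, 'e) vfield \<Rightarrow> ('m, 'e) vfield \<Rightarrow> ('m, 'e) vfield \<Rightarrow> ('m, 'e) vfield" where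
  "curvature A nab X Y Z =
     vf_add (vf_diff (nab (lie_bracket A X Y) Z) (nab X (nab Y Z))) (nab Y (nab X Z))"

text \<open>The curvature at a point is evaluated on tangent vectors by extending them to arbitrary
  smooth vector fields; by tensoriality the choice is immaterial.\<close>

definition extend_vec ::
  "('m::topological_space, 'e::euclidean_space) chart set \<Rightarrow> 'm \<Rightarrow> ('m, 'e) tvec \<Rightarrow>
   ('m, 'e) vfield" where
  "extend_vec A p v = (SOME X. smooth_vfield A X \<and> X p = v)"

definition curvature_at ::
  "('m::topological_space, 'e::euclidean_space) chart set \<Rightarrow> ('m, 'e) connection \<Rightarrow> 'm \<Rightarrow>
   ('m, 'e) tvec \<Rightarrow> ('m, 'e) tvec \<Rightarrow> ('m, 'e) tvec \<Rightarrow> ('m, 'e) tvec" where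
  "curvature_at A nab p x y z =
     curvature A nab (extend_vec A p x) (extend_vec A p y) (extend_vec A p z) p"

definition tangent_trace ::
  "('m::topological_space, 'e::euclidean_space) chart set \<Rightarrow> 'm \<Rightarrow>
   (('m, 'e) tvec \<Rightarrow> ('m, 'e) tvec) \<Rightarrow> real" where
  "tangent_trace A p L = (let c = chart_at A p in
     (\<Sum>b\<in>Basis. L (coord_vec A c p b) c \<bullet> b))"

definition ricci ::
  "('m::topological_space, 'e::euclidean_space) chart set \<Rightarrow> ('m, 'e) connection \<Rightarrow>
   ('m, 'e) bilin_form" where
  "ricci A nab p x y = tangent_trace A p (\<lambda>z. curvature_at A nab p x z y)"

section \<open>Weyl structures\<close>

text \<open>\<open>\<nabla>g = -2 \<theta> \<otimes> g\<close>, where \<open>(\<nabla>\<^sub>X g)(Y, Z) = X (g(Y, Z)) - g(\<nabla>\<^sub>X Y, Z) - g(Y, \<nabla>\<^sub>X Z)\<close>.\<close>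

definition lee_form ::
  "('m::topological_space, 'e::euclidean_space) chart set \<Rightarrow> ('m, 'e) connection \<Rightarrow>
   ('m, 'e) bilin_form \<Rightarrow> ('m, 'e) one_form \<Rightarrow> bool" where
  "lee_form A nab g \<theta> \<longleftrightarrow> smooth_one_form A \<theta> \<and>
     (\<forall>X Y Z. smooth_vfield A X \<and> smooth_vfield A Y \<and> smooth_vfield A Z \<longrightarrow>
       (\<forall>p. vf_apply A X (\<lambda>q. g q (Y q) (Z q)) p
            - g p (nab X Y p) (Z p) - g p (Y p) (nab X Z p)
          = - 2 * \<theta> p (X p) * g p (Y p) (Z p)))"

definition weyl_structure ::
  "('m::topological_space, 'e::euclidean_space) chart set \<Rightarrow> ('m, 'e) bilin_form set \<Rightarrow>
   ('m, 'e) connection \<Rightarrow> bool" where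
  "weyl_structure A C nab \<longleftrightarrow> linear_connection A nab \<and> torsion_free A nab \<and>
     (\<forall>g\<in>C. \<exists>\<theta>. lee_form A nab g \<theta>)"

definition sym_part :: "('m, 'e) bilin_form \<Rightarrow> ('m, 'e) bilin_form" where
  "sym_part S p u v = (S p u v + S p v u) / 2"

definition orthonormal_basis ::
  "('m::topological_space, 'e::euclidean_space) chart set \<Rightarrow> ('m, 'e) bilin_form \<Rightarrow> 'm \<Rightarrow>
   ('m, 'e) tvec set \<Rightarrow> bool" where
  "orthonormal_basis A g p E \<longleftrightarrow> E \<subseteq> tangent_space A p \<and> card E = DIM('e) \<and>
     (\<forall>u\<in>E. \<forall>v\<in>E. g p u v = (if u = v then 1 else 0))"

definition metric_trace ::
  "('m::topological_space, 'e::euclidean_space) chart set \<Rightarrow> ('m, 'e) bilin_form \<Rightarrow>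
   ('m, 'e) bilin_form \<Rightarrow> 'm \<Rightarrow> real" where
  "metric_trace A g S p = (\<Sum>e\<in>(SOME E. orthonormal_basis A g p E). S p e e)"

definition trace_free_part ::
  "('m::topological_space, 'e::euclidean_space) chart set \<Rightarrow> ('m, 'e) bilin_form \<Rightarrow>
   ('m, 'e) bilin_form \<Rightarrow> ('m, 'e) bilin_form" where
  "trace_free_part A g S p u v =
     S p u v - metric_trace A g S p / real DIM('e) * g p u v"

definition weyl_einstein ::
  "('m::topological_space, 'e::euclidean_space) chart set \<Rightarrow> ('m, 'e) bilin_form set \<Rightarrow>
   ('m, 'e) connection \<Rightarrow> bool" where
  "weyl_einstein A C nab \<longleftrightarrow> (\<exists>g\<in>C. \<forall>p. \<forall>u\<in>tangent_space A p. \<forall>v\<in>tangent_space A p.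
     trace_free_part A g (sym_part (ricci A nab)) p u v = 0)"

section \<open>Lie groups\<close>

definition lie_group ::
  "'g::{t2_space,second_countable_topology} monoid \<Rightarrow> ('g, 'e::euclidean_space) chart set \<Rightarrow> bool"
  where
  "lie_group G A \<longleftrightarrow> group G \<and> carrier G = UNIV \<and> smooth_atlas A \<and>
     smooth_map (prod_atlas A A) A (\<lambda>(x, y). x \<otimes>\<^bsub>G\<^esub> y) \<and>
     smooth_map A A (\<lambda>x. m_inv G x)"

text \<open>Nilpotency is that of the underlying abstract group: the lower central series
  \<open>\<gamma>\<^sub>0 = G\<close>, \<open>\<gamma>\<^bsub>n+1\<^esub> = [G, \<gamma>\<^sub>n]\<close> reaches the trivial subgroup.\<close>

primrec lower_central :: "('g, 'b) monoid_scheme \<Rightarrow> nat \<Rightarrow> 'g set" where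
  "lower_central G 0 = carrier G"
| "lower_central G (Suc n) = generate G
     {x \<otimes>\<^bsub>G\<^esub> y \<otimes>\<^bsub>G\<^esub> m_inv G x \<otimes>\<^bsub>G\<^esub> m_inv G y | x y. x \<in> carrier G \<and> y \<in> lower_central G n}"

definition nilpotent_group :: "('g, 'b) monoid_scheme \<Rightarrow> bool" where
  "nilpotent_group G \<longleftrightarrow> group G \<and> (\<exists>n. lower_central G n = {\<one>\<^bsub>G\<^esub>})"

definition left_invariant_metric ::
  "'g::{t2_space,second_countable_topology} monoid \<Rightarrow> ('g, 'e::euclidean_space) chart set \<Rightarrow>
   ('g, 'e) bilin_form \<Rightarrow> bool" where
  "left_invariant_metric G A g \<longleftrightarrow> riemannian_metric A g \<and>
     (\<forall>h p. \<forall>u\<in>tangent_space A p. \<forall>v\<in>tangent_space A p.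
        g (h \<otimes>\<^bsub>G\<^esub> p) (differential A A (\<lambda>q. h \<otimes>\<^bsub>G\<^esub> q) p u) (differential A A (\<lambda>q. h \<otimes>\<^bsub>G\<^esub> q) p v)
        = g p u v)"

definition left_invariant_form ::
  "'g::{t2_space,second_countable_topology} monoid \<Rightarrow> ('g, 'e::euclidean_space) chart set \<Rightarrow>
   ('g, 'e) one_form \<Rightarrow> bool" where
  "left_invariant_form G A \<theta> \<longleftrightarrow> (\<forall>h p. \<forall>u\<in>tangent_space A p.
     \<theta> (h \<otimes>\<^bsub>G\<^esub> p) (differential A A (\<lambda>q. h \<otimes>\<^bsub>G\<^esub> q) p u) = \<theta> p u)"

definition conformal_lie_group ::
  "'g::{t2_space,second_countable_topology} monoid \<Rightarrow> ('g, 'e::euclidean_space) chart set \<Rightarrow>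
   ('g, 'e) bilin_form set \<Rightarrow> bool" where
  "conformal_lie_group G A C \<longleftrightarrow> lie_group G A \<and> conformal_class A C \<and>
     (\<exists>g\<in>C. left_invariant_metric G A g)"

definition left_invariant_weyl ::
  "'g::{t2_space,second_countable_topology} monoid \<Rightarrow> ('g, 'e::euclidean_space) chart set \<Rightarrow>
   ('g, 'e) bilin_form set \<Rightarrow> ('g, 'e) connection \<Rightarrow> bool" where
  "left_invariant_weyl G A C nab \<longleftrightarrow> weyl_structure A C nab \<and>
     (\<forall>g\<in>C. \<forall>\<theta>. left_invariant_metric G A g \<and> lee_form A nab g \<theta> \<longrightarrow>
        left_invariant_form G A \<theta>)"

end

theory Submission
  imports Defs
begin

text \<open>Left-invariant vector fields identify the tangent space at the identity with \<open>'e\<close>; in a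
  \<open>g\<close>-orthonormal frame the Weyl structure becomes a product \<open>N\<close> with
  \<open>N x y - N y x = [x, y]\<close> and \<open>N x y \<bullet> z + y \<bullet> N x z = 2 (T \<bullet> x) (y \<bullet> z)\<close>, where \<open>T\<close> is dual to
  the Lee form.  Since \<open>Ad h - 1\<close> is the derivative of the commutator map
  \<open>q \<mapsto> h q h\<^sup>-\<^sup>1 q\<^sup>-\<^sup>1\<close> at the identity, nilpotency of the group passes to the
  bracket, and for connected \<open>G\<close> a zero bracket would make all commutator maps constant.

  For a unit vector \<open>x\<close> orthogonal to \<open>[g, g]\<close> and to \<open>T\<close> the Ricci form is at most a constant
  \<open>c\<close> depending only on \<open>T\<close> and \<open>N\<close>; for a unit central vector \<open>z\<close> of \<open>[g, g]\<close> it exceeds \<open>c\<close>.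
  Both vectors exist when the bracket is nilpotent and nonzero, so the symmetrised Ricci form is
  not a multiple of the metric.\<close>

section \<open>Calculus of smooth maps\<close>

text \<open>Why these two vectors separate the Ricci form: in \<open>N i x \<bullet> j\<close> the
  Lee form contributes the wedge of \<open>T\<close> and \<open>x\<close> and the multiple
  \<open>T \<bullet> x\<close> of the metric, the bracket one further term. For \<open>x\<close>
  orthogonal to \<open>[g, g]\<close> that term is minus half the symmetrised \<open>ad x\<close>;
  it lowers the Ricci value by a quarter of the squared norm of that symmetrisation. For central
  \<open>z\<close> it is skew and raises the Ricci value by its own squared norm. The Lee form
  leaves the same constant \<open>c = T \<bullet> tr_vec\<close> in both cases, and for
  \<open>z\<close> also \<open>(n - 2) (T \<bullet> z)^2\<close>, harmless in a lower bound;
  orthogonality of \<open>x\<close> to \<open>T\<close> keeps such a term out of the upper bound.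
  The step from group to algebra works without an exponential map: the bracket and \<open>Ad\<close>
  come from derivatives of the group law, and translations carry other points to the identity. The
  connection is not given as left-invariant; the Koszul formula expresses it by invariant data.
  Curvature at a point is defined through chosen extensions, so tensoriality has to be proved; the
  global left-invariant frame makes it short.\<close>

lemma has_derivative_fd:
  "f differentiable (at x) \<Longrightarrow> (f has_derivative frechet_derivative f (at x)) (at x)"
  by (simp add: frechet_derivative_works)

lemma fd_eq: "(f has_derivative f') (at x) \<Longrightarrow> frechet_derivative f (at x) = f'"
  by (metis frechet_derivative_at)

lemma fd_linear: "f differentiable (at x) \<Longrightarrow> linear (frechet_derivative f (at x))"
  by (simp add: linear_frechet_derivative)

lemma differentiable_cong_open:
  assumes "f differentiable (at x)" "open S" "x \<in> S" "\<And>y. y \<in> S \<Longrightarrow> f y = g y"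
  shows "g differentiable (at x)"
  using assms has_derivative_transform_within_open unfolding differentiable_def by blast

lemma Ck_on_cong:
  assumes "open S" "\<And>x. x \<in> S \<Longrightarrow> f x = g x" "Ck_on k S f"
  shows "Ck_on k S g"
  using assms(2,3)
proof (induction k arbitrary: f g)
  case 0
  then show ?case by (auto cong: continuous_on_cong)
next
  case (Suc k)
  have eq: "frechet_derivative f (at x) = frechet_derivative g (at x)" if "x \<in> S" for x
    using frechet_derivative_transform_within_open[of f x S g] Suc.prems that assms(1) by auto
  show ?case
  proof (simp, intro conjI allI ballI)
    fix x assume "x \<in> S"
    then show "g differentiable (at x)"
      using differentiable_cong_open[of f x S g] Suc.prems assms(1) by auto
  next
    fix v
    show "Ck_on k S (\<lambda>x. frechet_derivative g (at x) v)"
      by (rule Suc.IH[of "\<lambda>x. frechet_derivative f (at x) v"]) (use eq Suc.prems in auto)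
  qed
qed

lemma Ck_on_SucD: "Ck_on (Suc k) S f \<Longrightarrow> Ck_on k S f"
proof (induction k arbitrary: f)
  case 0
  then show ?case
    by (simp add: continuous_at_imp_continuous_on differentiable_imp_continuous_within)
next
  case (Suc k)
  show ?case using Suc.prems by (auto intro: Suc.IH)
qed

lemma Ck_on_subset: "Ck_on k S f \<Longrightarrow> T \<subseteq> S \<Longrightarrow> Ck_on k T f"
  by (induction k arbitrary: f) (auto intro: continuous_on_subset)

lemma Ck_on_const: "Ck_on k S (\<lambda>x. c)"
  by (induction k arbitrary: c) auto

lemma Ck_on_linear: "bounded_linear f \<Longrightarrow> Ck_on k S f"
proof (induction k)
  case 0
  then show ?case by (simp add: linear_continuous_on)
next
  case (Suc k)
  have "(f has_derivative f) (at x)" for x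
    using Suc.prems by (rule bounded_linear_imp_has_derivative)
  then have "frechet_derivative f (at x) = f" "f differentiable (at x)" for x
    using fd_eq by (blast, auto simp: differentiable_def)
  then show ?case by (simp add: Ck_on_const)
qed

text \<open>\<open>Ck_on\<close> is phrased with \<open>frechet_derivative\<close>, while derivative
  rules produce some explicit derivative. On an open set the two agree pointwise, so
  \<open>Ck_on_cong\<close> exchanges them; the closure inductions below run through this
  rule.\<close>

lemma Ck_on_SucI:
  assumes "open S" "\<And>x. x \<in> S \<Longrightarrow> (f has_derivative f' x) (at x)"
    and "\<And>v. Ck_on k S (\<lambda>x. f' x v)"
  shows "Ck_on (Suc k) S f"
proof (simp, intro conjI allI ballI)
  fix x assume "x \<in> S"
  then show "f differentiable (at x)" using assms(2) by (auto simp: differentiable_def)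
next
  fix v
  show "Ck_on k S (\<lambda>x. frechet_derivative f (at x) v)"
    by (rule Ck_on_cong[OF assms(1) _ assms(3)[of v]]) (use assms(2) fd_eq in metis)
qed

lemma Ck_on_SucE:
  assumes "Ck_on (Suc k) S f"
  obtains f' where "\<And>x. x \<in> S \<Longrightarrow> (f has_derivative f' x) (at x)" "\<And>v. Ck_on k S (\<lambda>x. f' x v)"
  using assms has_derivative_fd that[of "\<lambda>x. frechet_derivative f (at x)"] by auto

lemma Ck_on_add:
  assumes "open S" "Ck_on k S f" "Ck_on k S g"
  shows "Ck_on k S (\<lambda>x. f x + g x)"
  using assms(2,3)
proof (induction k arbitrary: f g)
  case 0
  then show ?case by (simp add: continuous_on_add)
next
  case (Suc k)
  obtain f' g' where
    f: "\<And>x. x \<in> S \<Longrightarrow> (f has_derivative f' x) (at x)" "\<And>v. Ck_on k S (\<lambda>x. f' x v)" and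
    g: "\<And>x. x \<in> S \<Longrightarrow> (g has_derivative g' x) (at x)" "\<And>v. Ck_on k S (\<lambda>x. g' x v)"
    using Suc.prems Ck_on_SucE by metis
  show ?case
    by (rule Ck_on_SucI[OF assms(1) has_derivative_add[OF f(1) g(1)]]) (auto intro: Suc.IH f g)
qed

lemma Ck_on_scaleR:
  fixes f :: "'a::real_normed_vector \<Rightarrow> real"
  assumes "open S" "Ck_on k S f" "Ck_on k S g"
  shows "Ck_on k S (\<lambda>x. f x *\<^sub>R g x)"
  using assms(2,3)
proof (induction k arbitrary: f g)
  case 0
  then show ?case by (simp add: continuous_on_scaleR)
next
  case (Suc k)
  obtain f' g' where
    f: "\<And>x. x \<in> S \<Longrightarrow> (f has_derivative f' x) (at x)" "\<And>v. Ck_on k S (\<lambda>x. f' x v)" and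
    g: "\<And>x. x \<in> S \<Longrightarrow> (g has_derivative g' x) (at x)" "\<And>v. Ck_on k S (\<lambda>x. g' x v)"
    using Suc.prems Ck_on_SucE by metis
  show ?case
    by (rule Ck_on_SucI[OF assms(1) has_derivative_scaleR[OF f(1) g(1)]])
      (auto intro!: Suc.IH f g Ck_on_add assms(1) intro: Ck_on_SucD[OF Suc.prems(1)] Ck_on_SucD[OF Suc.prems(2)])
qed

lemma Ck_on_sum:
  assumes "open S" "\<And>i. i \<in> I \<Longrightarrow> Ck_on k S (f i)"
  shows "Ck_on k S (\<lambda>x. \<Sum>i\<in>I. f i x)"
  using assms(2)
  by (induction I rule: infinite_finite_induct) (auto intro: Ck_on_const Ck_on_add assms(1))

lemma Ck_on_Pair:
  assumes "open S" "Ck_on k S f" "Ck_on k S g"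
  shows "Ck_on k S (\<lambda>x. (f x, g x))"
  using assms(2,3)
proof (induction k arbitrary: f g)
  case 0
  then show ?case by (simp add: continuous_on_Pair)
next
  case (Suc k)
  obtain f' g' where
    f: "\<And>x. x \<in> S \<Longrightarrow> (f has_derivative f' x) (at x)" "\<And>v. Ck_on k S (\<lambda>x. f' x v)" and
    g: "\<And>x. x \<in> S \<Longrightarrow> (g has_derivative g' x) (at x)" "\<And>v. Ck_on k S (\<lambda>x. g' x v)"
    using Suc.prems Ck_on_SucE by metis
  show ?case
    by (rule Ck_on_SucI[OF assms(1) has_derivative_Pair[OF f(1) g(1)]]) (auto intro: Suc.IH f g)
qed

lemma linear_Basis_expansion:
  fixes L :: "'a::euclidean_space \<Rightarrow> 'b::real_vector"
  assumes "linear L"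
  shows "L v = (\<Sum>b\<in>Basis. (v \<bullet> b) *\<^sub>R L b)"
proof -
  have "L v = L (\<Sum>b\<in>Basis. (v \<bullet> b) *\<^sub>R b)" by (simp add: euclidean_representation)
  also have "\<dots> = (\<Sum>b\<in>Basis. (v \<bullet> b) *\<^sub>R L b)"
    by (simp add: linear_sum[OF assms] linear_scale[OF assms])
  finally show ?thesis .
qed

lemma Ck_on_inner_const:
  fixes f :: "'a::real_normed_vector \<Rightarrow> 'b::euclidean_space"
  assumes "open S" "Ck_on k S f"
  shows "Ck_on k S (\<lambda>x. f x \<bullet> b)"
  using assms(2)
proof (induction k arbitrary: f)
  case 0
  then show ?case by (simp add: continuous_on_inner)
next
  case (Suc k)
  obtain f' where
    f: "\<And>x. x \<in> S \<Longrightarrow> (f has_derivative f' x) (at x)" "\<And>v. Ck_on k S (\<lambda>x. f' x v)"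
    using Suc.prems Ck_on_SucE by metis
  show ?case
    by (rule Ck_on_SucI[OF assms(1) has_derivative_inner_left[OF f(1)]]) (auto intro: Suc.IH f)
qed

text \<open>The chain rule evaluates the outer derivative in a direction that varies with the point,
  whereas \<open>Ck_on\<close> only controls fixed directions. Expanding that direction in
  \<open>Basis\<close> turns the derivative into a sum of products, to which the induction
  hypothesis and the product rule apply.\<close>

lemma Ck_on_compose:
  fixes f :: "'b::euclidean_space \<Rightarrow> 'c::real_normed_vector" and g :: "'a::real_normed_vector \<Rightarrow> 'b"
  assumes "open S" "g ` S \<subseteq> T" "Ck_on k T f" "Ck_on k S g"
  shows "Ck_on k S (\<lambda>x. f (g x))"
  using assms(3,4)
proof (induction k arbitrary: f)
  case 0
  then show ?case using assms(2) by (auto intro: continuous_on_compose2)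
next
  case (Suc k)
  obtain f' g' where
    f: "\<And>x. x \<in> T \<Longrightarrow> (f has_derivative f' x) (at x)" "\<And>v. Ck_on k T (\<lambda>x. f' x v)" and
    g: "\<And>x. x \<in> S \<Longrightarrow> (g has_derivative g' x) (at x)" "\<And>v. Ck_on k S (\<lambda>x. g' x v)"
    using Suc.prems Ck_on_SucE by metis
  show ?case
  proof (rule Ck_on_SucI[OF assms(1)])
    fix x assume x: "x \<in> S"
    have fx: "(f has_derivative f' (g x)) (at (g x))" using x assms(2) f(1) by auto
    have "((\<lambda>x. f (g x)) has_derivative (\<lambda>v. f' (g x) (g' x v))) (at x)"
      using diff_chain_at[OF g(1)[OF x] fx] by (simp add: o_def)
    moreover have "f' (g x) (g' x v) = (\<Sum>b\<in>Basis. (g' x v \<bullet> b) *\<^sub>R f' (g x) b)" for v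
      by (rule linear_Basis_expansion) (rule has_derivative_linear[OF fx])
    ultimately show "((\<lambda>x. f (g x)) has_derivative (\<lambda>v. \<Sum>b\<in>Basis. (g' x v \<bullet> b) *\<^sub>R f' (g x) b)) (at x)"
      by simp
  next
    fix v
    show "Ck_on k S (\<lambda>x. \<Sum>b\<in>Basis. (g' x v \<bullet> b) *\<^sub>R f' (g x) b)"
      by (intro Ck_on_sum assms(1) Ck_on_scaleR Ck_on_inner_const g(2) Suc.IH f(2)
          Ck_on_SucD[OF Suc.prems(2)])
  qed
qed

lemma smooth_on_cong:
  "open S \<Longrightarrow> (\<And>x. x \<in> S \<Longrightarrow> f x = g x) \<Longrightarrow> smooth_on S f \<Longrightarrow> smooth_on S g"
  unfolding smooth_on_def using Ck_on_cong by blast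

lemma smooth_on_subset: "smooth_on S f \<Longrightarrow> T \<subseteq> S \<Longrightarrow> smooth_on T f"
  unfolding smooth_on_def using Ck_on_subset by blast

lemma smooth_on_const: "smooth_on S (\<lambda>x. c)"
  by (simp add: smooth_on_def Ck_on_const)

lemma smooth_on_linear: "bounded_linear f \<Longrightarrow> smooth_on S f"
  by (simp add: smooth_on_def Ck_on_linear)

lemma smooth_on_add:
  "open S \<Longrightarrow> smooth_on S f \<Longrightarrow> smooth_on S g \<Longrightarrow> smooth_on S (\<lambda>x. f x + g x)"
  by (simp add: smooth_on_def Ck_on_add)

lemma smooth_on_scaleR:
  fixes f :: "'a::real_normed_vector \<Rightarrow> real"
  shows "open S \<Longrightarrow> smooth_on S f \<Longrightarrow> smooth_on S g \<Longrightarrow> smooth_on S (\<lambda>x. f x *\<^sub>R g x)"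
  by (simp add: smooth_on_def Ck_on_scaleR)

lemma smooth_on_sum:
  "open S \<Longrightarrow> (\<And>i. i \<in> I \<Longrightarrow> smooth_on S (f i)) \<Longrightarrow> smooth_on S (\<lambda>x. \<Sum>i\<in>I. f i x)"
  by (simp add: smooth_on_def Ck_on_sum)

lemma smooth_on_diff:
  assumes "open S" "smooth_on S f" "smooth_on S g"
  shows "smooth_on S (\<lambda>x. f x - g x)"
  using smooth_on_add[OF assms(1,2) smooth_on_scaleR[OF assms(1) smooth_on_const[of S "-1"] assms(3)]]
  by simp

lemma smooth_on_Pair:
  "open S \<Longrightarrow> smooth_on S f \<Longrightarrow> smooth_on S g \<Longrightarrow> smooth_on S (\<lambda>x. (f x, g x))"
  by (simp add: smooth_on_def Ck_on_Pair)

lemma smooth_on_inner_const: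
  fixes f :: "'a::real_normed_vector \<Rightarrow> 'b::euclidean_space"
  shows "open S \<Longrightarrow> smooth_on S f \<Longrightarrow> smooth_on S (\<lambda>x. f x \<bullet> b)"
  by (simp add: smooth_on_def Ck_on_inner_const)

lemma smooth_on_compose:
  fixes f :: "'b::euclidean_space \<Rightarrow> 'c::real_normed_vector" and g :: "'a::real_normed_vector \<Rightarrow> 'b"
  shows "open S \<Longrightarrow> g ` S \<subseteq> T \<Longrightarrow> smooth_on T f \<Longrightarrow> smooth_on S g \<Longrightarrow> smooth_on S (\<lambda>x. f (g x))"
  by (simp add: smooth_on_def Ck_on_compose[where f=f and T=T])

lemma smooth_on_differentiable: "smooth_on S f \<Longrightarrow> x \<in> S \<Longrightarrow> f differentiable (at x)"
  unfolding smooth_on_def by (metis Ck_on.simps(2))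

lemma smooth_on_has_derivative:
  "smooth_on S f \<Longrightarrow> x \<in> S \<Longrightarrow> (f has_derivative frechet_derivative f (at x)) (at x)"
  by (simp add: smooth_on_differentiable has_derivative_fd)

lemma smooth_on_continuous: "smooth_on S f \<Longrightarrow> continuous_on S f"
  unfolding smooth_on_def by (metis Ck_on.simps(1))

lemma smooth_on_fd: "smooth_on S f \<Longrightarrow> smooth_on S (\<lambda>x. frechet_derivative f (at x) v)"
  unfolding smooth_on_def by (metis Ck_on.simps(2))

lemma smooth_on_fd_apply:
  fixes f :: "'a::euclidean_space \<Rightarrow> 'b::real_normed_vector"
  assumes "open S" "smooth_on S f" "smooth_on S v"
  shows "smooth_on S (\<lambda>x. frechet_derivative f (at x) (v x))"
proof (rule smooth_on_cong[OF assms(1)])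
  show "smooth_on S (\<lambda>x. \<Sum>b\<in>Basis. (v x \<bullet> b) *\<^sub>R frechet_derivative f (at x) b)"
    by (intro smooth_on_sum smooth_on_scaleR smooth_on_inner_const smooth_on_fd assms)
  show "(\<Sum>b\<in>Basis. (v x \<bullet> b) *\<^sub>R frechet_derivative f (at x) b) = frechet_derivative f (at x) (v x)"
    if "x \<in> S" for x
    by (rule linear_Basis_expansion[symmetric]) (rule fd_linear[OF smooth_on_differentiable[OF assms(2) that]])
qed

section \<open>Second derivatives and their symmetry\<close>

definition second_deriv :: "('a::real_normed_vector \<Rightarrow> 'b::real_normed_vector) \<Rightarrow> 'a \<Rightarrow> 'a \<Rightarrow> 'a \<Rightarrow> 'b"
  where "second_deriv f x u v = frechet_derivative (\<lambda>x. frechet_derivative f (at x) v) (at x) u"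

text \<open>Both the base point and the direction move; expanding the direction in
  \<open>Basis\<close> reduces this to the product rule. The second-order computations with the
  group law below are instances, for suitable \<open>\<phi>\<close> and \<open>v\<close>.\<close>

lemma has_derivative_fd_apply:
  fixes f :: "'a::euclidean_space \<Rightarrow> 'b::real_normed_vector" and \<phi> v :: "'c::real_normed_vector \<Rightarrow> 'a"
  assumes S: "open S" and f: "smooth_on S f" and z: "\<phi> z \<in> S"
    and \<phi>: "(\<phi> has_derivative \<phi>') (at z)" and v: "(v has_derivative v') (at z)"
  shows "((\<lambda>z. frechet_derivative f (at (\<phi> z)) (v z)) has_derivative
    (\<lambda>a. second_deriv f (\<phi> z) (\<phi>' a) (v z) + frechet_derivative f (at (\<phi> z)) (v' a))) (at z)"
proof -
  let ?D = "\<lambda>x. frechet_derivative f (at x)"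
  have lin: "?D x v = (\<Sum>b\<in>Basis. (v \<bullet> b) *\<^sub>R ?D x b)" if "x \<in> S" for x v
    by (rule linear_Basis_expansion) (simp add: fd_linear smooth_on_differentiable[OF f that])
  have d2: "((\<lambda>x. ?D x b) has_derivative (\<lambda>u. second_deriv f x u b)) (at x)" if "x \<in> S" for x b
    unfolding second_deriv_def
    by (rule smooth_on_has_derivative[OF smooth_on_fd[OF f] that])
  \<comment> \<open>Linearity in the inner direction is inherited from the first derivative; only
    linearity in the outer one is automatic.\<close>
  have lin2: "second_deriv f x u v = (\<Sum>b\<in>Basis. (v \<bullet> b) *\<^sub>R second_deriv f x u b)" if "x \<in> S" for x u v
  proof -
    have "((\<lambda>x. \<Sum>b\<in>Basis. (v \<bullet> b) *\<^sub>R ?D x b) has_derivative (\<lambda>u. \<Sum>b\<in>Basis. (v \<bullet> b) *\<^sub>R second_deriv f x u b)) (at x)"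
      by (intro has_derivative_sum has_derivative_scaleR_right d2 that)
    then have "((\<lambda>x. ?D x v) has_derivative (\<lambda>u. \<Sum>b\<in>Basis. (v \<bullet> b) *\<^sub>R second_deriv f x u b)) (at x)"
      by (rule has_derivative_transform_within_open[OF _ S that]) (use lin in metis)
    from fd_eq[OF this] show ?thesis unfolding second_deriv_def[of f x u v] by metis
  qed
  have "((\<lambda>z. \<Sum>b\<in>Basis. (v z \<bullet> b) *\<^sub>R ?D (\<phi> z) b) has_derivative
     (\<lambda>a. \<Sum>b\<in>Basis. (v z \<bullet> b) *\<^sub>R second_deriv f (\<phi> z) (\<phi>' a) b + (v' a \<bullet> b) *\<^sub>R ?D (\<phi> z) b)) (at z)"
    by (intro has_derivative_sum has_derivative_scaleR has_derivative_inner_left v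
        has_derivative_compose[OF \<phi> d2[OF z]])
  also have "(\<lambda>a. \<Sum>b\<in>Basis. (v z \<bullet> b) *\<^sub>R second_deriv f (\<phi> z) (\<phi>' a) b + (v' a \<bullet> b) *\<^sub>R ?D (\<phi> z) b)
     = (\<lambda>a. second_deriv f (\<phi> z) (\<phi>' a) (v z) + ?D (\<phi> z) (v' a))"
    by (rule ext) (simp add: sum.distrib lin[OF z, symmetric] lin2[OF z, symmetric])
  finally have d: "((\<lambda>z. \<Sum>b\<in>Basis. (v z \<bullet> b) *\<^sub>R ?D (\<phi> z) b) has_derivative
     (\<lambda>a. second_deriv f (\<phi> z) (\<phi>' a) (v z) + ?D (\<phi> z) (v' a))) (at z)" .
  have "isCont \<phi> z" using \<phi> has_derivative_continuous by blast
  then have "\<forall>\<^sub>F y in at z. \<phi> y \<in> S"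
    using S z by (simp add: isCont_def tendsto_def)
  then have ev: "\<forall>\<^sub>F y in at z. (\<Sum>b\<in>Basis. (v y \<bullet> b) *\<^sub>R ?D (\<phi> y) b) = ?D (\<phi> y) (v y)"
    by eventually_elim (rule lin[symmetric])
  show ?thesis
    by (rule has_derivative_transform_eventually[OF d ev lin[OF z, symmetric] UNIV_I])
qed

lemma second_deriv_linear_left:
  assumes "smooth_on S f" "x \<in> S" shows "linear (\<lambda>u. second_deriv f x u v)"
  unfolding second_deriv_def
  by (rule fd_linear[OF smooth_on_differentiable[OF smooth_on_fd[OF assms(1)] assms(2)]])

lemma has_derivative_line: "((\<lambda>s. x + s *\<^sub>R u) has_derivative (\<lambda>s. s *\<^sub>R u)) (at s)"
  by (auto intro!: derivative_eq_intros)

text \<open>The mean value theorem twice: along \<open>u\<close> for the difference of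
  \<open>f\<close> on two parallel segments, then along \<open>v\<close> for the derivative in
  direction \<open>u\<close>. The bound on \<open>t\<close> keeps the whole parallelogram in the
  ball.\<close>

lemma second_difference:
  fixes f :: "'a::euclidean_space \<Rightarrow> real"
  assumes f: "smooth_on (ball x e) f" and t: "0 < t" "t * (norm u + norm v) < e"
  shows "\<exists>\<sigma> \<tau>. 0 < \<sigma> \<and> \<sigma> < t \<and> 0 < \<tau> \<and> \<tau> < t \<and>
    f (x + t *\<^sub>R u + t *\<^sub>R v) - f (x + t *\<^sub>R u) - f (x + t *\<^sub>R v) + f x
     = t * (t * second_deriv f (x + \<sigma> *\<^sub>R u + \<tau> *\<^sub>R v) v u)"
proof -
  have inb: "x + s *\<^sub>R u + r *\<^sub>R v \<in> ball x e" if "0 \<le> s" "s \<le> t" "0 \<le> r" "r \<le> t" for s r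
  proof -
    have "norm (s *\<^sub>R u + r *\<^sub>R v) \<le> s * norm u + r * norm v"
      using norm_triangle_ineq[of "s *\<^sub>R u" "r *\<^sub>R v"] that by simp
    also have "\<dots> \<le> t * norm u + t * norm v"
      by (intro add_mono mult_right_mono that) auto
    also have "\<dots> < e" using t(2) by (simp add: algebra_simps)
    finally show ?thesis by (simp add: dist_norm norm_minus_commute algebra_simps)
  qed
  let ?D = "\<lambda>y. frechet_derivative f (at y)"
  define h where "h s = f (x + t *\<^sub>R v + s *\<^sub>R u) - f (x + s *\<^sub>R u)" for s
  have hd: "(h has_derivative (\<lambda>r. ?D (x + t *\<^sub>R v + s *\<^sub>R u) (r *\<^sub>R u) - ?D (x + s *\<^sub>R u) (r *\<^sub>R u))) (at s)"
    if "0 \<le> s" "s \<le> t" for s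
    unfolding h_def
    by (intro has_derivative_diff has_derivative_compose[OF has_derivative_line]
        smooth_on_has_derivative[OF f]) (use inb[OF that, of t] inb[OF that, of 0] t in \<open>auto simp: algebra_simps\<close>)
  have "\<exists>\<sigma>\<in>{0<..<t}. h t - h 0 = (\<lambda>r. ?D (x + t *\<^sub>R v + \<sigma> *\<^sub>R u) (r *\<^sub>R u) - ?D (x + \<sigma> *\<^sub>R u) (r *\<^sub>R u)) (t - 0)"
    by (rule mvt_simple[OF t(1), where f'="\<lambda>\<sigma> r. ?D (x + t *\<^sub>R v + \<sigma> *\<^sub>R u) (r *\<^sub>R u) - ?D (x + \<sigma> *\<^sub>R u) (r *\<^sub>R u)"])
      (use hd in \<open>auto intro: has_derivative_at_withinI\<close>)
  then obtain \<sigma> where \<sigma>: "0 < \<sigma>" "\<sigma> < t"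
    "h t - h 0 = ?D (x + t *\<^sub>R v + \<sigma> *\<^sub>R u) (t *\<^sub>R u) - ?D (x + \<sigma> *\<^sub>R u) (t *\<^sub>R u)"
    by auto
  define k where "k r = ?D (x + \<sigma> *\<^sub>R u + r *\<^sub>R v) u" for r
  have kd: "(k has_derivative (\<lambda>q. second_deriv f (x + \<sigma> *\<^sub>R u + r *\<^sub>R v) (q *\<^sub>R v) u)) (at r)"
    if "0 \<le> r" "r \<le> t" for r
    unfolding k_def second_deriv_def
    by (intro has_derivative_compose[OF has_derivative_line] smooth_on_has_derivative[OF smooth_on_fd[OF f]])
      (use inb[of \<sigma> r] that \<sigma> in auto)
  have "\<exists>\<tau>\<in>{0<..<t}. k t - k 0 = (\<lambda>q. second_deriv f (x + \<sigma> *\<^sub>R u + \<tau> *\<^sub>R v) (q *\<^sub>R v) u) (t - 0)"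
    by (rule mvt_simple[OF t(1), where f'="\<lambda>r q. second_deriv f (x + \<sigma> *\<^sub>R u + r *\<^sub>R v) (q *\<^sub>R v) u"])
      (use kd in \<open>auto intro: has_derivative_at_withinI\<close>)
  then obtain \<tau> where \<tau>: "0 < \<tau>" "\<tau> < t"
    "k t - k 0 = second_deriv f (x + \<sigma> *\<^sub>R u + \<tau> *\<^sub>R v) (t *\<^sub>R v) u"
    by auto
  have l: "?D y (t *\<^sub>R u) = t * ?D y u" if "y \<in> ball x e" for y
    using linear_scale[OF fd_linear[OF smooth_on_differentiable[OF f that]]] by simp
  have b: "x + \<sigma> *\<^sub>R u + r *\<^sub>R v \<in> ball x e" if "0 \<le> r" "r \<le> t" for r using inb[of \<sigma> r] \<sigma> that by auto
  have "h t - h 0 = t * (k t - k 0)"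
    unfolding \<sigma>(3) k_def using l[OF b[of t]] l[OF b[of 0]] t(1) by (simp add: algebra_simps)
  also have "k t - k 0 = t * second_deriv f (x + \<sigma> *\<^sub>R u + \<tau> *\<^sub>R v) v u"
    unfolding \<tau>(3) using linear_scale[OF second_deriv_linear_left[OF f b[of \<tau>]], of t v] \<tau> by simp
  finally show ?thesis using \<sigma>(1,2) \<tau>(1,2) unfolding h_def
    by (intro exI[of _ \<sigma>] exI[of _ \<tau>]) (simp add: algebra_simps)
qed

lemma second_deriv_continuous:
  "smooth_on S f \<Longrightarrow> continuous_on S (\<lambda>x. second_deriv f x u v)"
  unfolding second_deriv_def by (rule smooth_on_continuous[OF smooth_on_fd[OF smooth_on_fd]])

text \<open>The second difference is symmetric in \<open>u\<close> and \<open>v\<close>, so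
  \<open>second_difference\<close> yields equal values of the two mixed derivatives at two points
  near \<open>x\<close>; continuity then excludes a gap at \<open>x\<close>.\<close>

lemma second_deriv_commute_real:
  fixes f :: "'a::euclidean_space \<Rightarrow> real"
  assumes S: "open S" "x \<in> S" and f: "smooth_on S f"
  shows "second_deriv f x u v = second_deriv f x v u"
proof (rule ccontr)
  \<comment> \<open>Half the gap: one common value cannot lie within less than \<open>?d\<close> of
    both derivatives.\<close>
  let ?d = "\<bar>second_deriv f x u v - second_deriv f x v u\<bar> / 2"
  assume "second_deriv f x u v \<noteq> second_deriv f x v u"
  then have d: "?d > 0" by simp
  have c: "isCont (\<lambda>y. second_deriv f y u v) x" for u v
    using second_deriv_continuous[OF f] S continuous_on_eq_continuous_at by blast
  obtain e1 where e1: "e1 > 0" "\<And>y. dist y x < e1 \<Longrightarrow> \<bar>second_deriv f y u v - second_deriv f x u v\<bar> < ?d"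
    using c[of u v] d unfolding continuous_at_eps_delta dist_real_def by metis
  obtain e2 where e2: "e2 > 0" "\<And>y. dist y x < e2 \<Longrightarrow> \<bar>second_deriv f y v u - second_deriv f x v u\<bar> < ?d"
    using c[of v u] d unfolding continuous_at_eps_delta dist_real_def by metis
  obtain e3 where e3: "e3 > 0" "ball x e3 \<subseteq> S" using S open_contains_ball by blast
  define e where "e = min e1 (min e2 e3)"
  have e: "e > 0" "e \<le> e1" "e \<le> e2" "e \<le> e3" using e1 e2 e3 by (auto simp: e_def)
  \<comment> \<open>The \<open>1\<close> keeps the denominator positive when \<open>u\<close> and
    \<open>v\<close> vanish; the factor \<open>2\<close> leaves \<open>t * (norm u + norm v)\<close>
    strictly below \<open>e\<close>.\<close>
  define t where "t = e / (2 * (norm u + norm v + 1))"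
  have n: "norm u + norm v + 1 > 0" by (smt (verit) norm_ge_zero)
  have t: "t > 0" using e n by (simp add: t_def)
  have te: "t * (norm u + norm v) < e"
  proof -
    have "t * (norm u + norm v) \<le> t * (norm u + norm v + 1)" using t by (intro mult_left_mono) auto
    also have "\<dots> = e / 2" using n by (simp add: t_def field_simps)
    finally show ?thesis using e by simp
  qed
  have inb: "dist (x + s *\<^sub>R u + r *\<^sub>R v) x < e" if "0 < s" "s < t" "0 < r" "r < t" for s r
  proof -
    have "norm (s *\<^sub>R u + r *\<^sub>R v) \<le> s * norm u + r * norm v"
      using norm_triangle_ineq[of "s *\<^sub>R u" "r *\<^sub>R v"] that by simp
    also have "\<dots> \<le> t * norm u + t * norm v"
      by (intro add_mono mult_right_mono) (use that in auto)
    also have "\<dots> < e" using te by (simp add: algebra_simps)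
    finally show ?thesis by (simp add: dist_norm norm_minus_commute algebra_simps)
  qed
  have f': "smooth_on (ball x e) f"
    by (rule smooth_on_subset[OF f]) (use e3(2) e(4) in \<open>auto simp: subset_iff\<close>)
  obtain s1 r1 where 1: "0 < s1" "s1 < t" "0 < r1" "r1 < t"
    "f (x + t *\<^sub>R u + t *\<^sub>R v) - f (x + t *\<^sub>R u) - f (x + t *\<^sub>R v) + f x
     = t * (t * second_deriv f (x + s1 *\<^sub>R u + r1 *\<^sub>R v) v u)"
    using second_difference[OF f' t te] by blast
  obtain s2 r2 where 2: "0 < s2" "s2 < t" "0 < r2" "r2 < t"
    "f (x + t *\<^sub>R v + t *\<^sub>R u) - f (x + t *\<^sub>R v) - f (x + t *\<^sub>R u) + f x
     = t * (t * second_deriv f (x + s2 *\<^sub>R v + r2 *\<^sub>R u) u v)"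
    using second_difference[OF f' t, of v u] te by (auto simp: add.commute)
  have "t * (t * second_deriv f (x + s1 *\<^sub>R u + r1 *\<^sub>R v) v u) = t * (t * second_deriv f (x + s2 *\<^sub>R v + r2 *\<^sub>R u) u v)"
    using 1(5) 2(5) by (simp add: algebra_simps)
  then have eq: "second_deriv f (x + s1 *\<^sub>R u + r1 *\<^sub>R v) v u = second_deriv f (x + r2 *\<^sub>R u + s2 *\<^sub>R v) u v"
    using t by (simp add: algebra_simps)
  have "\<bar>second_deriv f (x + s1 *\<^sub>R u + r1 *\<^sub>R v) v u - second_deriv f x v u\<bar> < ?d"
    by (rule e2(2)) (use inb[OF 1(1-4)] e in linarith)
  moreover have "\<bar>second_deriv f (x + r2 *\<^sub>R u + s2 *\<^sub>R v) u v - second_deriv f x u v\<bar> < ?d"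
    by (rule e1(2)) (use inb[OF 2(3,4,1,2)] e in linarith)
  ultimately show False using eq by (simp add: abs_if split: if_splits)
qed

lemma second_deriv_commute:
  fixes f :: "'a::euclidean_space \<Rightarrow> 'b::euclidean_space"
  assumes S: "open S" "x \<in> S" and f: "smooth_on S f"
  shows "second_deriv f x u v = second_deriv f x v u"
proof (rule euclidean_eqI)
  fix b :: 'b assume "b \<in> Basis"
  have 1: "frechet_derivative (\<lambda>x. f x \<bullet> b) (at y) v = frechet_derivative f (at y) v \<bullet> b" if "y \<in> S" for y v
    using fd_eq[OF has_derivative_inner_left[OF smooth_on_has_derivative[OF f that]]] by metis
  have 2: "second_deriv (\<lambda>x. f x \<bullet> b) x u v = second_deriv f x u v \<bullet> b" for u v
  proof -
    have "((\<lambda>x. frechet_derivative f (at x) v \<bullet> b) has_derivative (\<lambda>u. second_deriv f x u v \<bullet> b)) (at x)"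
      unfolding second_deriv_def
      by (intro has_derivative_inner_left smooth_on_has_derivative[OF smooth_on_fd[OF f] S(2)])
    then have "((\<lambda>x. frechet_derivative (\<lambda>x. f x \<bullet> b) (at x) v) has_derivative (\<lambda>u. second_deriv f x u v \<bullet> b)) (at x)"
      by (rule has_derivative_transform_within_open[OF _ S]) (use 1 in metis)
    from fd_eq[OF this] show ?thesis unfolding second_deriv_def[of "\<lambda>x. f x \<bullet> b"] by metis
  qed
  show "second_deriv f x u v \<bullet> b = second_deriv f x v u \<bullet> b"
    using second_deriv_commute_real[OF S smooth_on_inner_const[OF S(1) f, of b]] 2 by metis
qed

lemma second_deriv_linear_right:
  fixes f :: "'a::euclidean_space \<Rightarrow> 'b::euclidean_space"
  assumes "open S" "x \<in> S" "smooth_on S f"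
  shows "linear (\<lambda>v. second_deriv f x u v)"
proof -
  have "(\<lambda>v. second_deriv f x u v) = (\<lambda>v. second_deriv f x v u)"
    by (rule ext) (rule second_deriv_commute[OF assms])
  then show ?thesis using second_deriv_linear_left[OF assms(3,2)] by simp
qed

section \<open>Charts and the chain rule through a chart\<close>

context
  fixes c :: "('m::t2_space, 'e::euclidean_space) chart"
  assumes c: "is_chart c"
begin

lemma chart_open: "open (fst c)"
  using c by (simp add: is_chart_def)

lemma chart_image_open: "open (snd c ` fst c)"
  using c by (simp add: is_chart_def)

lemma chart_inv_left: "p \<in> fst c \<Longrightarrow> chart_inv c (snd c p) = p"
  using c unfolding is_chart_def homeomorphism_def by blast

lemma chart_inv_right: "x \<in> snd c ` fst c \<Longrightarrow> snd c (chart_inv c x) = x"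
  using c unfolding is_chart_def homeomorphism_def by blast

lemma chart_inv_in: "x \<in> snd c ` fst c \<Longrightarrow> chart_inv c x \<in> fst c"
  using chart_inv_left by auto

lemma chart_inv_isCont: "x \<in> snd c ` fst c \<Longrightarrow> isCont (chart_inv c) x"
  using c unfolding is_chart_def homeomorphism_def by (metis continuous_on_eq_continuous_at)

lemma chart_inv_continuous: "continuous_on (snd c ` fst c) (chart_inv c)"
  using c unfolding is_chart_def homeomorphism_def by blast

lemma chart_image_eq: "snd c ` (fst c \<inter> W) = snd c ` fst c \<inter> chart_inv c -` W"
  using chart_inv_left by (auto simp: image_iff)

lemma chart_image_open_Int: "open W \<Longrightarrow> open (snd c ` (fst c \<inter> W))"
  unfolding chart_image_eq
  using continuous_on_open_vimage[OF chart_image_open] chart_inv_continuous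
  by (metis Int_commute)

text \<open>The factorisation of \<open>\<Phi> \<circ> H\<close> through the chart holds only while
  \<open>H\<close> stays in the chart domain; continuity of \<open>H\<close> at \<open>z\<close>
  makes it valid near \<open>z\<close>, which is enough for a derivative.\<close>

lemma chart_chain:
  fixes H :: "'a::real_normed_vector \<Rightarrow> 'm" and \<Phi> :: "'m \<Rightarrow> 'b::real_normed_vector"
  assumes H: "isCont H z" "H z \<in> fst c" and 1: "(snd c \<circ> H has_derivative L1) (at z)"
    and 2: "(\<Phi> \<circ> chart_inv c has_derivative L2) (at (snd c (H z)))"
  shows "(\<Phi> \<circ> H has_derivative (L2 \<circ> L1)) (at z)"
proof -
  have d: "((\<Phi> \<circ> chart_inv c) \<circ> (snd c \<circ> H) has_derivative (L2 \<circ> L1)) (at z)"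
    using diff_chain_at[OF 1] 2 by simp
  have "\<forall>\<^sub>F y in at z. H y \<in> fst c"
    using H chart_open by (simp add: isCont_def tendsto_def)
  then have ev: "\<forall>\<^sub>F y in at z. ((\<Phi> \<circ> chart_inv c) \<circ> (snd c \<circ> H)) y = (\<Phi> \<circ> H) y"
    by eventually_elim (simp add: chart_inv_left)
  show ?thesis
    by (rule has_derivative_transform_eventually[OF d ev]) (simp_all add: chart_inv_left H)
qed

lemma chart_inv_has_derivative:
  assumes "p \<in> fst c"
  shows "(snd c \<circ> chart_inv c has_derivative (\<lambda>v. v)) (at (snd c p))"
  by (rule has_derivative_transform_within_open[OF has_derivative_ident chart_image_open])
    (use assms in \<open>auto simp: chart_inv_left\<close>)

end

lemma chart_chain_map:
  fixes H :: "'m::t2_space \<Rightarrow> 'n::t2_space" and \<Phi> :: "'n \<Rightarrow> 'b::real_normed_vector"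
    and c :: "('m, 'e::euclidean_space) chart" and d :: "('n, 'f::euclidean_space) chart"
  assumes "is_chart c" "is_chart d" "isCont H p" "p \<in> fst c" "H p \<in> fst d"
    and 1: "(snd d \<circ> H \<circ> chart_inv c has_derivative L1) (at (snd c p))"
    and 2: "(\<Phi> \<circ> chart_inv d has_derivative L2) (at (snd d (H p)))"
  shows "(\<Phi> \<circ> H \<circ> chart_inv c has_derivative (L2 \<circ> L1)) (at (snd c p))"
proof -
  have i: "chart_inv c (snd c p) = p" using assms chart_inv_left by blast
  have "isCont (H \<circ> chart_inv c) (snd c p)"
    by (rule continuous_at_compose) (use assms i chart_inv_isCont[OF assms(1)] in auto)
  from chart_chain[OF assms(2) this, of L1 \<Phi> L2] show ?thesis
    using assms i by (simp add: o_assoc)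
qed

section \<open>Tangent vectors and vector fields in charts\<close>

locale atlas =
  fixes A :: "('m::t2_space, 'e::euclidean_space) chart set"
  assumes atlas: "smooth_atlas A"
begin

lemma is_chart: "c \<in> A \<Longrightarrow> is_chart c"
  using atlas by (simp add: smooth_atlas_def)

lemma chart_at_props: "chart_at A p \<in> A" "p \<in> fst (chart_at A p)"
proof -
  have "p \<in> (\<Union>c\<in>A. fst c)" using atlas by (simp add: smooth_atlas_def)
  then have "\<exists>c. c \<in> A \<and> p \<in> fst c" by blast
  from someI_ex[OF this] show "chart_at A p \<in> A" "p \<in> fst (chart_at A p)"
    by (auto simp: chart_at_def)
qed

definition transition :: "('m, 'e) chart \<Rightarrow> ('m, 'e) chart \<Rightarrow> 'm \<Rightarrow> 'e \<Rightarrow> 'e" where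
  "transition c d p = frechet_derivative (snd d \<circ> chart_inv c) (at (snd c p))"

lemma transition_has_derivative:
  assumes "c \<in> A" "d \<in> A" "p \<in> fst c" "p \<in> fst d"
  shows "(snd d \<circ> chart_inv c has_derivative transition c d p) (at (snd c p))"
proof -
  have "smooth_on (snd c ` (fst c \<inter> fst d)) (snd d \<circ> chart_inv c)"
    using atlas assms by (simp add: smooth_atlas_def)
  then show ?thesis unfolding transition_def
    by (rule smooth_on_has_derivative) (use assms in auto)
qed

lemma transition_linear:
  assumes "c \<in> A" "d \<in> A" "p \<in> fst c" "p \<in> fst d"
  shows "linear (transition c d p)"
  using has_derivative_linear[OF transition_has_derivative[OF assms]] .

lemma chart_change:
  fixes \<Phi> :: "'m \<Rightarrow> 'b::real_normed_vector"
  assumes "c \<in> A" "d \<in> A" "p \<in> fst c" "p \<in> fst d"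
    and "(\<Phi> \<circ> chart_inv d has_derivative L) (at (snd d p))"
  shows "(\<Phi> \<circ> chart_inv c has_derivative (\<lambda>v. L (transition c d p v))) (at (snd c p))"
  using chart_chain[OF is_chart[OF assms(2)], where H = "chart_inv c" and z = "snd c p"
      and ?L1.0 = "transition c d p" and \<Phi> = \<Phi> and ?L2.0 = L]
    chart_inv_isCont[OF is_chart[OF assms(1)], of "snd c p"] chart_inv_left[OF is_chart[OF assms(1)] assms(3)]
    transition_has_derivative[OF assms(1-4)] assms
  by (simp add: o_def)

lemma transition_trans:
  assumes "c \<in> A" "d \<in> A" "e \<in> A" "p \<in> fst c" "p \<in> fst d" "p \<in> fst e"
  shows "transition d e p (transition c d p v) = transition c e p v"
  using has_derivative_unique[OF chart_change[OF assms(1,2,4,5) transition_has_derivative[OF assms(2,3,5,6)]]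
      transition_has_derivative[OF assms(1,3,4,6)]]
  by metis

lemma transition_self: "c \<in> A \<Longrightarrow> p \<in> fst c \<Longrightarrow> transition c c p v = v"
  using has_derivative_unique[OF transition_has_derivative[of c c p] chart_inv_has_derivative[of c p]]
    is_chart by metis

lemma tangent_iff:
  "v \<in> tangent_space A p \<longleftrightarrow> (\<forall>c. \<not> (c \<in> A \<and> p \<in> fst c) \<longrightarrow> v c = 0) \<and>
     (\<forall>c\<in>A. \<forall>d\<in>A. p \<in> fst c \<and> p \<in> fst d \<longrightarrow> v d = transition c d p (v c))"
  by (simp add: tangent_space_def transition_def)

lemma tangent_transition:
  "v \<in> tangent_space A p \<Longrightarrow> c \<in> A \<Longrightarrow> d \<in> A \<Longrightarrow> p \<in> fst c \<Longrightarrow> p \<in> fst d \<Longrightarrow>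
    v d = transition c d p (v c)"
  unfolding tangent_iff by blast

lemma tangent_outside: "v \<in> tangent_space A p \<Longrightarrow> \<not> (c \<in> A \<and> p \<in> fst c) \<Longrightarrow> v c = 0"
  unfolding tangent_iff by blast

lemma tangentI:
  assumes "\<And>c. \<not> (c \<in> A \<and> p \<in> fst c) \<Longrightarrow> v c = 0"
    and "\<And>c d. c \<in> A \<Longrightarrow> d \<in> A \<Longrightarrow> p \<in> fst c \<Longrightarrow> p \<in> fst d \<Longrightarrow> v d = transition c d p (v c)"
  shows "v \<in> tangent_space A p"
  unfolding tangent_iff using assms by blast

lemma tangent_eqI:
  assumes "u \<in> tangent_space A p" "v \<in> tangent_space A p" "c \<in> A" "p \<in> fst c" "u c = v c"
  shows "u = v"
proof
  fix d show "u d = v d"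
    using assms tangent_outside tangent_transition by metis
qed

lemma coord_vec_tangent:
  assumes "c \<in> A" "p \<in> fst c" shows "coord_vec A c p b \<in> tangent_space A p"
  unfolding tangent_iff coord_vec_def transition_def[symmetric]
  by (simp add: transition_trans[OF assms(1) _ _ assms(2)])

lemma coord_vec_self:
  assumes "c \<in> A" "p \<in> fst c" shows "coord_vec A c p b c = b"
  unfolding coord_vec_def transition_def[symmetric] by (simp add: transition_self assms)

lemma tangent_zero: "(\<lambda>c. 0) \<in> tangent_space A p"
  unfolding tangent_iff by (simp add: linear_0[OF transition_linear])

lemma tangent_add:
  assumes "u \<in> tangent_space A p" "v \<in> tangent_space A p"
  shows "(\<lambda>c. u c + v c) \<in> tangent_space A p"
proof (rule tangentI)
  fix c d assume cd: "c \<in> A" "d \<in> A" "p \<in> fst c" "p \<in> fst d"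
  show "u d + v d = transition c d p (u c + v c)"
    unfolding linear_add[OF transition_linear[OF cd]] tangent_transition[OF assms(1) cd, symmetric] tangent_transition[OF assms(2) cd, symmetric] ..
qed (simp add: assms[THEN tangent_outside])

lemma tangent_scale:
  assumes "u \<in> tangent_space A p"
  shows "(\<lambda>c. a *\<^sub>R u c) \<in> tangent_space A p"
proof (rule tangentI)
  fix c d assume cd: "c \<in> A" "d \<in> A" "p \<in> fst c" "p \<in> fst d"
  show "a *\<^sub>R u d = transition c d p (a *\<^sub>R u c)"
    unfolding linear_scale[OF transition_linear[OF cd]] tangent_transition[OF assms(1) cd, symmetric] ..
qed (simp add: assms[THEN tangent_outside])

lemma tangent_diff:
  assumes "u \<in> tangent_space A p" "v \<in> tangent_space A p"
  shows "(\<lambda>c. u c - v c) \<in> tangent_space A p"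
proof (rule tangentI)
  fix c d assume cd: "c \<in> A" "d \<in> A" "p \<in> fst c" "p \<in> fst d"
  show "u d - v d = transition c d p (u c - v c)"
    unfolding linear_diff[OF transition_linear[OF cd]] tangent_transition[OF assms(1) cd, symmetric] tangent_transition[OF assms(2) cd, symmetric] ..
qed (simp add: assms[THEN tangent_outside])

lemma smooth_vfield_tangent: "smooth_vfield A X \<Longrightarrow> X p \<in> tangent_space A p"
  by (simp add: smooth_vfield_def)

lemma smooth_vfield_smooth_on:
  "smooth_vfield A X \<Longrightarrow> c \<in> A \<Longrightarrow> smooth_on (snd c ` fst c) (\<lambda>x. X (chart_inv c x) c)"
  by (simp add: smooth_vfield_def)

lemma smooth_vf_add: "smooth_vfield A X \<Longrightarrow> smooth_vfield A Y \<Longrightarrow> smooth_vfield A (vf_add X Y)"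
  unfolding smooth_vfield_def vf_add_def
  by (simp add: tangent_add smooth_on_add chart_image_open is_chart)

lemma smooth_vf_diff: "smooth_vfield A X \<Longrightarrow> smooth_vfield A Y \<Longrightarrow> smooth_vfield A (vf_diff X Y)"
  unfolding smooth_vfield_def vf_diff_def
  by (simp add: tangent_diff smooth_on_diff chart_image_open is_chart)

lemma smooth_vf_scale: "smooth_fun A f \<Longrightarrow> smooth_vfield A X \<Longrightarrow> smooth_vfield A (vf_scale f X)"
  unfolding smooth_vfield_def vf_scale_def smooth_fun_def
  by (simp add: tangent_scale o_def smooth_on_scaleR chart_image_open is_chart)

lemma smooth_vf_zero: "smooth_vfield A (\<lambda>p c. 0)"
  unfolding smooth_vfield_def by (simp add: tangent_zero smooth_on_const)

lemma smooth_fun_const: "smooth_fun A (\<lambda>p. k)"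
  by (simp add: smooth_fun_def o_def smooth_on_const)

lemma smooth_fun_uminus: "smooth_fun A f \<Longrightarrow> smooth_fun A (\<lambda>p. - f p)"
  unfolding smooth_fun_def
proof
  fix c assume "\<forall>c\<in>A. smooth_on (snd c ` fst c) (f \<circ> chart_inv c)" and c: "c \<in> A"
  then show "smooth_on (snd c ` fst c) ((\<lambda>p. - f p) \<circ> chart_inv c)"
    using smooth_on_diff[OF chart_image_open[OF is_chart[OF c]] smooth_on_const[of _ 0], of "f \<circ> chart_inv c"]
    by (simp add: o_def)
qed

lemma smooth_fun_has_derivative:
  assumes "smooth_fun A f" "c \<in> A" "p \<in> fst c"
  shows "(f \<circ> chart_inv c has_derivative frechet_derivative (f \<circ> chart_inv c) (at (snd c p))) (at (snd c p))"
  by (rule smooth_on_has_derivative[of "snd c ` fst c"]) (use assms in \<open>auto simp: smooth_fun_def\<close>)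

lemma vf_apply_chart:
  assumes "smooth_fun A f" "smooth_vfield A X" "c \<in> A" "p \<in> fst c"
  shows "vf_apply A X f p = frechet_derivative (f \<circ> chart_inv c) (at (snd c p)) (X p c)"
proof -
  let ?d = "chart_at A p"
  note d = chart_at_props[of p]
  have "X p c = transition ?d c p (X p ?d)"
    by (rule tangent_transition[OF smooth_vfield_tangent[OF assms(2)] d(1) assms(3) d(2) assms(4)])
  moreover have "frechet_derivative (f \<circ> chart_inv ?d) (at (snd ?d p)) =
    (\<lambda>v. frechet_derivative (f \<circ> chart_inv c) (at (snd c p)) (transition ?d c p v))"
    by (rule fd_eq[OF chart_change[OF d(1) assms(3) d(2) assms(4) smooth_fun_has_derivative[OF assms(1,3,4)]]])
  ultimately show ?thesis by (simp add: vf_apply_def Let_def)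
qed

lemma vf_apply_smooth:
  assumes "smooth_fun A f" "smooth_vfield A X"
  shows "smooth_fun A (vf_apply A X f)"
  unfolding smooth_fun_def
proof
  fix c assume c: "c \<in> A"
  note ch = is_chart[OF c]
  show "smooth_on (snd c ` fst c) (vf_apply A X f \<circ> chart_inv c)"
  proof (rule smooth_on_cong[OF chart_image_open[OF ch]])
    show "smooth_on (snd c ` fst c) (\<lambda>x. frechet_derivative (f \<circ> chart_inv c) (at x) (X (chart_inv c x) c))"
      using assms(1) c
      by (intro smooth_on_fd_apply chart_image_open ch smooth_vfield_smooth_on assms(2))
        (auto simp: smooth_fun_def)
  next
    fix x assume x: "x \<in> snd c ` fst c"
    then show "frechet_derivative (f \<circ> chart_inv c) (at x) (X (chart_inv c x) c) = (vf_apply A X f \<circ> chart_inv c) x"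
      using vf_apply_chart[OF assms c chart_inv_in[OF ch x]] chart_inv_right[OF ch x] by simp
  qed
qed

lemma vf_apply_const: "vf_apply A X (\<lambda>p. k) p = 0"
  by (simp add: vf_apply_def o_def)

text \<open>Both iterated derivatives contain the Hessian of \<open>f\<close> in coordinates, and
  its symmetry cancels it; what remains is the coordinate formula of the bracket. Smoothness of the
  bracket is assumed here because it is later read off from a torsion-free connection.\<close>

lemma lie_bracket_apply:
  assumes f: "smooth_fun A f" and X: "smooth_vfield A X" and Y: "smooth_vfield A Y"
    and XY: "smooth_vfield A (lie_bracket A X Y)"
  shows "vf_apply A (lie_bracket A X Y) f p = vf_apply A X (vf_apply A Y f) p - vf_apply A Y (vf_apply A X f) p"
proof -
  define c where "c = chart_at A p"
  have c: "c \<in> A" "p \<in> fst c" using chart_at_props[of p] by (simp_all add: c_def)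
  note ch = is_chart[OF c(1)]
  let ?S = "snd c ` fst c" and ?x = "snd c p"
  have x: "?x \<in> ?S" using c by auto
  have ip: "chart_inv c ?x = p" using chart_inv_left[OF ch c(2)] .
  define F where "F = f \<circ> chart_inv c"
  have F: "smooth_on ?S F" using f c by (simp add: smooth_fun_def F_def)
  have FX: "vf_apply A X (vf_apply A Y f) p = second_deriv F ?x (X p c) (Y p c)
     + frechet_derivative F (at ?x) (frechet_derivative (\<lambda>x. Y (chart_inv c x) c) (at ?x) (X p c))"
    if X: "smooth_vfield A X" and Y: "smooth_vfield A Y" for X Y
  proof -
    have "vf_apply A X (vf_apply A Y f) p = frechet_derivative (vf_apply A Y f \<circ> chart_inv c) (at ?x) (X p c)"
      by (rule vf_apply_chart[OF vf_apply_smooth[OF f Y] X c])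
    also have "frechet_derivative (vf_apply A Y f \<circ> chart_inv c) (at ?x) =
       (\<lambda>a. second_deriv F ?x a (Y (chart_inv c ?x) c)
        + frechet_derivative F (at ?x) (frechet_derivative (\<lambda>x. Y (chart_inv c x) c) (at ?x) a))"
    proof (rule fd_eq, rule has_derivative_transform_within_open)
      show "((\<lambda>x. frechet_derivative F (at x) (Y (chart_inv c x) c)) has_derivative
        (\<lambda>a. second_deriv F ?x a (Y (chart_inv c ?x) c)
        + frechet_derivative F (at ?x) (frechet_derivative (\<lambda>x. Y (chart_inv c x) c) (at ?x) a))) (at ?x)"
        by (rule has_derivative_fd_apply[OF chart_image_open[OF ch] F x has_derivative_ident
              smooth_on_has_derivative[OF smooth_vfield_smooth_on[OF Y c(1)] x]])
      show "open ?S" "?x \<in> ?S" by (rule chart_image_open[OF ch], rule x)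
      show "frechet_derivative F (at x) (Y (chart_inv c x) c) = (vf_apply A Y f \<circ> chart_inv c) x"
        if x: "x \<in> ?S" for x
        using vf_apply_chart[OF f Y c(1) chart_inv_in[OF ch x]] chart_inv_right[OF ch x] by (simp add: F_def)
    qed
    finally show ?thesis by (simp add: ip)
  qed
  have lin: "linear (frechet_derivative F (at ?x))"
    by (rule fd_linear[OF smooth_on_differentiable[OF F x]])
  have "vf_apply A (lie_bracket A X Y) f p = frechet_derivative F (at ?x) (lie_bracket A X Y p c)"
    unfolding F_def by (rule vf_apply_chart[OF f XY c])
  also have "lie_bracket A X Y p c = frechet_derivative (\<lambda>x. Y (chart_inv c x) c) (at ?x) (X p c)
        - frechet_derivative (\<lambda>x. X (chart_inv c x) c) (at ?x) (Y p c)"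
    using c by (simp add: lie_bracket_def)
  finally show ?thesis
    unfolding FX[OF X Y] FX[OF Y X] linear_diff[OF lin]
    using second_deriv_commute[OF chart_image_open[OF ch] x F, of "X p c" "Y p c"] by simp
qed

end

section \<open>Left-invariant vector fields\<close>

locale lie_grp = group G for G :: "'g::{t2_space,second_countable_topology} monoid" (structure) +
  fixes A :: "('g, 'e::euclidean_space) chart set"
  assumes lie_group: "lie_group G A"
begin

lemma carrier_UNIV [simp]: "carrier G = UNIV"
  using lie_group by (simp add: lie_group_def)

sublocale atlas A
  using lie_group by unfold_locales (simp add: lie_group_def)

lemma mult_continuous: "continuous_on UNIV (\<lambda>(x, y). x \<otimes> y)"
  using lie_group by (simp add: lie_group_def smooth_map_def)

lemma continuous_on_mult_G:
  assumes "continuous_on S f" "continuous_on S h"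
  shows "continuous_on S (\<lambda>z. f z \<otimes> h z)"
  using continuous_on_compose2[OF mult_continuous continuous_on_Pair[OF assms]] by simp

lemma inv_continuous: "continuous_on UNIV (\<lambda>x. inv x)"
  using lie_group by (simp add: lie_group_def smooth_map_def)

section \<open>The group law in coordinates\<close>

definition mult_loc :: "('g, 'e) chart \<Rightarrow> ('g, 'e) chart \<Rightarrow> ('g, 'e) chart \<Rightarrow> 'e \<times> 'e \<Rightarrow> 'e" where
  "mult_loc c1 c2 d z = snd d (chart_inv c1 (fst z) \<otimes> chart_inv c2 (snd z))"

definition mult_dom :: "('g, 'e) chart \<Rightarrow> ('g, 'e) chart \<Rightarrow> ('g, 'e) chart \<Rightarrow> ('e \<times> 'e) set" where
  "mult_dom c1 c2 d = (snd c1 ` fst c1 \<times> snd c2 ` fst c2) \<inter>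
     (\<lambda>z. chart_inv c1 (fst z) \<otimes> chart_inv c2 (snd z)) -` fst d"

lemma mult_domI:
  assumes "c1 \<in> A" "c2 \<in> A" "p \<in> fst c1" "q \<in> fst c2" "p \<otimes> q \<in> fst d"
  shows "(snd c1 p, snd c2 q) \<in> mult_dom c1 c2 d"
  using assms chart_inv_left[OF is_chart] by (simp add: mult_dom_def)

lemma mult_loc_chart:
  assumes "c1 \<in> A" "c2 \<in> A" "p \<in> fst c1" "q \<in> fst c2"
  shows "mult_loc c1 c2 d (snd c1 p, snd c2 q) = snd d (p \<otimes> q)"
  using assms chart_inv_left[OF is_chart] by (simp add: mult_loc_def)

lemma mult_dom_open:
  assumes "c1 \<in> A" "c2 \<in> A" "d \<in> A"
  shows "open (mult_dom c1 c2 d)"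
proof -
  let ?S = "snd c1 ` fst c1 \<times> snd c2 ` fst c2"
  have o: "open ?S" using assms chart_image_open[OF is_chart] by (simp add: open_Times)
  have 1: "continuous_on ?S (\<lambda>z. chart_inv c1 (fst z))"
    by (rule continuous_on_compose2[OF chart_inv_continuous[OF is_chart[OF assms(1)]] continuous_on_fst[OF continuous_on_id]]) auto
  have 2: "continuous_on ?S (\<lambda>z. chart_inv c2 (snd z))"
    by (rule continuous_on_compose2[OF chart_inv_continuous[OF is_chart[OF assms(2)]] continuous_on_snd[OF continuous_on_id]]) auto
  have "continuous_on ?S (\<lambda>z. chart_inv c1 (fst z) \<otimes> chart_inv c2 (snd z))"
    by (rule continuous_on_mult_G[OF 1 2])
  then have "open ((\<lambda>z. chart_inv c1 (fst z) \<otimes> chart_inv c2 (snd z)) -` fst d \<inter> ?S)"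
    using continuous_on_open_vimage[OF o] chart_open[OF is_chart[OF assms(3)]] by blast
  then show ?thesis by (simp add: mult_dom_def Int_commute)
qed

text \<open>Smoothness of the multiplication is given in a chart \<open>P\<close> of the product
  atlas, whose inverse is a choice of preimages. Injectivity of the pair map on the product domain
  identifies that inverse with the pair of chart inverses used in \<open>mult_loc\<close>.\<close>

lemma mult_loc_smooth:
  assumes "c1 \<in> A" "c2 \<in> A" "d \<in> A"
  shows "smooth_on (mult_dom c1 c2 d) (mult_loc c1 c2 d)"
proof -
  note ch = is_chart[OF assms(1)] is_chart[OF assms(2)]
  define P :: "('g \<times> 'g, 'e \<times> 'e) chart" where "P = (fst c1 \<times> fst c2, \<lambda>(x, y). (snd c1 x, snd c2 y))"
  have "P \<in> prod_atlas A A" using assms unfolding P_def prod_atlas_def by blast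
  then have sm: "smooth_on (snd P ` (fst P \<inter> (\<lambda>(x, y). x \<otimes> y) -` fst d)) (snd d \<circ> (\<lambda>(x, y). x \<otimes> y) \<circ> chart_inv P)"
    using lie_group assms(3) by (simp add: lie_group_def smooth_map_def)
  have inj: "inj_on (snd P) (fst P)"
    unfolding P_def inj_on_def using chart_inv_left[OF ch(1)] chart_inv_left[OF ch(2)]
    by (auto) (metis)+
  have dom: "snd P ` (fst P \<inter> (\<lambda>(x, y). x \<otimes> y) -` fst d) = mult_dom c1 c2 d"
  proof (intro equalityI subsetI)
    fix z assume "z \<in> snd P ` (fst P \<inter> (\<lambda>(x, y). x \<otimes> y) -` fst d)"
    then show "z \<in> mult_dom c1 c2 d"
      using mult_domI[OF assms(1,2), of _ _ d] by (auto simp: P_def)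
  next
    fix z assume z: "z \<in> mult_dom c1 c2 d"
    then obtain p q where pq: "z = (snd c1 p, snd c2 q)" "p \<in> fst c1" "q \<in> fst c2"
      by (auto simp: mult_dom_def)
    then have "p \<otimes> q \<in> fst d" using z chart_inv_left[OF ch(1)] chart_inv_left[OF ch(2)]
      by (simp add: mult_dom_def)
    then show "z \<in> snd P ` (fst P \<inter> (\<lambda>(x, y). x \<otimes> y) -` fst d)"
      using pq by (intro image_eqI[where x="(p, q)"]) (auto simp: P_def)
  qed
  show ?thesis
  proof (rule smooth_on_cong[OF mult_dom_open[OF assms]])
    show "smooth_on (mult_dom c1 c2 d) (snd d \<circ> (\<lambda>(x, y). x \<otimes> y) \<circ> chart_inv P)"
      using sm unfolding dom .
    fix z assume "z \<in> mult_dom c1 c2 d"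
    then obtain p q where pq: "z = (snd c1 p, snd c2 q)" "p \<in> fst c1" "q \<in> fst c2"
      by (auto simp: mult_dom_def)
    have "chart_inv P (snd P (p, q)) = (p, q)"
      unfolding chart_inv_def by (rule inv_into_f_f[OF inj]) (use pq in \<open>simp add: P_def\<close>)
    then have "chart_inv P z = (p, q)" using pq(1) by (simp add: P_def)
    then show "(snd d \<circ> (\<lambda>(x, y). x \<otimes> y) \<circ> chart_inv P) z = mult_loc c1 c2 d z"
      using mult_loc_chart[OF assms(1,2) pq(2,3)] pq(1) by simp
  qed
qed

lemma mult_loc_has_derivative:
  assumes "c1 \<in> A" "c2 \<in> A" "d \<in> A" "p \<in> fst c1" "q \<in> fst c2" "p \<otimes> q \<in> fst d"
  shows "(mult_loc c1 c2 d has_derivative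
    frechet_derivative (mult_loc c1 c2 d) (at (snd c1 p, snd c2 q))) (at (snd c1 p, snd c2 q))"
  by (rule smooth_on_has_derivative[OF mult_loc_smooth[OF assms(1-3)] mult_domI[OF assms(1,2,4-6)]])

text \<open>Differentiability at first order only, but stable under composition, products and
  inversion, hence available for every word in the group operations. Second-order information is
  taken from \<open>mult_loc\<close>.\<close>

definition mdiff :: "('g \<Rightarrow> 'g) \<Rightarrow> bool" where
  "mdiff F \<longleftrightarrow> continuous_on UNIV F \<and> (\<forall>c\<in>A. \<forall>d\<in>A. \<forall>p. p \<in> fst c \<longrightarrow> F p \<in> fst d \<longrightarrow>
     (snd d \<circ> F \<circ> chart_inv c) differentiable (at (snd c p)))"

definition deriv_loc :: "('g, 'e) chart \<Rightarrow> ('g, 'e) chart \<Rightarrow> ('g \<Rightarrow> 'g) \<Rightarrow> 'g \<Rightarrow> 'e \<Rightarrow> 'e" where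
  "deriv_loc c d F p = frechet_derivative (snd d \<circ> F \<circ> chart_inv c) (at (snd c p))"

lemma mdiff_has_derivative:
  assumes "mdiff F" "c \<in> A" "d \<in> A" "p \<in> fst c" "F p \<in> fst d"
  shows "(snd d \<circ> F \<circ> chart_inv c has_derivative deriv_loc c d F p) (at (snd c p))"
  using assms by (simp add: mdiff_def deriv_loc_def has_derivative_fd)

lemma mdiff_isCont: "mdiff F \<Longrightarrow> isCont F p"
  by (simp add: mdiff_def continuous_on_eq_continuous_at)

lemma deriv_loc_linear:
  assumes "mdiff F" "c \<in> A" "d \<in> A" "p \<in> fst c" "F p \<in> fst d"
  shows "linear (deriv_loc c d F p)"
  by (rule has_derivative_linear[OF mdiff_has_derivative[OF assms]])

lemma mdiff_const: "mdiff (\<lambda>p. k)"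
  by (simp add: mdiff_def o_def)

lemma deriv_loc_const: "deriv_loc c d (\<lambda>p. k) p v = 0"
  by (simp add: deriv_loc_def o_def)

lemma mdiff_id: "mdiff (\<lambda>p. p)"
  unfolding mdiff_def
proof (intro conjI ballI allI impI)
  fix c d p assume "c \<in> A" "d \<in> A" "p \<in> fst c" "p \<in> fst d"
  then show "(snd d \<circ> (\<lambda>p. p) \<circ> chart_inv c) differentiable at (snd c p)"
    using transition_has_derivative[of c d p] unfolding differentiable_def by (auto simp: o_def)
qed (rule continuous_on_id)

lemma deriv_loc_id: "c \<in> A \<Longrightarrow> p \<in> fst c \<Longrightarrow> deriv_loc c c (\<lambda>p. p) p v = v"
  using transition_self[of c p v] by (simp add: deriv_loc_def transition_def o_def)

lemma deriv_loc_compose_has_derivative: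
  assumes "mdiff F" "mdiff H" "c \<in> A" "d \<in> A" "e \<in> A" "p \<in> fst c" "H p \<in> fst d" "F (H p) \<in> fst e"
  shows "(snd e \<circ> (\<lambda>p. F (H p)) \<circ> chart_inv c has_derivative
    (\<lambda>v. deriv_loc d e F (H p) (deriv_loc c d H p v))) (at (snd c p))"
  using chart_chain_map[OF is_chart[OF assms(3)] is_chart[OF assms(4)] mdiff_isCont[OF assms(2)] assms(6,7)
      mdiff_has_derivative[OF assms(2,3,4,6,7)] mdiff_has_derivative[OF assms(1,4,5,7,8)]]
  by (simp add: o_def)

lemma deriv_loc_compose:
  assumes "mdiff F" "mdiff H" "c \<in> A" "d \<in> A" "e \<in> A" "p \<in> fst c" "H p \<in> fst d" "F (H p) \<in> fst e"
  shows "deriv_loc c e (\<lambda>p. F (H p)) p v = deriv_loc d e F (H p) (deriv_loc c d H p v)"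
  unfolding deriv_loc_def[of c e] fd_eq[OF deriv_loc_compose_has_derivative[OF assms]] ..

lemma mdiff_compose:
  assumes "mdiff F" "mdiff H" shows "mdiff (\<lambda>p. F (H p))"
  unfolding mdiff_def
proof (intro conjI ballI allI impI)
  show "continuous_on UNIV (\<lambda>p. F (H p))"
    using assms continuous_on_compose2[of UNIV F UNIV H] by (simp add: mdiff_def)
  fix c d p assume "c \<in> A" "d \<in> A" "p \<in> fst c" "F (H p) \<in> fst d"
  then show "(snd d \<circ> (\<lambda>p. F (H p)) \<circ> chart_inv c) differentiable at (snd c p)"
    using deriv_loc_compose_has_derivative[OF assms _ chart_at_props(1)[of "H p"] _ _ chart_at_props(2)[of "H p"]]
    unfolding differentiable_def by blast
qed

lemma deriv_loc_mult_has_derivative: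
  assumes F: "mdiff F" and H: "mdiff H" and c: "c \<in> A" "c1 \<in> A" "c2 \<in> A" "d \<in> A"
    and p: "p \<in> fst c" "F p \<in> fst c1" "H p \<in> fst c2" "F p \<otimes> H p \<in> fst d"
  shows "(snd d \<circ> (\<lambda>p. F p \<otimes> H p) \<circ> chart_inv c has_derivative
    (\<lambda>v. frechet_derivative (mult_loc c1 c2 d) (at (snd c1 (F p), snd c2 (H p)))
       (deriv_loc c c1 F p v, deriv_loc c c2 H p v))) (at (snd c p))"
proof -
  note ip = chart_inv_left[OF is_chart[OF c(1)] p(1)]
  let ?g = "\<lambda>x. ((snd c1 \<circ> F \<circ> chart_inv c) x, (snd c2 \<circ> H \<circ> chart_inv c) x)"
  have g: "(?g has_derivative (\<lambda>v. (deriv_loc c c1 F p v, deriv_loc c c2 H p v))) (at (snd c p))"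
    by (rule has_derivative_Pair[OF mdiff_has_derivative[OF F c(1,2) p(1,2)] mdiff_has_derivative[OF H c(1,3) p(1,3)]])
  have m: "(mult_loc c1 c2 d has_derivative
      frechet_derivative (mult_loc c1 c2 d) (at (snd c1 (F p), snd c2 (H p)))) (at (?g (snd c p)))"
    using mult_loc_has_derivative[OF c(2,3,4) p(2,3,4)] by (simp add: ip)
  have comp: "(mult_loc c1 c2 d \<circ> ?g has_derivative
    (\<lambda>v. frechet_derivative (mult_loc c1 c2 d) (at (snd c1 (F p), snd c2 (H p)))
       (deriv_loc c c1 F p v, deriv_loc c c2 H p v))) (at (snd c p))"
    using diff_chain_at[OF g m] by (simp add: o_def)
  have t: "isCont (\<lambda>x. K (chart_inv c x)) (snd c p)" if "mdiff K" for K :: "'g \<Rightarrow> 'g"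
    using isCont_o2[OF chart_inv_isCont[OF is_chart[OF c(1)]], of "snd c p" K] p(1) mdiff_isCont[OF that] by simp
  have "\<forall>\<^sub>F x in at (snd c p). F (chart_inv c x) \<in> fst c1" "\<forall>\<^sub>F x in at (snd c p). H (chart_inv c x) \<in> fst c2"
    using t[OF F] t[OF H] chart_open[OF is_chart[OF c(2)]] chart_open[OF is_chart[OF c(3)]] p ip
    by (simp_all add: isCont_def tendsto_def)
  then have ev: "\<forall>\<^sub>F x in at (snd c p). (mult_loc c1 c2 d \<circ> ?g) x = (snd d \<circ> (\<lambda>p. F p \<otimes> H p) \<circ> chart_inv c) x"
    by eventually_elim (simp add: mult_loc_chart[OF c(2,3)])
  show ?thesis
    by (rule has_derivative_transform_eventually[OF comp ev _ UNIV_I])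
      (simp add: mult_loc_chart[OF c(2,3)] ip p)
qed

lemma mdiff_mult:
  assumes "mdiff F" "mdiff H" shows "mdiff (\<lambda>p. F p \<otimes> H p)"
  unfolding mdiff_def
proof (intro conjI ballI allI impI)
  show "continuous_on UNIV (\<lambda>p. F p \<otimes> H p)"
    using assms unfolding mdiff_def by (blast intro: continuous_on_mult_G)
  fix c d p assume "c \<in> A" "d \<in> A" "p \<in> fst c" "F p \<otimes> H p \<in> fst d"
  then show "(snd d \<circ> (\<lambda>p. F p \<otimes> H p) \<circ> chart_inv c) differentiable at (snd c p)"
    using deriv_loc_mult_has_derivative[OF assms _ chart_at_props(1)[of "F p"] chart_at_props(1)[of "H p"] _ _
        chart_at_props(2)[of "F p"] chart_at_props(2)[of "H p"]]
    unfolding differentiable_def by blast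
qed

lemma mdiff_inv: "mdiff (\<lambda>p. inv p)"
  unfolding mdiff_def
proof (intro conjI ballI allI impI)
  fix c d p assume cd: "c \<in> A" "d \<in> A" "p \<in> fst c" "inv p \<in> fst d"
  then have "smooth_on (snd c ` (fst c \<inter> (\<lambda>x. inv x) -` fst d)) (snd d \<circ> (\<lambda>x. inv x) \<circ> chart_inv c)"
    using lie_group by (simp add: lie_group_def smooth_map_def)
  then show "(snd d \<circ> (\<lambda>x. inv x) \<circ> chart_inv c) differentiable at (snd c p)"
    by (rule smooth_on_differentiable) (use cd in auto)
qed (rule inv_continuous)

lemma mdiff_left: "mdiff (\<lambda>q. p \<otimes> q)"
  by (rule mdiff_mult[OF mdiff_const mdiff_id])

definition c0 :: "('g, 'e) chart" where "c0 = chart_at A \<one>"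

lemma c0: "c0 \<in> A" "\<one> \<in> fst c0"
  unfolding c0_def by (rule chart_at_props)+

definition y0 :: 'e where "y0 = snd c0 \<one>"

lemma y0_in: "y0 \<in> snd c0 ` fst c0" and inv_y0 [simp]: "chart_inv c0 y0 = \<one>"
  using c0 chart_inv_left[OF is_chart] by (auto simp: y0_def)

text \<open>The coordinates \<open>a\<close> refer to the chart \<open>c0\<close> at the identity.\<close>

definition lfield :: "'e \<Rightarrow> ('g, 'e) vfield" where
  "lfield a p = (\<lambda>d. if d \<in> A \<and> p \<in> fst d then deriv_loc c0 d (\<lambda>q. p \<otimes> q) \<one> a else 0)"

lemma lfield_chart:
  "d \<in> A \<Longrightarrow> p \<in> fst d \<Longrightarrow> lfield a p d = deriv_loc c0 d (\<lambda>q. p \<otimes> q) \<one> a"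
  by (simp add: lfield_def)

text \<open>Left translation by \<open>p\<close> becomes a partial derivative of one fixed smooth
  function in which \<open>p\<close> is merely a coordinate. This is what allows left-invariant
  fields to be differentiated in \<open>p\<close>.\<close>

lemma deriv_left_mult:
  assumes "d \<in> A" "p \<in> fst d"
  shows "deriv_loc c0 d (\<lambda>q. p \<otimes> q) \<one> a = frechet_derivative (mult_loc d c0 d) (at (snd d p, y0)) (0, a)"
  using fd_eq[OF deriv_loc_mult_has_derivative[OF mdiff_const mdiff_id c0(1) assms(1) c0(1) assms(1) c0(2) assms(2) c0(2)]] assms
  by (simp add: deriv_loc_const deriv_loc_id c0 y0_def deriv_loc_def[of c0 d])

lemma lfield_tangent: "lfield a p \<in> tangent_space A p"
proof (rule tangentI)
  fix c d assume cd: "c \<in> A" "d \<in> A" "p \<in> fst c" "p \<in> fst d"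
  have "deriv_loc c0 d (\<lambda>q. (p \<otimes> q)) \<one> a = deriv_loc c d (\<lambda>q. q) (p \<otimes> \<one>) (deriv_loc c0 c (\<lambda>q. p \<otimes> q) \<one> a)"
    by (rule deriv_loc_compose[OF mdiff_id mdiff_left]) (use cd c0 in auto)
  then show "lfield a p d = transition c d p (lfield a p c)"
    using cd by (simp add: lfield_def deriv_loc_def[of c d] transition_def o_def)
qed (auto simp: lfield_def)

lemma lfield_smooth: "smooth_vfield A (lfield a)"
  unfolding smooth_vfield_def
proof (intro conjI allI ballI)
  fix c assume c: "c \<in> A"
  note ch = is_chart[OF c] and im = chart_image_open[OF is_chart[OF c]]
  show "smooth_on (snd c ` fst c) (\<lambda>x. lfield a (chart_inv c x) c)"
  proof (rule smooth_on_cong[OF im])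
    show "smooth_on (snd c ` fst c) (\<lambda>x. frechet_derivative (mult_loc c c0 c) (at (x, y0)) (0, a))"
    proof (rule smooth_on_compose[OF im, where g = "\<lambda>x. (x, y0)"
          and f = "\<lambda>z. frechet_derivative (mult_loc c c0 c) (at z) (0, a)"])
      show "(\<lambda>x. (x, y0)) ` snd c ` fst c \<subseteq> mult_dom c c0 c"
        using mult_domI[OF c c0(1) _ c0(2), of _ c] by (auto simp: y0_def)
      show "smooth_on (mult_dom c c0 c) (\<lambda>z. frechet_derivative (mult_loc c c0 c) (at z) (0, a))"
        by (rule smooth_on_fd[OF mult_loc_smooth[OF c c0(1) c]])
      show "smooth_on (snd c ` fst c) (\<lambda>x. (x, y0))"
        by (intro smooth_on_Pair im smooth_on_const smooth_on_linear bounded_linear_ident)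
    qed
    fix x assume x: "x \<in> snd c ` fst c"
    show "frechet_derivative (mult_loc c c0 c) (at (x, y0)) (0, a) = lfield a (chart_inv c x) c"
      using chart_inv_in[OF ch x] chart_inv_right[OF ch x] c
      by (simp add: lfield_chart deriv_left_mult)
  qed
qed (rule lfield_tangent)

lemma lfield_linear: "linear (\<lambda>a. lfield a p d)"
proof (cases "d \<in> A \<and> p \<in> fst d")
  case True
  then show ?thesis using deriv_loc_linear[OF mdiff_left c0(1) _ c0(2), of d p] by (simp add: lfield_def)
next
  case False
  then have "(\<lambda>a. lfield a p d) = (\<lambda>a. 0)" by (auto simp: lfield_def)
  then show ?thesis by (simp add: module_hom_zero)
qed

lemma lfield_one: "lfield a \<one> c0 = a"
  using deriv_loc_id[OF c0] by (simp add: lfield_chart c0)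

lemma lfield_one_eq: "lfield a \<one> = coord_vec A c0 \<one> a"
  by (rule tangent_eqI[OF lfield_tangent coord_vec_tangent[OF c0] c0])
    (simp add: lfield_one coord_vec_self[OF c0])

text \<open>Associativity and the chain rule: translating by \<open>p\<close> and then by
  \<open>h\<close> is translating by \<open>h \<otimes> p\<close>.\<close>

lemma lfield_left_invariant:
  "differential A A (\<lambda>q. h \<otimes> q) p (lfield a p) = lfield a (h \<otimes> p)"
proof
  fix d
  let ?c = "chart_at A p"
  note c = chart_at_props[of p]
  show "differential A A (\<lambda>q. h \<otimes> q) p (lfield a p) d = lfield a (h \<otimes> p) d"
  proof (cases "d \<in> A \<and> h \<otimes> p \<in> fst d")
    case True
    have "deriv_loc c0 d (\<lambda>q. h \<otimes> (p \<otimes> q)) \<one> a = deriv_loc ?c d (\<lambda>q. h \<otimes> q) (p \<otimes> \<one>) (deriv_loc c0 ?c (\<lambda>q. p \<otimes> q) \<one> a)"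
      by (rule deriv_loc_compose[OF mdiff_left mdiff_left]) (use c c0 True in auto)
    moreover have "(\<lambda>q. h \<otimes> (p \<otimes> q)) = (\<lambda>q. h \<otimes> p \<otimes> q)" by (simp add: m_assoc)
    ultimately show ?thesis using True c
      by (simp add: differential_def Let_def lfield_def deriv_loc_def[of ?c])
  next
    case False
    then show ?thesis by (auto simp: differential_def lfield_def Let_def)
  qed
qed

end

text \<open>A finite-dimensional subspace is its own double orthogonal complement: pairing with a
  vector orthogonal to \<open>W\<close> makes \<open>f\<close> constant, so the values of
  \<open>f'\<close> are orthogonal to that vector too.\<close>

lemma has_derivative_in_subspace:
  fixes f :: "'a::real_normed_vector \<Rightarrow> 'b::euclidean_space"
  assumes f: "(f has_derivative f') (at x)" and W: "subspace W" and fW: "\<And>y. f y - f x \<in> W"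
  shows "f' a \<in> W"
proof -
  have "f' a \<bullet> w = 0" if w: "w \<in> orthogonal_comp W" for w
  proof -
    have "f y \<bullet> w = f x \<bullet> w" for y
      using w fW[of y] by (auto simp: orthogonal_comp_def orthogonal_def inner_diff_left)
    then have "(\<lambda>y. f y \<bullet> w) = (\<lambda>y. f x \<bullet> w)" by blast
    then have "((\<lambda>y. f y \<bullet> w) has_derivative (\<lambda>a. 0)) (at x)" by simp
    with has_derivative_inner_left[OF f, of w] have "(\<lambda>a. f' a \<bullet> w) = (\<lambda>a. 0)"
      by (rule has_derivative_unique)
    then show ?thesis by (rule fun_cong)
  qed
  then have "f' a \<in> orthogonal_comp (orthogonal_comp W)"
    by (auto simp: orthogonal_comp_def orthogonal_def inner_commute)
  then show ?thesis by (simp add: orthogonal_comp_self[OF W])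
qed

lemma (in atlas) zero_derivative_local_const:
  fixes \<Phi> :: "'m \<Rightarrow> 'b::real_normed_vector"
  assumes c: "c \<in> A" and W: "open W" "p \<in> W" "W \<subseteq> fst c"
    and d: "\<And>q. q \<in> W \<Longrightarrow> (\<Phi> \<circ> chart_inv c has_derivative (\<lambda>v. 0)) (at (snd c q))"
  shows "\<exists>U. open U \<and> p \<in> U \<and> U \<subseteq> W \<and> (\<forall>q\<in>U. \<Phi> q = \<Phi> p)"
proof -
  note ch = is_chart[OF c]
  have "open (snd c ` (fst c \<inter> W))" by (rule chart_image_open_Int[OF ch W(1)])
  then have o: "open (snd c ` W)" using W(3) by (simp add: Int_absorb1)
  then obtain e where e: "e > 0" "ball (snd c p) e \<subseteq> snd c ` W"
    using W(2) open_contains_ball by (metis imageI)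
  let ?B = "ball (snd c p) e"
  define U where "U = fst c \<inter> snd c -` ?B"
  have "continuous_on (fst c) (snd c)"
    using ch unfolding is_chart_def homeomorphism_def by blast
  then have "open (snd c -` ?B \<inter> fst c)"
    using continuous_on_open_vimage[OF chart_open[OF ch]] by blast
  then have U: "open U" by (simp add: U_def Int_commute)
  have UW: "U \<subseteq> W"
  proof
    fix q assume "q \<in> U"
    then have q: "q \<in> fst c" "snd c q \<in> snd c ` W" using e by (auto simp: U_def)
    then obtain r where "r \<in> W" "snd c q = snd c r" by blast
    then show "q \<in> W" using q(1) W(3) chart_inv_left[OF ch] by (metis subsetD)
  qed
  have "\<exists>k. \<forall>x\<in>?B. (\<Phi> \<circ> chart_inv c) x = k"
  proof (rule has_derivative_zero_constant[OF convex_ball])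
    fix x assume "x \<in> ?B"
    then obtain q where "q \<in> W" "x = snd c q" using e by blast
    then show "(\<Phi> \<circ> chart_inv c has_derivative (\<lambda>h. 0)) (at x within ?B)"
      using d has_derivative_at_withinI by blast
  qed
  then obtain k where k: "\<And>x. x \<in> ?B \<Longrightarrow> \<Phi> (chart_inv c x) = k" by auto
  have Uk: "\<Phi> q = k" if "q \<in> U" for q
    using k[of "snd c q"] that chart_inv_left[OF ch, of q] by (simp add: U_def)
  have "p \<in> U" using W e by (auto simp: U_def)
  then show ?thesis using U UW Uk by blast
qed

lemma locally_constant_connected:
  assumes "connected (UNIV :: 'a::topological_space set)"
    and "\<And>p. \<exists>U. open U \<and> p \<in> U \<and> (\<forall>q\<in>U. f q = f p)"
  shows "f (p::'a) = f q"
proof (rule connected_local_const[OF assms(1) UNIV_I UNIV_I], rule ballI)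
  fix a
  obtain U where "open U" "a \<in> U" "\<forall>q\<in>U. f q = f a" using assms(2) by blast
  then show "\<forall>\<^sub>F b in at a. f a = f b"
    unfolding eventually_at_topological by metis
qed

lemma has_derivative_Pair_const:
  "((\<lambda>x. (x, k)) has_derivative (\<lambda>w. (w, 0))) (at z)"
  "((\<lambda>x. (k, x)) has_derivative (\<lambda>w. (0, w))) (at z)"
  by (intro has_derivative_Pair has_derivative_ident has_derivative_const)+

section \<open>The bracket as the antisymmetrised second derivative of the group law\<close>

context lie_grp
begin

lemma deriv_mult_left:
  assumes "c1 \<in> A" "c \<in> A" "d \<in> A" "p \<in> fst c1" "q \<in> fst c" "p \<otimes> q \<in> fst d"
  shows "deriv_loc c d (\<lambda>q. p \<otimes> q) q v = frechet_derivative (mult_loc c1 c d) (at (snd c1 p, snd c q)) (0, v)"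
  using fd_eq[OF deriv_loc_mult_has_derivative[OF mdiff_const mdiff_id assms(2,1,2,3,5,4,5,6)]] assms
  by (simp add: deriv_loc_const deriv_loc_id deriv_loc_def[of c d])

lemma mdiff_right: "mdiff (\<lambda>q. q \<otimes> p)"
  by (rule mdiff_mult[OF mdiff_id mdiff_const])

lemma deriv_mult_right:
  assumes "c1 \<in> A" "c \<in> A" "d \<in> A" "p \<in> fst c1" "q \<in> fst c" "q \<otimes> p \<in> fst d"
  shows "deriv_loc c d (\<lambda>q. q \<otimes> p) q v = frechet_derivative (mult_loc c c1 d) (at (snd c q, snd c1 p)) (v, 0)"
  using fd_eq[OF deriv_loc_mult_has_derivative[OF mdiff_id mdiff_const assms(2,2,1,3,5,5,4,6)]] assms
  by (simp add: deriv_loc_const deriv_loc_id deriv_loc_def[of c d])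

abbreviation \<mu> :: "'e \<times> 'e \<Rightarrow> 'e" where "\<mu> \<equiv> mult_loc c0 c0 c0"
abbreviation \<mu>_dom :: "('e \<times> 'e) set" where "\<mu>_dom \<equiv> mult_dom c0 c0 c0"

lemma \<mu>_smooth: "smooth_on \<mu>_dom \<mu>" and \<mu>_dom_open: "open \<mu>_dom" and \<mu>_dom_y0: "(y0, y0) \<in> \<mu>_dom"
  using mult_loc_smooth[OF c0(1) c0(1) c0(1)] mult_dom_open[OF c0(1) c0(1) c0(1)]
    mult_domI[OF c0(1) c0(1) c0(2) c0(2)] c0(2) by (simp_all add: y0_def)

text \<open>Fixing either factor at the identity turns the product into the identity map, so both
  partial derivatives at \<open>(y0, y0)\<close> are the identity.\<close>

lemma \<mu>_deriv_y0: "frechet_derivative \<mu> (at (y0, y0)) (u, v) = u + v"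
proof -
  have lin: "linear (frechet_derivative \<mu> (at (y0, y0)))"
    by (rule fd_linear[OF smooth_on_differentiable[OF \<mu>_smooth \<mu>_dom_y0]])
  have "frechet_derivative \<mu> (at (y0, y0)) (u, 0) = u"
    using deriv_mult_right[OF c0(1) c0(1) c0(1) c0(2) c0(2)] c0 deriv_loc_id[OF c0]
    by (simp add: y0_def)
  moreover have "frechet_derivative \<mu> (at (y0, y0)) (0, v) = v"
    using deriv_mult_left[OF c0(1) c0(1) c0(1) c0(2) c0(2)] c0 deriv_loc_id[OF c0]
    by (simp add: y0_def)
  ultimately show ?thesis using linear_add[OF lin, of "(u, 0)" "(0, v)"] by simp
qed

text \<open>The bilinear term of the group law in its second-order Taylor expansion at the identity;
  its antisymmetrisation \<open>br\<close> is the Lie algebra bracket in the coordinates of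
  \<open>c0\<close>, as \<open>lie_bracket_lfield\<close> confirms.\<close>

definition mixed :: "'e \<Rightarrow> 'e \<Rightarrow> 'e" where
  "mixed a b = second_deriv \<mu> (y0, y0) (a, 0) (0, b)"

definition br :: "'e \<Rightarrow> 'e \<Rightarrow> 'e" where
  "br a b = mixed a b - mixed b a"

lemma linear_Pair0: "linear (\<lambda>a. (a, 0))" "linear (\<lambda>a. (0, a))"
  by (auto intro!: linearI)

lemma mixed_linear: "linear (\<lambda>a. mixed a b)" "linear (\<lambda>b. mixed a b)"
  unfolding mixed_def
  using linear_compose[OF linear_Pair0(1) second_deriv_linear_left[OF \<mu>_smooth \<mu>_dom_y0]]
    linear_compose[OF linear_Pair0(2) second_deriv_linear_right[OF \<mu>_dom_open \<mu>_dom_y0 \<mu>_smooth]]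
  by (simp_all add: o_def)

lemma br_linear: "linear (\<lambda>a. br a b)" "linear (\<lambda>b. br a b)"
  unfolding br_def by (intro linear_compose_sub mixed_linear)+

lemma br_antisym: "br a b = - br b a"
  by (simp add: br_def)

text \<open>Differentiate the associative law \<open>m(x, \<mu>(y, z)) = m(m(x, y), z)\<close> in the direction \<open>b\<close> of \<open>z\<close>
  and then in the direction \<open>a\<close> of \<open>y\<close>, at \<open>y = z = y0\<close>.\<close>

lemma lfield_bracket_aux:
  assumes d: "d \<in> A" "p \<in> fst d"
  shows "frechet_derivative (\<lambda>x. lfield b (chart_inv d x) d) (at (snd d p)) (lfield a p d)
    = second_deriv (mult_loc d c0 d) (snd d p, y0) (0, a) (0, b) + lfield (mixed a b) p d"
proof -
  note ch = is_chart[OF d(1)] and im = chart_image_open[OF is_chart[OF d(1)]]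
  define m where "m = mult_loc d c0 d"
  let ?O = "mult_dom d c0 d" and ?x = "snd d p"
  have m: "smooth_on ?O m" and O: "open ?O"
    unfolding m_def using mult_loc_smooth[OF d(1) c0(1) d(1)] mult_dom_open[OF d(1) c0(1) d(1)] by blast+
  have xO: "(?x, y0) \<in> ?O" using mult_domI[OF d(1) c0(1) d(2) c0(2)] d by (simp add: y0_def)
  have x: "?x \<in> snd d ` fst d" using d by blast
  have mlin: "linear (frechet_derivative m (at (?x, y0)))"
    by (rule fd_linear[OF smooth_on_differentiable[OF m xO]])
  have ea: "lfield a p d = frechet_derivative m (at (?x, y0)) (0, a)" for a
    using deriv_left_mult[OF d] d by (simp add: lfield_chart m_def)
  have "((\<lambda>x. frechet_derivative m (at (x, y0)) (0, b)) has_derivative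
     (\<lambda>w. second_deriv m (?x, y0) (w, 0) (0, b) + frechet_derivative m (at (?x, y0)) 0)) (at ?x)"
    by (rule has_derivative_fd_apply[OF O m, where \<phi> = "\<lambda>x. (x, y0)" and v = "\<lambda>x. (0, b)"])
      (rule xO has_derivative_Pair_const has_derivative_const)+
  then have 1: "((\<lambda>x. lfield b (chart_inv d x) d) has_derivative
     (\<lambda>w. second_deriv m (?x, y0) (w, 0) (0, b) + frechet_derivative m (at (?x, y0)) 0)) (at ?x)"
  proof (rule has_derivative_transform_within_open[OF _ im x])
    fix x assume x: "x \<in> snd d ` fst d"
    show "frechet_derivative m (at (x, y0)) (0, b) = lfield b (chart_inv d x) d"
      using deriv_left_mult[OF d(1) chart_inv_in[OF ch x]] chart_inv_right[OF ch x]
      by (simp add: m_def lfield_chart[OF d(1) chart_inv_in[OF ch x]])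
  qed
  have mx: "m (?x, y0) = ?x" using mult_loc_chart[OF d(1) c0(1) d(2) c0(2)] by (simp add: m_def y0_def)
  let ?N = "snd c0 ` (fst c0 \<inter> ((\<lambda>q. p \<otimes> q) -` fst d))"
  have "open ((\<lambda>q. p \<otimes> q) -` fst d)"
    using mdiff_left[of p] chart_open[OF ch] unfolding mdiff_def
    by (metis open_vimage)
  then have N: "open ?N" by (rule chart_image_open_Int[OF is_chart[OF c0(1)]])
  have yN: "y0 \<in> ?N" using c0 d by (auto simp: y0_def)
  \<comment> \<open>Associativity differentiated once, in the last factor at the identity. The
    domain \<open>?N\<close> keeps \<open>p \<otimes> q\<close> inside the chart
    \<open>d\<close>.\<close>
  have key: "frechet_derivative m (at (?x, y)) (0, frechet_derivative \<mu> (at (y, y0)) (0, b))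
      = frechet_derivative m (at (m (?x, y), y0)) (0, b)" if y: "y \<in> ?N" for y
  proof -
    obtain q where q: "y = snd c0 q" "q \<in> fst c0" "p \<otimes> q \<in> fst d" using y by auto
    have "frechet_derivative m (at (?x, y)) (0, frechet_derivative \<mu> (at (y, y0)) (0, b))
      = deriv_loc c0 d (\<lambda>q. p \<otimes> q) q (deriv_loc c0 c0 (\<lambda>r. q \<otimes> r) \<one> b)"
      using deriv_mult_left[OF d(1) c0(1) d(1) d(2) q(2,3)] deriv_left_mult[OF c0(1) q(2)]
      by (simp add: q(1) m_def)
    also have "\<dots> = deriv_loc c0 d (\<lambda>r. p \<otimes> (q \<otimes> r)) \<one> b"
      using deriv_loc_compose[OF mdiff_left mdiff_left c0(1) c0(1) d(1) c0(2), of q p b] q by simp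
    also have "(\<lambda>r. p \<otimes> (q \<otimes> r)) = (\<lambda>r. p \<otimes> q \<otimes> r)" by (simp add: m_assoc)
    also have "deriv_loc c0 d (\<lambda>r. p \<otimes> q \<otimes> r) \<one> b = frechet_derivative m (at (m (?x, y), y0)) (0, b)"
      using deriv_left_mult[OF d(1) q(3)] mult_loc_chart[OF d(1) c0(1) d(2) q(2)] by (simp add: m_def q(1))
    finally show ?thesis .
  qed
  have v: "((\<lambda>y. frechet_derivative \<mu> (at (y, y0)) (0, b)) has_derivative
     (\<lambda>a. mixed a b + frechet_derivative \<mu> (at (y0, y0)) 0)) (at y0)"
    unfolding mixed_def
    by (rule has_derivative_fd_apply[OF \<mu>_dom_open \<mu>_smooth, where \<phi> = "\<lambda>x. (x, y0)" and v = "\<lambda>x. (0, b)"])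
      (rule \<mu>_dom_y0 has_derivative_Pair_const has_derivative_const)+
  have v': "((\<lambda>y. frechet_derivative \<mu> (at (y, y0)) (0, b)) has_derivative (\<lambda>a. mixed a b)) (at y0)"
    using v \<mu>_deriv_y0[of 0 0] by (simp add: zero_prod_def)
  have "((\<lambda>y. frechet_derivative m (at (?x, y)) (0, frechet_derivative \<mu> (at (y, y0)) (0, b))) has_derivative
     (\<lambda>a. second_deriv m (?x, y0) (0, a) (0, frechet_derivative \<mu> (at (y0, y0)) (0, b))
        + frechet_derivative m (at (?x, y0)) (0, mixed a b))) (at y0)"
    by (rule has_derivative_fd_apply[OF O m, where \<phi> = "\<lambda>y. (?x, y)"
          and v = "\<lambda>y. (0, frechet_derivative \<mu> (at (y, y0)) (0, b))"
          and v' = "\<lambda>a. (0, mixed a b)"])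
      (rule xO has_derivative_Pair_const has_derivative_Pair[OF has_derivative_const v'])+
  then have L: "((\<lambda>y. frechet_derivative m (at (m (?x, y), y0)) (0, b)) has_derivative
     (\<lambda>a. second_deriv m (?x, y0) (0, a) (0, b) + frechet_derivative m (at (?x, y0)) (0, mixed a b))) (at y0)"
    unfolding \<mu>_deriv_y0 add_0
    by (rule has_derivative_transform_within_open[OF _ N yN key])
  have "((\<lambda>y. (?x, y)) has_derivative (\<lambda>a. (0, a))) (at y0)" by (rule has_derivative_Pair_const)
  from diff_chain_at[OF this smooth_on_has_derivative[OF m xO]]
  have mx': "((\<lambda>y. m (?x, y)) has_derivative (\<lambda>a. frechet_derivative m (at (?x, y0)) (0, a))) (at y0)"
    by (simp add: o_def)
  have "((\<lambda>y. frechet_derivative m (at (m (?x, y), y0)) (0, b)) has_derivative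
     (\<lambda>a. second_deriv m (m (?x, y0), y0) (frechet_derivative m (at (?x, y0)) (0, a), 0) (0, b)
        + frechet_derivative m (at (m (?x, y0), y0)) 0)) (at y0)"
    by (rule has_derivative_fd_apply[OF O m, where \<phi> = "\<lambda>y. (m (?x, y), y0)" and v = "\<lambda>y. (0, b)"])
      (simp add: mx xO, rule has_derivative_Pair[OF mx' has_derivative_const], rule has_derivative_const)
  \<comment> \<open>The same function of \<open>y\<close> has been differentiated through either
    side of \<open>key\<close>. The right-hand result moves the base point along
    \<open>lfield a\<close>, which is the derivative of \<open>lfield b\<close> computed in
    \<open>1\<close>.\<close>
  from fun_cong[OF has_derivative_unique[OF L this], of a]
  have "second_deriv m (?x, y0) (0, a) (0, b) + frechet_derivative m (at (?x, y0)) (0, mixed a b)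
     = second_deriv m (?x, y0) (frechet_derivative m (at (?x, y0)) (0, a), 0) (0, b)"
    by (simp only: mx linear_0[OF mlin] add_0_right)
  then show ?thesis
    unfolding fd_eq[OF 1] by (simp only: ea m_def[symmetric] linear_0[OF mlin] add_0_right)
qed

text \<open>In the two instances of \<open>lfield_bracket_aux\<close> the second derivative in the
  second argument is symmetric in \<open>a\<close> and \<open>b\<close> and drops out of the
  difference, leaving \<open>mixed a b - mixed b a\<close>.\<close>

lemma lie_bracket_lfield: "lie_bracket A (lfield a) (lfield b) = lfield (br a b)"
proof (intro ext)
  fix p d
  show "lie_bracket A (lfield a) (lfield b) p d = lfield (br a b) p d"
  proof (cases "d \<in> A \<and> p \<in> fst d")
    case True
    then have xO: "(snd d p, y0) \<in> mult_dom d c0 d"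
      using mult_domI[of d c0 p \<one> d] c0 by (simp add: y0_def)
    have "second_deriv (mult_loc d c0 d) (snd d p, y0) (0, a) (0, b)
      = second_deriv (mult_loc d c0 d) (snd d p, y0) (0, b) (0, a)"
      using second_deriv_commute[OF mult_dom_open xO mult_loc_smooth] True c0 by blast
    then show ?thesis
      using True lfield_bracket_aux[of d p a b] lfield_bracket_aux[of d p b a]
      by (simp add: lie_bracket_def br_def linear_diff[OF lfield_linear])
  next
    case False
    then show ?thesis unfolding lie_bracket_def lfield_def[of "br a b"] by presburger
  qed
qed

end

section \<open>The adjoint representation\<close>

context lie_grp
begin

definition conjug :: "'g \<Rightarrow> 'g \<Rightarrow> 'g" where
  "conjug h q = h \<otimes> q \<otimes> inv h"

definition commut :: "'g \<Rightarrow> 'g \<Rightarrow> 'g" where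
  "commut h q = h \<otimes> q \<otimes> inv h \<otimes> inv q"

lemma mdiff_conjug: "mdiff (conjug h)"
  unfolding conjug_def by (intro mdiff_mult mdiff_const mdiff_id)

lemma mdiff_commut: "mdiff (commut h)"
  unfolding commut_def by (intro mdiff_mult mdiff_const mdiff_id mdiff_inv)

lemma conjug_one [simp]: "conjug h \<one> = \<one>"
  by (simp add: conjug_def)

lemma commut_one [simp]: "commut h \<one> = \<one>"
  by (simp add: commut_def)

lemma inv_cancel: "inv h \<otimes> (h \<otimes> q) = q" "h \<otimes> (inv h \<otimes> q) = q"
  by (simp_all add: m_assoc[symmetric])

lemma commut_mult: "commut h q \<otimes> q = conjug h q"
  by (simp add: commut_def conjug_def m_assoc)

definition Ad :: "'g \<Rightarrow> 'e \<Rightarrow> 'e" where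
  "Ad h = deriv_loc c0 c0 (conjug h) \<one>"

lemma Ad_linear: "linear (Ad h)"
  unfolding Ad_def by (rule deriv_loc_linear[OF mdiff_conjug c0(1) c0(1) c0(2)]) (simp add: c0)

lemma Ad_mult: "Ad (h \<otimes> k) b = Ad h (Ad k b)"
proof -
  have "conjug (h \<otimes> k) = (\<lambda>q. conjug h (conjug k q))"
    by (rule ext) (simp add: conjug_def m_assoc inv_mult_group)
  then show ?thesis
    unfolding Ad_def using deriv_loc_compose[OF mdiff_conjug mdiff_conjug c0(1) c0(1) c0(1) c0(2), of k h b] c0(2)
    by simp
qed

lemma Ad_one: "Ad \<one> b = b"
proof -
  have "conjug \<one> = (\<lambda>q. q)" by (rule ext) (simp add: conjug_def)
  then show ?thesis unfolding Ad_def using deriv_loc_id[OF c0] by simp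
qed

text \<open>Since \<open>commut h q \<otimes> q = conjug h q\<close> and the group law
  differentiates to addition at the identity, the derivatives of the two factors add up to
  \<open>Ad h\<close>.\<close>

lemma deriv_commut: "deriv_loc c0 c0 (commut h) \<one> v = Ad h v - v"
proof -
  have 1: "deriv_loc c0 c0 (\<lambda>q. commut h q \<otimes> q) \<one> v =
    frechet_derivative \<mu> (at (snd c0 (commut h \<one>), snd c0 \<one>)) (deriv_loc c0 c0 (commut h) \<one> v, deriv_loc c0 c0 (\<lambda>q. q) \<one> v)"
    unfolding deriv_loc_def[of c0 c0 "\<lambda>q. commut h q \<otimes> q"]
    by (rule fun_cong[OF fd_eq[OF deriv_loc_mult_has_derivative[OF mdiff_commut mdiff_id c0(1) c0(1) c0(1) c0(1)]]])
      (simp_all add: c0)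
  have "Ad h v = deriv_loc c0 c0 (\<lambda>q. commut h q \<otimes> q) \<one> v"
    unfolding commut_mult by (simp add: Ad_def)
  also have "\<dots> = deriv_loc c0 c0 (commut h) \<one> v + v"
    unfolding 1 by (simp add: y0_def[symmetric] \<mu>_deriv_y0 deriv_loc_id[OF c0])
  finally show ?thesis by simp
qed

lemma deriv_inv: "deriv_loc c0 c0 (\<lambda>q. inv q) \<one> v = - v"
proof -
  have 1: "deriv_loc c0 c0 (\<lambda>q. q \<otimes> inv q) \<one> v =
    frechet_derivative \<mu> (at (snd c0 \<one>, snd c0 (inv \<one>))) (deriv_loc c0 c0 (\<lambda>q. q) \<one> v, deriv_loc c0 c0 (\<lambda>q. inv q) \<one> v)"
    unfolding deriv_loc_def[of c0 c0 "\<lambda>q. q \<otimes> inv q"]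
    by (rule fun_cong[OF fd_eq[OF deriv_loc_mult_has_derivative[OF mdiff_id mdiff_inv c0(1) c0(1) c0(1) c0(1)]]])
      (simp_all add: c0)
  have "0 = deriv_loc c0 c0 (\<lambda>q. q \<otimes> inv q) \<one> v"
    by (simp add: deriv_loc_const)
  also have "\<dots> = v + deriv_loc c0 c0 (\<lambda>q. inv q) \<one> v"
    unfolding 1 by (simp add: y0_def[symmetric] \<mu>_deriv_y0 deriv_loc_id[OF c0])
  finally show ?thesis by (metis add_eq_0_iff)
qed

text \<open>Conjugation is split into left translation by \<open>q\<close> and right translation by
  \<open>inv q\<close>, so that \<open>Ad q b\<close> becomes an expression in derivatives of
  \<open>\<mu>\<close> that can be differentiated in \<open>q\<close>.\<close>

lemma Ad_chart:
  assumes "q \<in> fst c0" "inv q \<in> fst c0"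
  shows "Ad q b = frechet_derivative \<mu> (at (snd c0 q, snd c0 (inv q)))
    (frechet_derivative \<mu> (at (snd c0 q, y0)) (0, b), 0)"
proof -
  have "Ad q b = deriv_loc c0 c0 (\<lambda>r. (q \<otimes> r) \<otimes> inv q) \<one> b"
    by (simp add: Ad_def conjug_def[abs_def])
  also have "\<dots> = deriv_loc c0 c0 (\<lambda>r. r \<otimes> inv q) (q \<otimes> \<one>) (deriv_loc c0 c0 (\<lambda>r. q \<otimes> r) \<one> b)"
    by (rule deriv_loc_compose[OF mdiff_right mdiff_left]) (use assms c0 in auto)
  also have "\<dots> = frechet_derivative \<mu> (at (snd c0 q, snd c0 (inv q)))
    (frechet_derivative \<mu> (at (snd c0 q, y0)) (0, b), 0)"
    using deriv_mult_right[OF c0(1) c0(1) c0(1) assms(2,1)] deriv_left_mult[OF c0(1) assms(1)] c0 by simp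
  finally show ?thesis .
qed

text \<open>\<open>\<mu> (x, y0) = x\<close>, so the Taylor expansion has no second-order term in
  the first argument alone.\<close>

lemma second_deriv_\<mu>_right: "second_deriv \<mu> (y0, y0) (a, 0) (b, 0) = 0"
proof -
  have "((\<lambda>x. frechet_derivative \<mu> (at (x, y0)) (b, 0)) has_derivative
     (\<lambda>a. second_deriv \<mu> (y0, y0) (a, 0) (b, 0) + frechet_derivative \<mu> (at (y0, y0)) 0)) (at y0)"
    by (rule has_derivative_fd_apply[OF \<mu>_dom_open \<mu>_smooth, where \<phi> = "\<lambda>x. (x, y0)" and v = "\<lambda>x. (b, 0)"])
      (rule \<mu>_dom_y0 has_derivative_Pair_const has_derivative_const)+
  moreover have "((\<lambda>x. frechet_derivative \<mu> (at (x, y0)) (b, 0)) has_derivative (\<lambda>a. 0)) (at y0)"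
  proof (rule has_derivative_transform_within_open[OF has_derivative_const[of b] chart_image_open[OF is_chart[OF c0(1)]] y0_in])
    fix x assume "x \<in> snd c0 ` fst c0"
    then obtain q where q: "x = snd c0 q" "q \<in> fst c0" by blast
    then show "b = frechet_derivative \<mu> (at (x, y0)) (b, 0)"
      using deriv_mult_right[OF c0(1) c0(1) c0(1) c0(2) q(2)] deriv_loc_id[OF c0(1) q(2)]
      by (simp add: y0_def)
  qed
  ultimately have "(\<lambda>a. second_deriv \<mu> (y0, y0) (a, 0) (b, 0) + frechet_derivative \<mu> (at (y0, y0)) 0) = (\<lambda>a. 0)"
    by (rule has_derivative_unique)
  from fun_cong[OF this, of a] show ?thesis using \<mu>_deriv_y0[of 0 0] by (simp add: zero_prod_def)
qed

text \<open>The derivative of \<open>Ad\<close> at the identity is \<open>ad\<close>: left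
  translation contributes \<open>mixed a b\<close>, right translation by the inverse contributes
  \<open>- mixed b a\<close>.\<close>

lemma Ad_has_derivative: "((\<lambda>x. Ad (chart_inv c0 x) b) has_derivative (\<lambda>a. br a b)) (at y0)"
proof -
  let ?i = "snd c0 \<circ> (\<lambda>q. inv q) \<circ> chart_inv c0"
  have "deriv_loc c0 c0 (\<lambda>q. inv q) \<one> = (\<lambda>a. - a)" by (rule ext) (rule deriv_inv)
  then have i: "(?i has_derivative (\<lambda>a. - a)) (at y0)"
    using mdiff_has_derivative[OF mdiff_inv c0(1) c0(1) c0(2)] c0(2) by (simp add: y0_def)
  have i0: "?i y0 = y0" by (simp add: y0_def[symmetric])
  have "((\<lambda>y. frechet_derivative \<mu> (at (y, y0)) (0, b)) has_derivative
     (\<lambda>a. mixed a b + frechet_derivative \<mu> (at (y0, y0)) 0)) (at y0)"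
    unfolding mixed_def
    by (rule has_derivative_fd_apply[OF \<mu>_dom_open \<mu>_smooth, where \<phi> = "\<lambda>x. (x, y0)" and v = "\<lambda>x. (0, b)"])
      (rule \<mu>_dom_y0 has_derivative_Pair_const has_derivative_const)+
  then have v: "((\<lambda>y. frechet_derivative \<mu> (at (y, y0)) (0, b)) has_derivative (\<lambda>a. mixed a b)) (at y0)"
    using \<mu>_deriv_y0[of 0 0] by (simp add: zero_prod_def)
  have d: "((\<lambda>x. frechet_derivative \<mu> (at (x, ?i x)) (frechet_derivative \<mu> (at (x, y0)) (0, b), 0)) has_derivative
    (\<lambda>a. second_deriv \<mu> (y0, ?i y0) (a, - a) (frechet_derivative \<mu> (at (y0, y0)) (0, b), 0)
      + frechet_derivative \<mu> (at (y0, ?i y0)) (mixed a b, 0))) (at y0)"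
    by (rule has_derivative_fd_apply[OF \<mu>_dom_open \<mu>_smooth, where \<phi> = "\<lambda>x. (x, ?i x)"
          and v = "\<lambda>x. (frechet_derivative \<mu> (at (x, y0)) (0, b), 0)"])
      (simp only: i0 \<mu>_dom_y0, rule has_derivative_Pair[OF has_derivative_ident i],
        rule has_derivative_Pair[OF v has_derivative_const])
  have lin: "linear (\<lambda>u. second_deriv \<mu> (y0, y0) u (b, 0))"
    by (rule second_deriv_linear_left[OF \<mu>_smooth \<mu>_dom_y0])
  \<comment> \<open>The direction is \<open>(a, - a)\<close> because inversion has derivative
    \<open>-1\<close>; its first component contributes nothing by
    \<open>second_deriv_\<mu>_right\<close>.\<close>
  have s: "second_deriv \<mu> (y0, y0) (a, - a) (b, 0) = - mixed b a" for a
  proof -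
    have "second_deriv \<mu> (y0, y0) (a, - a) (b, 0) = second_deriv \<mu> (y0, y0) ((a, 0) - (0, a)) (b, 0)" by simp
    also have "\<dots> = - second_deriv \<mu> (y0, y0) (0, a) (b, 0)"
      unfolding linear_diff[OF lin] second_deriv_\<mu>_right by simp
    also have "second_deriv \<mu> (y0, y0) (0, a) (b, 0) = mixed b a"
      unfolding mixed_def by (rule second_deriv_commute[OF \<mu>_dom_open \<mu>_dom_y0 \<mu>_smooth])
    finally show ?thesis .
  qed
  have "(\<lambda>a. second_deriv \<mu> (y0, ?i y0) (a, - a) (frechet_derivative \<mu> (at (y0, y0)) (0, b), 0)
      + frechet_derivative \<mu> (at (y0, ?i y0)) (mixed a b, 0)) = (\<lambda>a. br a b)"
    unfolding i0 \<mu>_deriv_y0 by (simp add: s br_def)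
  with d have d': "((\<lambda>x. frechet_derivative \<mu> (at (x, ?i x)) (frechet_derivative \<mu> (at (x, y0)) (0, b), 0)) has_derivative
    (\<lambda>a. br a b)) (at y0)" by simp
  have "open ((\<lambda>q. inv q) -` fst c0)"
    using inv_continuous chart_open[OF is_chart[OF c0(1)]] by (metis open_vimage)
  then have N: "open (snd c0 ` (fst c0 \<inter> (\<lambda>q. inv q) -` fst c0))"
    by (rule chart_image_open_Int[OF is_chart[OF c0(1)]])
  have yN: "y0 \<in> snd c0 ` (fst c0 \<inter> (\<lambda>q. inv q) -` fst c0)" using c0 by (auto simp: y0_def)
  show ?thesis
  proof (rule has_derivative_transform_within_open[OF d' N yN])
    fix x assume "x \<in> snd c0 ` (fst c0 \<inter> (\<lambda>q. inv q) -` fst c0)"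
    then obtain q where q: "x = snd c0 q" "q \<in> fst c0" "inv q \<in> fst c0" by auto
    then have "chart_inv c0 x = q" using chart_inv_left[OF is_chart[OF c0(1)]] by blast
    then show "frechet_derivative \<mu> (at (x, ?i x)) (frechet_derivative \<mu> (at (x, y0)) (0, b), 0) = Ad (chart_inv c0 x) b"
      using Ad_chart[OF q(2,3), of b] q(1) by simp
  qed
qed

text \<open>The abstract group is nilpotent, so composing enough commutator maps \<open>commut h\<close> gives the
  constant map; by \<open>deriv_commut\<close> the operators \<open>Ad h - 1\<close> are therefore jointly nilpotent, which
  the following filtration records.\<close>

primrec ad_fil :: "nat \<Rightarrow> 'e set" where
  "ad_fil 0 = {0}"
| "ad_fil (Suc k) = {b. \<forall>h. Ad h b - b \<in> ad_fil k}"

lemma ad_fil_subspace: "subspace (ad_fil k)"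
proof (induction k)
  case 0
  then show ?case by simp
next
  case (Suc k)
  then show ?case
    by (simp add: subspace_def linear_0[OF Ad_linear] linear_add[OF Ad_linear] linear_scale[OF Ad_linear]
        add_diff_add scaleR_diff_right[symmetric])
qed

text \<open>\<open>Ad h b - b\<close> stays in the subspace \<open>ad_fil k\<close> for all
  \<open>h\<close>, hence so does its derivative in \<open>h\<close> at the identity.\<close>

lemma br_ad_fil:
  assumes "b \<in> ad_fil (Suc k)" shows "br a b \<in> ad_fil k"
proof (rule has_derivative_in_subspace[OF Ad_has_derivative ad_fil_subspace])
  fix x
  show "Ad (chart_inv c0 x) b - Ad (chart_inv c0 y0) b \<in> ad_fil k"
    using assms by (simp add: Ad_one)
qed

lemma commut_lower_central:
  "q \<in> lower_central G k \<Longrightarrow> commut h q \<in> lower_central G (Suc k)"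
  by (auto simp: commut_def intro!: generate.incl)

text \<open>Composing \<open>H\<close> with \<open>commut h\<close> moves its values one step down
  the lower central series and applies \<open>Ad h - 1\<close> to its derivative. After
  \<open>k\<close> such compositions the values lie in the trivial group and the derivative is
  zero.\<close>

lemma deriv_in_ad_fil:
  assumes "lower_central G n = {\<one>}" "k \<le> n" "mdiff H" "H \<one> = \<one>" "\<And>q. H q \<in> lower_central G (n - k)"
  shows "deriv_loc c0 c0 H \<one> v \<in> ad_fil k"
  using assms(2-5)
proof (induction k arbitrary: H)
  case 0
  then have "H = (\<lambda>q. \<one>)" using assms(1) by (intro ext) simp
  then show ?case by (simp add: deriv_loc_const)
next
  case (Suc k)
  have "Ad h (deriv_loc c0 c0 H \<one> v) - deriv_loc c0 c0 H \<one> v \<in> ad_fil k" for h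
  proof -
    have "deriv_loc c0 c0 (\<lambda>q. commut h (H q)) \<one> v \<in> ad_fil k"
    proof (rule Suc.IH)
      show "k \<le> n" using Suc.prems by simp
      show "mdiff (\<lambda>q. commut h (H q))" by (rule mdiff_compose[OF mdiff_commut Suc.prems(2)])
      show "commut h (H \<one>) = \<one>" using Suc.prems by simp
      fix q
      have "n - k = Suc (n - Suc k)" using Suc.prems by simp
      then show "commut h (H q) \<in> lower_central G (n - k)"
        using commut_lower_central[OF Suc.prems(4)[of q]] by metis
    qed
    moreover have "deriv_loc c0 c0 (\<lambda>q. commut h (H q)) \<one> v = deriv_loc c0 c0 (commut h) (H \<one>) (deriv_loc c0 c0 H \<one> v)"
      by (rule deriv_loc_compose[OF mdiff_commut Suc.prems(2)]) (use c0 Suc.prems(3) in auto)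
    ultimately show ?thesis using deriv_commut Suc.prems(3) by simp
  qed
  then show ?case by simp
qed

lemma ad_fil_UNIV:
  assumes "lower_central G n = {\<one>}" shows "ad_fil n = UNIV"
proof -
  have "v \<in> ad_fil n" for v
    using deriv_in_ad_fil[OF assms order_refl mdiff_id, of v] deriv_loc_id[OF c0] by simp
  then show ?thesis by blast
qed

text \<open>A zero bracket makes \<open>Ad\<close> stationary at the identity; multiplicativity
  transports this to every point, and connectedness turns stationary into constant.\<close>

lemma Ad_trivial:
  assumes con: "connected (UNIV :: 'g set)" and br: "\<And>a b. br a b = 0"
  shows "Ad h b = b"
proof -
  have "Ad h b = Ad \<one> b"
  proof (rule locally_constant_connected[OF con, of "\<lambda>h. Ad h b"])
    fix p
    let ?c = "chart_at A p"
    note c = chart_at_props[of p]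
    have z: "((\<lambda>q. Ad q b) \<circ> chart_inv ?c has_derivative (\<lambda>v. 0)) (at (snd ?c q))" if q: "q \<in> fst ?c" for q
    proof -
      have 0: "((\<lambda>r. Ad q (Ad r b)) \<circ> chart_inv c0 has_derivative (\<lambda>v. 0)) (at (snd c0 (inv q \<otimes> q)))"
        using bounded_linear.has_derivative[OF linear_conv_bounded_linear[THEN iffD1, OF Ad_linear[of q]] Ad_has_derivative[of b]]
        by (simp add: br linear_0[OF Ad_linear] o_def y0_def)
      \<comment> \<open>Writing \<open>Ad r b = Ad q (Ad (inv q \<otimes> r) b)\<close> moves the
        point \<open>q\<close> to the identity.\<close>
      have "((\<lambda>r. Ad q (Ad r b)) \<circ> (\<lambda>r. inv q \<otimes> r) \<circ> chart_inv ?c has_derivative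
         ((\<lambda>v. 0) \<circ> deriv_loc ?c c0 (\<lambda>r. inv q \<otimes> r) q)) (at (snd ?c q))"
        by (rule chart_chain_map[OF is_chart[OF c(1)] is_chart[OF c0(1)] mdiff_isCont[OF mdiff_left] q _
              mdiff_has_derivative[OF mdiff_left c(1) c0(1) q] 0]) (simp_all add: c0)
      moreover have "(\<lambda>r. Ad q (Ad r b)) \<circ> (\<lambda>r. inv q \<otimes> r) = (\<lambda>r. Ad r b)"
        by (rule ext) (simp add: Ad_mult[symmetric] m_assoc[symmetric])
      moreover have "(\<lambda>v. 0::'e) \<circ> deriv_loc ?c c0 (\<lambda>r. inv q \<otimes> r) q = (\<lambda>v. 0)" by (simp add: o_def)
      ultimately show ?thesis by (simp only:)
    qed
    show "\<exists>U. open U \<and> p \<in> U \<and> (\<forall>q\<in>U. Ad q b = Ad p b)"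
      using zero_derivative_local_const[OF c(1) chart_open[OF is_chart[OF c(1)]] c(2) subset_refl z] by blast
  qed
  then show ?thesis by (simp add: Ad_one)
qed

text \<open>If \<open>Ad\<close> is trivial, each \<open>commut h\<close> has zero derivative at the
  identity by \<open>deriv_commut\<close>, hence everywhere by a translation identity; it is then
  constant on the connected group and all elements commute.\<close>

lemma br_nontrivial:
  assumes con: "connected (UNIV :: 'g set)" and nc: "\<not> comm_group G"
  shows "\<exists>a b. br a b \<noteq> 0"
proof (rule ccontr)
  assume "\<not> ?thesis"
  then have Ad: "Ad h b = b" for h b using Ad_trivial[OF con] by blast
  have "commut h q = \<one>" for h q
  proof -
    have "commut h q = commut h \<one>"
    proof (rule locally_constant_connected[OF con, of "commut h"])
      fix p
      let ?c = "chart_at A p" and ?d = "chart_at A (commut h p)"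
      note c = chart_at_props[of p] and d = chart_at_props[of "commut h p"]
      let ?W = "fst ?c \<inter> commut h -` fst ?d"
      have "open (commut h -` fst ?d)"
        using mdiff_commut[of h] chart_open[OF is_chart[OF d(1)]] unfolding mdiff_def by (metis open_vimage)
      then have W: "open ?W" "p \<in> ?W" "?W \<subseteq> fst ?c"
        using c d chart_open[OF is_chart[OF c(1)]] by auto
      have z: "((snd ?d \<circ> commut h) \<circ> chart_inv ?c has_derivative (\<lambda>v. 0)) (at (snd ?c q))" if q: "q \<in> ?W" for q
      proof -
        \<comment> \<open>From \<open>commut h (q \<otimes> s) = conjug h q \<otimes> commut h s
          \<otimes> inv q\<close>, used with \<open>s = inv q \<otimes> r\<close>: near
          \<open>q\<close> the map is \<open>commut h\<close> near the identity followed by the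
          fixed map \<open>F\<close>.\<close>
        define F where "F = (\<lambda>s. conjug h q \<otimes> s \<otimes> inv q)"
        have F: "mdiff F" unfolding F_def by (intro mdiff_mult mdiff_const mdiff_id)
        have L: "mdiff (\<lambda>r. commut h (inv q \<otimes> r))" by (rule mdiff_compose[OF mdiff_commut mdiff_left])
        have eq: "commut h = (\<lambda>r. F (commut h (inv q \<otimes> r)))"
        proof
          fix r
          have "h \<otimes> r = h \<otimes> q \<otimes> inv h \<otimes> (h \<otimes> (inv q \<otimes> r))" by (simp add: m_assoc inv_cancel)
          then show "commut h r = F (commut h (inv q \<otimes> r))"
            by (simp add: F_def commut_def conjug_def m_assoc inv_mult_group inv_cancel)
        qed
        have "deriv_loc ?c ?d (\<lambda>r. F (commut h (inv q \<otimes> r))) q v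
          = deriv_loc c0 ?d F (commut h (inv q \<otimes> q)) (deriv_loc ?c c0 (\<lambda>r. commut h (inv q \<otimes> r)) q v)" for v
          by (rule deriv_loc_compose[OF F L c(1) c0(1) d(1)])
            (use q c0 fun_cong[OF eq, of q] in auto)
        moreover have "deriv_loc ?c c0 (\<lambda>r. commut h (inv q \<otimes> r)) q v
          = deriv_loc c0 c0 (commut h) (inv q \<otimes> q) (deriv_loc ?c c0 (\<lambda>r. inv q \<otimes> r) q v)" for v
          by (rule deriv_loc_compose[OF mdiff_commut mdiff_left c(1) c0(1) c0(1)]) (use q c0 in auto)
        moreover have "F \<one> \<in> fst ?d" using fun_cong[OF eq, of q] q by simp
        ultimately have "deriv_loc ?c ?d (commut h) q = (\<lambda>v. 0)"
          using linear_0[OF deriv_loc_linear[OF F c0(1) d(1) c0(2)]] deriv_commut Ad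
          by (subst eq) (simp add: fun_eq_iff)
        then show ?thesis using mdiff_has_derivative[OF mdiff_commut c(1) d(1), of q h] q by (simp add: o_assoc)
      qed
      obtain U where U: "open U" "p \<in> U" "U \<subseteq> ?W" "\<And>q. q \<in> U \<Longrightarrow> snd ?d (commut h q) = snd ?d (commut h p)"
        using zero_derivative_local_const[OF c(1) W z] by auto
      have "commut h q = commut h p" if "q \<in> U" for q
        using U(4)[OF that] U(3) that d chart_inv_left[OF is_chart[OF d(1)]] by (metis IntD2 subsetD vimage_eq)
      then show "\<exists>U. open U \<and> p \<in> U \<and> (\<forall>q\<in>U. commut h q = commut h p)" using U by blast
    qed
    then show ?thesis by simp
  qed
  then have "h \<otimes> q = q \<otimes> h" for h q
    using commut_mult[of h q] by (simp add: conjug_def) (metis UNIV_I carrier_UNIV inv_solve_right m_closed)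
  then have "comm_group G" by (intro group_comm_groupI) auto
  then show False using nc by simp
qed

end

section \<open>Nilpotent Weyl algebras\<close>

locale skew_algebra =
  fixes br :: "'e::euclidean_space \<Rightarrow> 'e \<Rightarrow> 'e"
  assumes br_lin: "linear (\<lambda>x. br x y)" "linear (\<lambda>y. br x y)"
    and br_skew: "br x y = - br y x"
begin

lemma br_self: "br x x = 0"
proof -
  have "2 *\<^sub>R br x x = 0" using br_skew[of x x] by (metis add.right_inverse scaleR_2)
  then show ?thesis by simp
qed

section \<open>The lower central series of a bracket and two distinguished vectors\<close>

primrec lcs :: "nat \<Rightarrow> 'e set" where
  "lcs 0 = UNIV"
| "lcs (Suc k) = span {br x v | x v. v \<in> lcs k}"

lemma br_in_lcs: "v \<in> lcs k \<Longrightarrow> br x v \<in> lcs (Suc k)"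
  by (auto intro: span_base)

lemma lcs_mono_step: "lcs k \<subseteq> lcs l \<Longrightarrow> lcs (Suc k) \<subseteq> lcs (Suc l)"
  unfolding lcs.simps by (rule span_mono) blast

lemma lcs_Suc_subset: "lcs (Suc k) \<subseteq> lcs (Suc 0)"
  by (rule lcs_mono_step) simp

text \<open>Take a vector from the last nonzero term of the lower central series: its brackets land
  in the next term, which is zero.\<close>

lemma central_element_exists:
  assumes nil: "lcs n \<subseteq> {0}" and nab: "br a b \<noteq> 0"
  obtains z where "z \<noteq> 0" "\<And>x. br z x = 0" "z \<in> lcs (Suc 0)"
proof -
  define k where "k = (LEAST k. lcs k \<subseteq> {0})"
  have k: "lcs k \<subseteq> {0}" unfolding k_def using nil by (rule LeastI)
  have min: "\<not> lcs l \<subseteq> {0}" if "l < k" for l using that not_less_Least unfolding k_def by blast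
  have "br a b \<in> lcs (Suc 0)" by (rule br_in_lcs) simp
  then have 1: "\<not> lcs (Suc 0) \<subseteq> {0}" using nab by blast
  have 0: "\<not> lcs 0 \<subseteq> {0}" using nab by auto
  \<comment> \<open>The bracket is nonzero, so terms \<open>0\<close> and \<open>1\<close> are
    nonzero and the first vanishing index is at least \<open>2\<close>; this places the last nonzero
    term inside \<open>[g, g]\<close>.\<close>
  from k 0 1 obtain j where j: "k = Suc (Suc j)" by (metis old.nat.exhaust)
  obtain z where z: "z \<in> lcs (Suc j)" "z \<noteq> 0" using min[of "Suc j"] j by blast
  have "br z x = 0" for x
    using br_in_lcs[OF z(1), of x] k j br_skew[of z x] by auto
  then show ?thesis using that z lcs_Suc_subset[of j] by blast
qed

text \<open>If \<open>[g, g]\<close> and \<open>T\<close> spanned \<open>g\<close>, then \<open>[g, g] = [g, [g, g]]\<close>, contradicting nilpotency.\<close>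

lemma orthogonal_element_exists:
  assumes nil: "lcs n \<subseteq> {0}" and nab: "br a b \<noteq> 0"
  obtains x where "x \<noteq> 0" "\<And>v. v \<in> lcs (Suc 0) \<Longrightarrow> v \<bullet> x = 0" "T \<bullet> x = 0"
proof -
  let ?V = "lcs (Suc 0)"
  have sV: "span ?V = ?V" unfolding lcs.simps by (rule span_span)
  have "span (insert T ?V) \<noteq> UNIV"
  proof
    assume sp: "span (insert T ?V) = UNIV"
    have sub2: "subspace (lcs (Suc (Suc 0)))" by (simp add: subspace_span)
    have "br u v \<in> lcs (Suc (Suc 0))" for u v
    proof -
      have dec: "\<exists>k. u - k *\<^sub>R T \<in> ?V" for u
        using sp sV span_breakdown_eq[of u T ?V] by blast
      obtain s where s: "u - s *\<^sub>R T \<in> ?V" using dec by blast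
      obtain t where t: "v - t *\<^sub>R T \<in> ?V" using dec by blast
      \<comment> \<open>Modulo \<open>[g, g]\<close> both arguments are multiples of
        \<open>T\<close>, and \<open>br T T = 0\<close>; every surviving bracket has one argument in
        \<open>[g, g]\<close>.\<close>
      have "br u v = br u (v - t *\<^sub>R T) + t *\<^sub>R br u T"
        by (simp add: linear_diff[OF br_lin(2)] linear_scale[OF br_lin(2)])
      also have "br u T = - br T (u - s *\<^sub>R T)"
        by (simp add: linear_diff[OF br_lin(2)] linear_scale[OF br_lin(2)] br_self br_skew[of u T])
      finally have e: "br u v = br u (v - t *\<^sub>R T) + t *\<^sub>R (- br T (u - s *\<^sub>R T))" .
      show ?thesis unfolding e
        by (intro subspace_add[OF sub2] subspace_scale[OF sub2] subspace_neg[OF sub2] br_in_lcs s t)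
    qed
    then have "{br x v | x v. v \<in> lcs 0} \<subseteq> lcs (Suc (Suc 0))" by blast
    then have "?V \<subseteq> lcs (Suc (Suc 0))"
      unfolding lcs.simps(2)[of 0] by (rule span_minimal[OF _ sub2])
    then have step: "lcs (Suc k) \<subseteq> lcs (Suc (Suc k))" for k
      by (induction k) (use lcs_mono_step in blast)+
    have "?V \<subseteq> lcs k" for k
    proof (induction k)
      case (Suc k)
      show ?case
      proof (cases k)
        case (Suc l)
        then show ?thesis using Suc.IH step[of l] by blast
      qed simp
    qed simp
    then have "?V \<subseteq> {0}" using nil by blast
    moreover have "br a b \<in> ?V" by (rule br_in_lcs) simp
    ultimately show False using nab by blast
  qed
  then have "dim (insert T ?V) < DIM('e)"
    using dim_eq_full[of "insert T ?V"] dim_subset_UNIV[of "insert T ?V"] by linarith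
  then obtain x where x: "x \<noteq> 0" "\<And>y. y \<in> span (insert T ?V) \<Longrightarrow> orthogonal x y"
    using orthogonal_to_subspace_exists by blast
  show ?thesis
  proof (rule that[OF x(1)])
    show "T \<bullet> x = 0" using x(2)[OF span_base[of T]] by (simp add: orthogonal_def inner_commute)
    show "v \<bullet> x = 0" if "v \<in> ?V" for v
      using x(2)[OF span_base[of v]] that by (simp add: orthogonal_def inner_commute)
  qed
qed

end

section \<open>Ricci curvature of a Weyl algebra\<close>

locale weyl_algebra = skew_algebra br for br :: "'e::euclidean_space \<Rightarrow> 'e \<Rightarrow> 'e" +
  fixes N :: "'e \<Rightarrow> 'e \<Rightarrow> 'e" and T :: 'e
  assumes N_lin: "linear (\<lambda>x. N x y)" "linear (\<lambda>y. N x y)"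
    and torsion: "N x y - N y x = br x y"
    and compat: "N x y \<bullet> z + y \<bullet> N x z = 2 * (T \<bullet> x) * (y \<bullet> z)"
begin

text \<open>The usual alternating sum of three instances of \<open>compat\<close>, with differences
  of \<open>N\<close> rewritten by \<open>torsion\<close>; the Lee form supplies the last three
  terms.\<close>

lemma koszul:
  "2 * (N x y \<bullet> z) = br x y \<bullet> z - br y z \<bullet> x + br z x \<bullet> y
     + 2 * (T \<bullet> x) * (y \<bullet> z) + 2 * (T \<bullet> y) * (x \<bullet> z) - 2 * (T \<bullet> z) * (x \<bullet> y)"
proof -
  have t: "N x y \<bullet> z - N y x \<bullet> z = br x y \<bullet> z" for x y z
    by (simp add: inner_diff_left[symmetric] torsion)
  show ?thesis
    using compat[of x y z] compat[of y x z] compat[of z x y] t[of x y z] t[of y z x] t[of z x y]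
    by (simp add: inner_commute)
qed

text \<open>The diagonal of the Ricci tensor with the sign convention of \<open>curvature\<close>.
  The Einstein condition concerns a symmetric form, which its diagonal determines.\<close>

definition ric :: "'e \<Rightarrow> real" where
  "ric x = (\<Sum>i\<in>Basis. (N (br x i) x - N x (N i x) + N i (N x x)) \<bullet> i)"

text \<open>For a nilpotent bracket this is \<open>(2 - n) T\<close>, with \<open>n\<close> the
  dimension. It stays unevaluated because \<open>T \<bullet> tr_vec\<close> enters both Ricci
  estimates and is their common threshold.\<close>

definition tr_vec :: 'e where "tr_vec = (\<Sum>i\<in>Basis. N i i)"

lemma inner_sum_Basis: "(\<Sum>i\<in>Basis. (u \<bullet> i) * (v \<bullet> i)) = u \<bullet> v" for u v :: 'e
  by (rule euclidean_inner[symmetric])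

lemma trace_N: "(\<Sum>i\<in>Basis. N i v \<bullet> i) = 2 * (T \<bullet> v) - v \<bullet> tr_vec"
proof -
  have "N i v \<bullet> i = 2 * ((T \<bullet> i) * (v \<bullet> i)) - v \<bullet> N i i" for i
    using compat[of i v i] by simp
  then have "(\<Sum>i\<in>Basis. N i v \<bullet> i) = 2 * (\<Sum>i\<in>Basis. (T \<bullet> i) * (v \<bullet> i)) - (\<Sum>i\<in>Basis. v \<bullet> N i i)"
    by (simp add: sum_subtractf sum_distrib_left)
  then show ?thesis by (simp add: inner_sum_Basis tr_vec_def inner_sum_right)
qed

text \<open>The hypothesis covers both test vectors: it holds when \<open>x\<close> is orthogonal to
  all brackets and when \<open>x\<close> is central.\<close>

lemma N_self:
  assumes "\<And>w. br w x \<bullet> x = 0"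
  shows "N x x = 2 *\<^sub>R (T \<bullet> x) *\<^sub>R x - (x \<bullet> x) *\<^sub>R T"
proof (rule euclidean_eqI)
  fix z :: 'e
  show "N x x \<bullet> z = (2 *\<^sub>R (T \<bullet> x) *\<^sub>R x - (x \<bullet> x) *\<^sub>R T) \<bullet> z"
  proof -
    have "2 * (N x x \<bullet> z) = 4 * ((T \<bullet> x) * (x \<bullet> z)) - 2 * ((T \<bullet> z) * (x \<bullet> x))"
      using koszul[of x x z] assms[of z] br_skew[of x z] by (simp add: br_self)
    moreover have "(2 *\<^sub>R (T \<bullet> x) *\<^sub>R x - (x \<bullet> x) *\<^sub>R T) \<bullet> z = 2 * ((T \<bullet> x) * (x \<bullet> z)) - (T \<bullet> z) * (x \<bullet> x)"
      by (simp add: inner_diff_left)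
    ultimately show ?thesis by linarith
  qed
qed

text \<open>\<open>compat\<close> moves the outer \<open>N x\<close> to the other factor, and
  \<open>N_self\<close> evaluates \<open>N x x\<close>. Both produce
  \<open>2 (T \<bullet> x) (N i x \<bullet> i)\<close>, with opposite signs in \<open>ric\<close>;
  the trace of \<open>N i T\<close> supplies the final parenthesis.\<close>

lemma ric_eq:
  assumes "\<And>w. br w x \<bullet> x = 0" "x \<bullet> x = 1"
  shows "ric x = (\<Sum>i\<in>Basis. N (br x i) x \<bullet> i) + (\<Sum>i\<in>Basis. N i x \<bullet> (N i x + br x i))
    + (T \<bullet> tr_vec - 2 * (T \<bullet> T))"
proof -
  let ?t = "T \<bullet> x"
  have 2: "N x (N i x) \<bullet> i = 2 * ?t * (N i x \<bullet> i) - N i x \<bullet> (N i x + br x i)" for i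
  proof -
    have "N x i = N i x + br x i" using torsion[of x i] by (simp add: algebra_simps)
    then show ?thesis using compat[of x "N i x" i] by simp
  qed
  have 3: "N i (N x x) \<bullet> i = 2 * ?t * (N i x \<bullet> i) - N i T \<bullet> i" for i
    unfolding N_self[OF assms(1)]
    by (simp add: assms(2) linear_diff[OF N_lin(2)] linear_scale[OF N_lin(2)] inner_diff_left)
  have "ric x = (\<Sum>i\<in>Basis. N (br x i) x \<bullet> i + N i x \<bullet> (N i x + br x i) - N i T \<bullet> i)"
    unfolding ric_def
    by (intro sum.cong refl) (simp add: inner_add_left inner_diff_left 2 3)
  then show ?thesis
    by (simp add: sum.distrib sum_subtractf trace_N)
qed

lemma norm_double_sum: "(\<Sum>i\<in>Basis. f i \<bullet> f i) = (\<Sum>i\<in>Basis. \<Sum>j\<in>Basis. (f i \<bullet> j)\<^sup>2)" for f :: "'e \<Rightarrow> 'e"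
  by (intro sum.cong refl) (unfold power2_eq_square, rule euclidean_inner)

text \<open>Lagrange's identity for the wedge of \<open>T\<close> with the unit vector
  \<open>x\<close>; the sum runs over ordered pairs, hence the factor \<open>2\<close>.\<close>

lemma wedge_norm:
  fixes x :: 'e
  assumes "x \<bullet> x = 1"
  shows "(\<Sum>i\<in>Basis. \<Sum>j\<in>Basis. ((T \<bullet> i) * (x \<bullet> j) - (T \<bullet> j) * (x \<bullet> i))\<^sup>2) = 2 * (T \<bullet> T) - 2 * (T \<bullet> x)\<^sup>2"
proof -
  have "((T \<bullet> i) * (x \<bullet> j) - (T \<bullet> j) * (x \<bullet> i))\<^sup>2 =
    ((T \<bullet> i) * (T \<bullet> i)) * ((x \<bullet> j) * (x \<bullet> j)) + ((x \<bullet> i) * (x \<bullet> i)) * ((T \<bullet> j) * (T \<bullet> j))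
    - 2 * (((T \<bullet> i) * (x \<bullet> i)) * ((T \<bullet> j) * (x \<bullet> j)))" for i j
    by (simp add: power2_eq_square algebra_simps)
  then have "(\<Sum>i\<in>Basis. \<Sum>j\<in>Basis. ((T \<bullet> i) * (x \<bullet> j) - (T \<bullet> j) * (x \<bullet> i))\<^sup>2) =
    (T \<bullet> T) * (x \<bullet> x) + (x \<bullet> x) * (T \<bullet> T) - 2 * ((T \<bullet> x) * (T \<bullet> x))"
    by (simp add: sum.distrib sum_subtractf sum_distrib_left[symmetric] sum_distrib_right[symmetric] inner_sum_Basis)
  then show ?thesis by (simp add: assms power2_eq_square)
qed

lemma sum_sym_skew:
  fixes s k :: "'e \<Rightarrow> 'e \<Rightarrow> real"
  assumes "\<And>i j. s i j = s j i" "\<And>i j. k i j = - k j i"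
  shows "(\<Sum>i\<in>Basis. \<Sum>j\<in>Basis. s i j * k i j) = 0"
proof -
  have "(\<Sum>i\<in>Basis. \<Sum>j\<in>Basis. s i j * k i j) = (\<Sum>i\<in>Basis. \<Sum>j\<in>Basis. s j i * k j i)"
    by (rule sum.swap)
  also have "\<dots> = (\<Sum>i\<in>Basis. \<Sum>j\<in>Basis. - (s i j * k i j))"
    by (intro sum.cong refl) (metis assms mult_minus_right)
  finally show ?thesis by (simp add: sum_negf)
qed

text \<open>With \<open>s\<close> the symmetrised \<open>a = ad X\<close>, the computation gives
  \<open>ric X = T \<bullet> tr_vec - |s|^2 / 4\<close>. The wedge part contributes
  \<open>2 (T \<bullet> T)\<close>, which cancels the constant in \<open>ric_eq\<close>.\<close>

lemma ric_orthogonal_le: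
  assumes X: "X \<bullet> X = 1" "T \<bullet> X = 0" "\<And>u v. br u v \<bullet> X = 0"
  shows "ric X \<le> T \<bullet> tr_vec"
proof -
  define a where "a = br X"
  have alin: "linear a" unfolding a_def by (rule br_lin(2))
  have aX: "a i \<bullet> X = 0" "X \<bullet> a i = 0" for i using X(3) by (simp_all add: a_def inner_commute)
  have aXX: "a X = 0" by (simp add: a_def br_self)
  let ?k = "\<lambda>i j. (T \<bullet> i) * (X \<bullet> j) - (T \<bullet> j) * (X \<bullet> i)"
  let ?s = "\<lambda>i j. a i \<bullet> j + a j \<bullet> i"
  \<comment> \<open>Koszul splits this into a skew part, the wedge of \<open>T\<close> and
    \<open>X\<close>, and minus half the symmetrisation of \<open>a\<close>; the two are orthogonal,
    which is \<open>sk\<close> below.\<close>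
  have A: "N i X \<bullet> w = ?k i w - ?s i w / 2" for i w
    using koszul[of i X w] X(2) X(3)[of w i] br_skew[of i X]
    by (simp add: a_def inner_commute field_simps)
  \<comment> \<open>\<open>P\<close> is the squared norm of \<open>a\<close> and \<open>Q\<close>
    the trace of \<open>a\<close> composed with itself, so \<open>2 * P + 2 * Q\<close> is the
    squared norm of \<open>?s\<close>.\<close>
  define P where "P = (\<Sum>i\<in>Basis. a i \<bullet> a i)"
  define Q where "Q = (\<Sum>i\<in>Basis. a (a i) \<bullet> i)"
  \<comment> \<open>This cross term is \<open>T \<bullet> a X\<close>, and
    \<open>a X = 0\<close>.\<close>
  have z: "(\<Sum>i\<in>Basis. (T \<bullet> a i) * (X \<bullet> i)) = 0"
  proof -
    have "(\<Sum>i\<in>Basis. (T \<bullet> a i) * (X \<bullet> i)) = T \<bullet> (\<Sum>i\<in>Basis. (X \<bullet> i) *\<^sub>R a i)"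
      by (simp add: inner_sum_right mult.commute)
    also have "(\<Sum>i\<in>Basis. (X \<bullet> i) *\<^sub>R a i) = a (\<Sum>i\<in>Basis. (X \<bullet> i) *\<^sub>R i)"
      by (simp add: linear_sum[OF alin] linear_scale[OF alin])
    finally show ?thesis by (simp add: euclidean_representation aXX)
  qed
  have "N (a i) X \<bullet> i = (T \<bullet> a i) * (X \<bullet> i) - (a (a i) \<bullet> i) / 2 - (a i \<bullet> a i) / 2" for i
    using A[of "a i" i] aX[of i] by (simp add: field_simps)
  then have F: "(\<Sum>i\<in>Basis. N (br X i) X \<bullet> i) = - Q / 2 - P / 2"
    by (simp add: a_def[symmetric] sum_subtractf z P_def Q_def sum_divide_distrib)
  have "N i X \<bullet> a i = - ((T \<bullet> a i) * (X \<bullet> i)) - (a i \<bullet> a i) / 2 - (a (a i) \<bullet> i) / 2" for i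
    using A[of i "a i"] aX[of i] by (simp add: field_simps)
  then have S: "(\<Sum>i\<in>Basis. N i X \<bullet> br X i) = - P / 2 - Q / 2"
    by (simp add: a_def[symmetric] sum_subtractf sum_negf z P_def Q_def sum_divide_distrib)
  have k2: "(\<Sum>i\<in>Basis. \<Sum>j\<in>Basis. (?k i j)\<^sup>2) = 2 * (T \<bullet> T)"
    using wedge_norm[OF X(1)] X(2) by simp
  have sk: "(\<Sum>i\<in>Basis. \<Sum>j\<in>Basis. ?s i j * ?k i j) = 0"
    by (rule sum_sym_skew) simp_all
  have aaQ: "Q = (\<Sum>i\<in>Basis. \<Sum>j\<in>Basis. (a i \<bullet> j) * (a j \<bullet> i))"
    unfolding Q_def
  proof (rule sum.cong[OF refl])
    fix i :: 'e
    have "a (a i) = a (\<Sum>j\<in>Basis. (a i \<bullet> j) *\<^sub>R j)" by (simp add: euclidean_representation)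
    also have "\<dots> = (\<Sum>j\<in>Basis. (a i \<bullet> j) *\<^sub>R a j)"
      by (simp add: linear_sum[OF alin] linear_scale[OF alin])
    finally show "a (a i) \<bullet> i = (\<Sum>j\<in>Basis. (a i \<bullet> j) * (a j \<bullet> i))"
      by (simp add: inner_sum_left)
  qed
  have P2: "P = (\<Sum>i\<in>Basis. \<Sum>j\<in>Basis. (a i \<bullet> j)\<^sup>2)" unfolding P_def by (rule norm_double_sum)
  also have "\<dots> = (\<Sum>i\<in>Basis. \<Sum>j\<in>Basis. (a j \<bullet> i)\<^sup>2)" by (rule sum.swap)
  finally have P3: "P = (\<Sum>i\<in>Basis. \<Sum>j\<in>Basis. (a j \<bullet> i)\<^sup>2)" .
  have s2: "(\<Sum>i\<in>Basis. \<Sum>j\<in>Basis. (?s i j)\<^sup>2) = 2 * P + 2 * Q"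
  proof -
    have "(\<Sum>i\<in>Basis. \<Sum>j\<in>Basis. (?s i j)\<^sup>2) =
      (\<Sum>i\<in>Basis. \<Sum>j\<in>Basis. (a i \<bullet> j)\<^sup>2) + (\<Sum>i\<in>Basis. \<Sum>j\<in>Basis. (a j \<bullet> i)\<^sup>2)
      + 2 * (\<Sum>i\<in>Basis. \<Sum>j\<in>Basis. (a i \<bullet> j) * (a j \<bullet> i))"
      by (simp add: power2_sum sum.distrib sum_distrib_left mult.assoc)
    then show ?thesis using P2 P3 aaQ by simp
  qed
  have "(\<Sum>i\<in>Basis. N i X \<bullet> N i X) = (\<Sum>i\<in>Basis. \<Sum>j\<in>Basis. (?k i j)\<^sup>2 + (?s i j)\<^sup>2 / 4 - ?s i j * ?k i j)"
    unfolding norm_double_sum[of "\<lambda>i. N i X"] unfolding A by (simp add: power2_eq_square field_simps)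
  also have "\<dots> = 2 * (T \<bullet> T) + (2 * P + 2 * Q) / 4"
    unfolding s2[symmetric] k2[symmetric]
    by (simp add: sum.distrib sum_subtractf sk sum_divide_distrib[symmetric])
  finally have N2: "(\<Sum>i\<in>Basis. N i X \<bullet> N i X) = 2 * (T \<bullet> T) + (P + Q) / 2" by simp
  have "0 \<le> (\<Sum>i\<in>Basis. \<Sum>j\<in>Basis. (?s i j)\<^sup>2)" by (intro sum_nonneg) simp
  then have "0 \<le> P + Q" unfolding s2 by simp
  moreover have "ric X = (- Q / 2 - P / 2) + ((2 * (T \<bullet> T) + (P + Q) / 2) + (- P / 2 - Q / 2)) + (T \<bullet> tr_vec - 2 * (T \<bullet> T))"
    unfolding ric_eq[OF X(3) X(1)] F inner_add_right sum.distrib S N2 ..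
  ultimately show ?thesis by (simp add: field_simps)
qed

text \<open>For central \<open>Z\<close> the bracket part \<open>J\<close> of
  \<open>N i Z \<bullet> j\<close> is skew and enters with a plus sign: \<open>ric Z = T \<bullet>
  tr_vec + |J|^2 + (n - 2) (T \<bullet> Z)^2\<close> with \<open>n\<close> the dimension.
  \<open>J\<close> is nonzero because \<open>Z\<close> is not orthogonal to all brackets.\<close>

lemma ric_central_gt:
  assumes Z: "Z \<bullet> Z = 1" "\<And>v. br Z v = 0" and nz: "br u v \<bullet> Z \<noteq> 0" and dim: "2 \<le> DIM('e)"
  shows "T \<bullet> tr_vec < ric Z"
proof -
  have Z': "br v Z = 0" for v using br_skew[of v Z] Z(2) by simp
  let ?k = "\<lambda>i j. (T \<bullet> i) * (Z \<bullet> j) - (T \<bullet> j) * (Z \<bullet> i)"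
  let ?t = "T \<bullet> Z"
  define J where "J i j = (br j i \<bullet> Z) / 2" for i j
  have A: "N i Z \<bullet> j = J i j + ?k i j + ?t * (i \<bullet> j)" for i j
    using koszul[of i Z j] Z(2)[of j] Z'[of i] by (simp add: J_def inner_commute)
  have Jskew: "J i j = - J j i" for i j using br_skew[of i j] by (simp add: J_def)
  \<comment> \<open>Both forms are skew, so symmetry alone does not make them orthogonal; centrality
    does, since \<open>J i Z = 0\<close> contracts \<open>J\<close> with the wedge of
    \<open>T\<close> and \<open>Z\<close> to zero.\<close>
  have Jk: "(\<Sum>i\<in>Basis. \<Sum>j\<in>Basis. J i j * ?k i j) = 0"
  proof -
    have Jlin: "linear (J i)" "linear (\<lambda>i. J i j)" for i j
      unfolding J_def using linear_add[OF br_lin(1)] linear_add[OF br_lin(2)] linear_scale[OF br_lin(1)] linear_scale[OF br_lin(2)]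
      by (auto intro!: linearI simp: inner_add_left add_divide_distrib)
    have JZ: "(\<Sum>j\<in>Basis. J i j * (Z \<bullet> j)) = 0" for i
    proof -
      have "(\<Sum>j\<in>Basis. J i j * (Z \<bullet> j)) = J i (\<Sum>j\<in>Basis. (Z \<bullet> j) *\<^sub>R j)"
        by (simp add: linear_sum[OF Jlin(1)] linear_scale[OF Jlin(1)] mult.commute)
      then show ?thesis by (simp add: euclidean_representation J_def Z)
    qed
    have "(\<Sum>i\<in>Basis. \<Sum>j\<in>Basis. J i j * ((T \<bullet> i) * (Z \<bullet> j))) = (\<Sum>i\<in>Basis. (T \<bullet> i) * (\<Sum>j\<in>Basis. J i j * (Z \<bullet> j)))"
      by (simp add: sum_distrib_left algebra_simps)
    then have 1: "(\<Sum>i\<in>Basis. \<Sum>j\<in>Basis. J i j * ((T \<bullet> i) * (Z \<bullet> j))) = 0" by (simp add: JZ)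
    have "(\<Sum>i\<in>Basis. \<Sum>j\<in>Basis. J i j * ((T \<bullet> j) * (Z \<bullet> i))) = (\<Sum>i\<in>Basis. \<Sum>j\<in>Basis. J j i * ((T \<bullet> i) * (Z \<bullet> j)))"
      by (rule sum.swap)
    also have "\<dots> = - (\<Sum>i\<in>Basis. \<Sum>j\<in>Basis. J i j * ((T \<bullet> i) * (Z \<bullet> j)))"
      unfolding sum_negf[symmetric] by (intro sum.cong refl) (metis Jskew mult_minus_left)
    finally have 2: "(\<Sum>i\<in>Basis. \<Sum>j\<in>Basis. J i j * ((T \<bullet> j) * (Z \<bullet> i))) = 0" using 1 by simp
    show ?thesis using 1 2 by (simp add: right_diff_distrib sum_subtractf)
  qed
  have Jt: "(\<Sum>i\<in>Basis. \<Sum>j\<in>Basis. (?t * (i \<bullet> j)) * J i j) = 0"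
    by (rule sum_sym_skew) (simp_all add: inner_commute Jskew[symmetric])
  have kt: "(\<Sum>i\<in>Basis. \<Sum>j\<in>Basis. (?t * (i \<bullet> j)) * ?k i j) = 0"
    by (rule sum_sym_skew) (simp_all add: inner_commute)
  have tt: "(\<Sum>i\<in>(Basis::'e set). \<Sum>j\<in>Basis. (?t * (i \<bullet> j))\<^sup>2) = real DIM('e) * ?t\<^sup>2"
  proof -
    have "(\<Sum>j\<in>Basis. (?t * (i \<bullet> j))\<^sup>2) = ?t\<^sup>2" if "i \<in> Basis" for i :: 'e
    proof -
      have "(\<Sum>j\<in>Basis. (?t * (i \<bullet> j))\<^sup>2) = ?t\<^sup>2 * (\<Sum>j\<in>Basis. (i \<bullet> j) * (i \<bullet> j))"
        by (simp add: sum_distrib_left power2_eq_square ac_simps)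
      then show ?thesis using that by (simp add: inner_sum_Basis inner_same_Basis)
    qed
    then show ?thesis by simp
  qed
  have "(\<Sum>i\<in>Basis. N i Z \<bullet> N i Z) = (\<Sum>i\<in>Basis. \<Sum>j\<in>Basis. (J i j)\<^sup>2 + (?k i j)\<^sup>2 + (?t * (i \<bullet> j))\<^sup>2
      + 2 * (J i j * ?k i j) + 2 * ((?t * (i \<bullet> j)) * J i j) + 2 * ((?t * (i \<bullet> j)) * ?k i j))"
    unfolding norm_double_sum[of "\<lambda>i. N i Z"] unfolding A by (intro sum.cong refl) (simp add: power2_eq_square algebra_simps)
  also have "\<dots> = (\<Sum>i\<in>Basis. \<Sum>j\<in>Basis. (J i j)\<^sup>2) + (2 * (T \<bullet> T) - 2 * ?t\<^sup>2) + real DIM('e) * ?t\<^sup>2"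
    using Jk Jt kt tt wedge_norm[OF Z(1)] by (simp only: sum.distrib sum_distrib_left[symmetric])
  finally have N2: "(\<Sum>i\<in>Basis. N i Z \<bullet> N i Z) =
    (\<Sum>i\<in>Basis. \<Sum>j\<in>Basis. (J i j)\<^sup>2) + 2 * (T \<bullet> T) + (real DIM('e) - 2) * ?t\<^sup>2"
    by (simp add: algebra_simps)
  have "0 < (\<Sum>i\<in>Basis. \<Sum>j\<in>Basis. (J i j)\<^sup>2)"
  proof (rule ccontr)
    assume "\<not> ?thesis"
    moreover have nn: "0 \<le> (\<Sum>i\<in>Basis. \<Sum>j\<in>Basis. (J i j)\<^sup>2)" by (intro sum_nonneg) simp
    ultimately have 0: "(\<Sum>i\<in>Basis. \<Sum>j\<in>Basis. (J i j)\<^sup>2) = 0" by linarith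
    have "(\<Sum>j\<in>Basis. (J i j)\<^sup>2) = 0" if "i \<in> Basis" for i
      using 0 that sum_nonneg_eq_0_iff[of Basis "\<lambda>i. \<Sum>j\<in>Basis. (J i j)\<^sup>2"] by (simp add: sum_nonneg)
    then have Jij: "J i j = 0" if "i \<in> Basis" "j \<in> Basis" for i j
      using that sum_nonneg_eq_0_iff[of Basis "\<lambda>j. (J i j)\<^sup>2"] by simp
    have bb: "br j i \<bullet> Z = 0" if "i \<in> Basis" "j \<in> Basis" for i j using Jij[OF that] by (simp add: J_def)
    have "br j v \<bullet> Z = 0" if "j \<in> Basis" for j v
    proof -
      have "br j v = br j (\<Sum>i\<in>Basis. (v \<bullet> i) *\<^sub>R i)" by (simp add: euclidean_representation)
      also have "\<dots> = (\<Sum>i\<in>Basis. (v \<bullet> i) *\<^sub>R br j i)"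
        by (simp add: linear_sum[OF br_lin(2)] linear_scale[OF br_lin(2)])
      finally show ?thesis using bb that by (simp add: inner_sum_left)
    qed
    moreover have "br u v = br (\<Sum>i\<in>Basis. (u \<bullet> i) *\<^sub>R i) v" by (simp add: euclidean_representation)
    then have "br u v = (\<Sum>i\<in>Basis. (u \<bullet> i) *\<^sub>R br i v)"
      by (simp add: linear_sum[OF br_lin(1)] linear_scale[OF br_lin(1)])
    ultimately show False using nz by (simp add: inner_sum_left)
  qed
  moreover have "0 \<le> (real DIM('e) - 2) * ?t\<^sup>2" using dim by simp
  moreover have "br w Z \<bullet> Z = 0" for w using Z' by simp
  from ric_eq[OF this Z(1)] have "ric Z = (\<Sum>i\<in>Basis. N i Z \<bullet> N i Z) + (T \<bullet> tr_vec - 2 * (T \<bullet> T))"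
    by (simp add: Z(2) linear_0[OF N_lin(1)])
  ultimately show ?thesis unfolding N2 by linarith
qed

lemma orthogonal_pair_dim:
  fixes x z :: 'e
  assumes "x \<noteq> 0" "z \<noteq> 0" "x \<bullet> z = 0"
  shows "2 \<le> DIM('e)"
proof -
  have "independent {x, z}"
    by (rule pairwise_orthogonal_independent) (use assms in \<open>auto simp: pairwise_def orthogonal_def inner_commute\<close>)
  moreover have "x \<noteq> z" using assms by auto
  ultimately show ?thesis using independent_bound[of "{x, z}"] by simp
qed

theorem nilpotent_not_einstein:
  assumes nil: "lcs n \<subseteq> {0}" and nab: "br a b \<noteq> 0"
    and ein: "\<And>x. ric x = k * (x \<bullet> x)"
  shows False
proof -
  obtain z where z: "z \<noteq> 0" "\<And>x. br z x = 0" "z \<in> lcs (Suc 0)"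
    using central_element_exists[OF nil nab] by metis
  obtain x where x: "x \<noteq> 0" "\<And>v. v \<in> lcs (Suc 0) \<Longrightarrow> v \<bullet> x = 0" "T \<bullet> x = 0"
    using orthogonal_element_exists[OF nil nab] by metis
  have bx: "br u v \<bullet> x = 0" for u v by (rule x(2)[OF br_in_lcs]) simp
  \<comment> \<open>\<open>z\<close> lies in the span of the brackets, so orthogonality to all of
    them would make it orthogonal to itself.\<close>
  obtain u v where uv: "br u v \<bullet> z \<noteq> 0"
  proof -
    have "\<exists>u v. br u v \<bullet> z \<noteq> 0"
    proof (rule ccontr)
      assume "\<not> ?thesis"
      then have "orthogonal z y" if "y \<in> {br x v | x v. v \<in> lcs 0}" for y
        using that by (auto simp: orthogonal_def inner_commute)
      then have "orthogonal z z" by (rule orthogonal_to_span[OF z(3)[unfolded lcs.simps(2)]])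
      then show False using z(1) by (simp add: orthogonal_def)
    qed
    then show ?thesis using that by blast
  qed
  \<comment> \<open>\<open>z\<close> lies in \<open>[g, g]\<close> and \<open>x\<close> is
    orthogonal to it, which excludes dimension one.\<close>
  have "2 \<le> DIM('e)"
    by (rule orthogonal_pair_dim[OF x(1) z(1)]) (use x(2)[OF z(3)] in \<open>simp add: inner_commute\<close>)
  define X where "X = (1 / norm x) *\<^sub>R x"
  define Z where "Z = (1 / norm z) *\<^sub>R z"
  have "X \<bullet> X = 1" "Z \<bullet> Z = 1"
    using x(1) z(1) by (simp_all add: X_def Z_def dot_square_norm power2_eq_square)
  then have "ric X = k" "ric Z = k" by (simp_all add: ein)
  moreover have "ric X \<le> T \<bullet> tr_vec"
    by (rule ric_orthogonal_le[OF \<open>X \<bullet> X = 1\<close>]) (simp_all add: X_def x bx)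
  moreover have "T \<bullet> tr_vec < ric Z"
  proof (rule ric_central_gt[OF \<open>Z \<bullet> Z = 1\<close> _ _ \<open>2 \<le> DIM('e)\<close>])
    show "br Z v = 0" for v by (simp add: Z_def linear_scale[OF br_lin(1)] z)
    show "br u v \<bullet> Z \<noteq> 0" using uv z by (simp add: Z_def)
  qed
  ultimately show False by linarith
qed

end

section \<open>Tensoriality of the curvature\<close>

locale torsion_free_connection = atlas A
  for A :: "('m::t2_space, 'e::euclidean_space) chart set" +
  fixes nab :: "('m, 'e) connection"
  assumes connection: "linear_connection A nab" and torsion_free: "torsion_free A nab"
begin

abbreviation sm :: "('m, 'e) vfield \<Rightarrow> bool" where "sm \<equiv> smooth_vfield A"

lemma nab_smooth: "sm X \<Longrightarrow> sm Y \<Longrightarrow> sm (nab X Y)"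
  using connection by (simp add: linear_connection_def)

lemma nab_add:
  assumes "sm X" "sm Y" "sm Z"
  shows "nab (vf_add X Y) Z = vf_add (nab X Z) (nab Y Z)"
    and "nab X (vf_add Y Z) = vf_add (nab X Y) (nab X Z)"
  using connection assms by (simp_all add: linear_connection_def)

lemma nab_scale:
  assumes "smooth_fun A f" "sm X" "sm Y"
  shows "nab (vf_scale f X) Y = vf_scale f (nab X Y)"
    and "nab X (vf_scale f Y) = vf_add (vf_scale (vf_apply A X f) Y) (vf_scale f (nab X Y))"
  using connection assms by (simp_all add: linear_connection_def)

text \<open>Torsion-freeness lets the bracket be handled through the axioms of the connection, so
  its smoothness, additivity and Leibniz rule need no coordinates.\<close>

lemma lie_bracket_nab: "sm X \<Longrightarrow> sm Y \<Longrightarrow> lie_bracket A X Y = vf_diff (nab X Y) (nab Y X)"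
  using torsion_free by (simp add: torsion_free_def)

lemma lie_bracket_smooth: "sm X \<Longrightarrow> sm Y \<Longrightarrow> sm (lie_bracket A X Y)"
  by (simp add: lie_bracket_nab smooth_vf_diff nab_smooth)

lemma lie_bracket_add: "sm X \<Longrightarrow> sm Y \<Longrightarrow> sm Z \<Longrightarrow>
  lie_bracket A (vf_add X Y) Z = vf_add (lie_bracket A X Z) (lie_bracket A Y Z)"
  by (simp add: lie_bracket_nab smooth_vf_add nab_add) (simp add: vf_add_def vf_diff_def fun_eq_iff)

lemma lie_bracket_scale: "smooth_fun A f \<Longrightarrow> sm X \<Longrightarrow> sm Y \<Longrightarrow>
  lie_bracket A (vf_scale f X) Y =
    vf_add (vf_scale f (lie_bracket A X Y)) (vf_scale (\<lambda>p. - vf_apply A Y f p) X)"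
  by (simp add: lie_bracket_nab smooth_vf_scale nab_scale)
    (simp add: vf_add_def vf_diff_def vf_scale_def fun_eq_iff scaleR_diff_right)

lemma lie_bracket_skew: "sm X \<Longrightarrow> sm Y \<Longrightarrow> lie_bracket A Y X = vf_scale (\<lambda>p. - 1) (lie_bracket A X Y)"
  by (simp add: lie_bracket_nab) (simp add: vf_diff_def vf_scale_def fun_eq_iff)

lemma curvature_add1:
  assumes "sm X" "sm X'" "sm Y" "sm Z"
  shows "curvature A nab (vf_add X X') Y Z p c = curvature A nab X Y Z p c + curvature A nab X' Y Z p c"
  using assms unfolding curvature_def
  by (simp add: lie_bracket_add nab_add lie_bracket_smooth nab_smooth) (simp add: vf_add_def vf_diff_def)

text \<open>The derivative of \<open>f\<close> along \<open>Y\<close> appears twice, from the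
  bracket and from \<open>nab Y\<close> applied to a scaled field, with opposite signs.\<close>

lemma curvature_scale1:
  assumes "smooth_fun A f" "sm X" "sm Y" "sm Z"
  shows "curvature A nab (vf_scale f X) Y Z p c = f p *\<^sub>R curvature A nab X Y Z p c"
proof -
  note s = lie_bracket_smooth nab_smooth smooth_vf_scale smooth_fun_uminus vf_apply_smooth
  have "curvature A nab (vf_scale f X) Y Z =
    vf_add (vf_diff (vf_add (vf_scale f (nab (lie_bracket A X Y) Z)) (vf_scale (\<lambda>p. - vf_apply A Y f p) (nab X Z)))
     (vf_scale f (nab X (nab Y Z)))) (vf_add (vf_scale (vf_apply A Y f) (nab X Z)) (vf_scale f (nab Y (nab X Z))))"
    using assms unfolding curvature_def
    by (simp add: lie_bracket_scale nab_add(1) nab_scale s)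
  then show ?thesis
    by (simp add: curvature_def) (simp add: vf_add_def vf_diff_def vf_scale_def algebra_simps)
qed

lemma curvature_skew:
  assumes "sm X" "sm Y" "sm Z"
  shows "curvature A nab X Y Z p c = - curvature A nab Y X Z p c"
proof -
  have "nab (lie_bracket A Y X) Z = vf_scale (\<lambda>p. - 1) (nab (lie_bracket A X Y) Z)"
    using assms lie_bracket_smooth[of X Y]
    by (simp add: lie_bracket_skew[of X Y] nab_scale(1) smooth_fun_const)
  then show ?thesis
    by (simp add: curvature_def) (simp add: vf_add_def vf_diff_def vf_scale_def)
qed

lemma curvature_add2:
  assumes "sm X" "sm Y" "sm Y'" "sm Z"
  shows "curvature A nab X (vf_add Y Y') Z p c = curvature A nab X Y Z p c + curvature A nab X Y' Z p c"
  using assms curvature_add1[of Y Y' X Z p c] curvature_skew[of X _ Z p c] by (simp add: smooth_vf_add)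

lemma curvature_scale2:
  assumes "smooth_fun A f" "sm X" "sm Y" "sm Z"
  shows "curvature A nab X (vf_scale f Y) Z p c = f p *\<^sub>R curvature A nab X Y Z p c"
  using assms curvature_scale1[of f Y X Z p c] curvature_skew[of X _ Z p c] by (simp add: smooth_vf_scale)

lemma curvature_add3:
  assumes "sm X" "sm Y" "sm Z" "sm Z'"
  shows "curvature A nab X Y (vf_add Z Z') p c = curvature A nab X Y Z p c + curvature A nab X Y Z' p c"
  using assms unfolding curvature_def
  by (simp add: nab_add lie_bracket_smooth nab_smooth) (simp add: vf_add_def vf_diff_def)

text \<open>First derivatives of \<open>f\<close> cancel in pairs; second derivatives cancel because
  the bracket acts on functions as the commutator, by \<open>lie_bracket_apply\<close>.\<close>

lemma curvature_scale3:
  assumes f: "smooth_fun A f" and X: "sm X" and Y: "sm Y" and Z: "sm Z"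
  shows "curvature A nab X Y (vf_scale f Z) p c = f p *\<^sub>R curvature A nab X Y Z p c"
proof -
  note s = lie_bracket_smooth nab_smooth smooth_vf_scale smooth_vf_add vf_apply_smooth
  have 2: "nab X (nab Y (vf_scale f Z)) =
    vf_add (vf_add (vf_scale (vf_apply A X (vf_apply A Y f)) Z) (vf_scale (vf_apply A Y f) (nab X Z)))
      (vf_add (vf_scale (vf_apply A X f) (nab Y Z)) (vf_scale f (nab X (nab Y Z))))"
    if "sm X" "sm Y" for X Y
    using f Z that by (simp add: nab_scale nab_add(2) s)
  have nb: "nab (lie_bracket A X Y) (vf_scale f Z) =
    vf_add (vf_scale (vf_apply A (lie_bracket A X Y) f) Z) (vf_scale f (nab (lie_bracket A X Y) Z))"
    using assms by (simp add: nab_scale s)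
  have br: "vf_apply A (lie_bracket A X Y) f p = vf_apply A X (vf_apply A Y f) p - vf_apply A Y (vf_apply A X f) p"
    by (rule lie_bracket_apply[OF f X Y lie_bracket_smooth[OF X Y]])
  show ?thesis
    unfolding curvature_def 2[OF X Y] 2[OF Y X] nb
    by (simp add: vf_add_def vf_diff_def vf_scale_def br algebra_simps)
qed

end

text \<open>Additivity and scaling by the value at \<open>p\<close> evaluate \<open>L\<close> on
  combinations with function coefficients. Smoothness of the partial sums is part of the induction
  because both rules for \<open>L\<close> ask for smooth fields.\<close>

lemma (in atlas) tensorial_sum:
  fixes L :: "('m, 'e) vfield \<Rightarrow> 'b::real_vector"
  assumes add: "\<And>X Y. smooth_vfield A X \<Longrightarrow> smooth_vfield A Y \<Longrightarrow> L (vf_add X Y) = L X + L Y"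
    and scale: "\<And>f X. smooth_fun A f \<Longrightarrow> smooth_vfield A X \<Longrightarrow> L (vf_scale f X) = f p *\<^sub>R L X"
    and S: "finite S" "\<And>b. b \<in> S \<Longrightarrow> smooth_fun A (f b)" "\<And>b. b \<in> S \<Longrightarrow> smooth_vfield A (E b)"
  shows "smooth_vfield A (\<lambda>q c. \<Sum>b\<in>S. f b q *\<^sub>R E b q c) \<and>
    L (\<lambda>q c. \<Sum>b\<in>S. f b q *\<^sub>R E b q c) = (\<Sum>b\<in>S. f b p *\<^sub>R L (E b))"
  using S
proof (induction S rule: finite_induct)
  case empty
  have "L (\<lambda>q c. 0) = L (vf_scale (\<lambda>q. 0) (\<lambda>q c. 0))" by (simp add: vf_scale_def)
  also have "\<dots> = 0" using scale[OF smooth_fun_const smooth_vf_zero, of 0] by simp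
  finally show ?case by (simp add: smooth_vf_zero)
next
  case (insert b S)
  have "(\<lambda>q c. \<Sum>b\<in>insert b S. f b q *\<^sub>R E b q c) =
    vf_add (vf_scale (f b) (E b)) (\<lambda>q c. \<Sum>b\<in>S. f b q *\<^sub>R E b q c)"
    using insert.hyps by (simp add: vf_add_def vf_scale_def)
  then show ?case
    using insert by (simp add: add scale smooth_vf_add smooth_vf_scale)
qed

section \<open>Orthonormalisation of an abstract inner product\<close>

locale inner_form =
  fixes B :: "'e::euclidean_space \<Rightarrow> 'e \<Rightarrow> real"
  assumes B_lin: "linear (\<lambda>x. B x y)" and B_sym: "B x y = B y x" and B_pos: "x \<noteq> 0 \<Longrightarrow> B x x > 0"
begin

lemma B_lin2: "linear (\<lambda>y. B x y)"
  using B_lin[of x] B_sym by simp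

text \<open>Gram-Schmidt for \<open>B\<close>: fewer than \<open>DIM('e)\<close> vectors leave some
  vector outside their span, whose remainder after \<open>B\<close>-projection is nonzero and can be
  normalised.\<close>

lemma orthonormal_set_exists:
  "k \<le> DIM('e) \<Longrightarrow> \<exists>E. finite E \<and> card E = k \<and> (\<forall>u\<in>E. \<forall>v\<in>E. B u v = (if u = v then 1 else 0))"
proof (induction k)
  case 0
  then show ?case by (intro exI[of _ "{}"]) simp
next
  case (Suc k)
  then obtain E where E: "finite E" "card E = k" "\<And>u v. u \<in> E \<Longrightarrow> v \<in> E \<Longrightarrow> B u v = (if u = v then 1 else 0)"
    by auto
  have "dim E < DIM('e)" using dim_le_card'[OF E(1)] E(2) Suc.prems by linarith
  then have "span E \<noteq> UNIV" using dim_eq_full[of E] by auto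
  then obtain x where x: "x \<notin> span E" by auto
  define y where "y = x - (\<Sum>e\<in>E. B x e *\<^sub>R e)"
  have "(\<Sum>e\<in>E. B x e *\<^sub>R e) \<in> span E" by (intro span_sum span_scale span_base)
  then have "y \<noteq> 0" using x unfolding y_def by auto
  then have y: "B y y > 0" by (rule B_pos)
  have yE: "B y v = 0" if "v \<in> E" for v
  proof -
    have "B (\<Sum>e\<in>E. B x e *\<^sub>R e) v = (\<Sum>e\<in>E. B x e * B e v)"
      by (simp add: linear_sum[OF B_lin] linear_scale[OF B_lin])
    also have "\<dots> = (\<Sum>e\<in>E. if e = v then B x e else 0)"
      by (rule sum.cong) (use E(3) that in auto)
    also have "\<dots> = B x v" using E(1) that by simp
    finally show ?thesis by (simp add: y_def linear_diff[OF B_lin])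
  qed
  define z where "z = (1 / sqrt (B y y)) *\<^sub>R y"
  have zE: "B z v = 0" "B v z = 0" if "v \<in> E" for v
    using yE[OF that] by (simp_all add: z_def linear_scale[OF B_lin] B_sym[of v])
  have zz: "B z z = 1"
    using y by (simp add: z_def linear_scale[OF B_lin] linear_scale[OF B_lin2] real_sqrt_mult_self field_simps)
  then have "z \<notin> E" using zE by fastforce
  then show ?case
    using E zE zz by (intro exI[of _ "insert z E"]) auto
qed

text \<open>\<open>P\<close> sends the standard basis to a \<open>B\<close>-orthonormal one, so that
  the later algebra can use the fixed inner product of the type \<open>'e\<close>.\<close>

lemma orthonormalisation:
  obtains P :: "'e \<Rightarrow> 'e" where "linear P" "\<And>a b. B (P a) (P b) = a \<bullet> b"
proof -
  obtain E where E: "finite E" "card E = DIM('e)" "\<And>u v. u \<in> E \<Longrightarrow> v \<in> E \<Longrightarrow> B u v = (if u = v then 1 else 0)"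
    using orthonormal_set_exists[of "DIM('e)"] by auto
  obtain h where h: "bij_betw h (Basis :: 'e set) E"
    using finite_same_card_bij[OF finite_Basis E(1)] E(2) by metis
  define P where "P a = (\<Sum>b\<in>Basis. (a \<bullet> b) *\<^sub>R h b)" for a :: 'e
  have lin: "linear P"
    by (rule linearI) (simp_all add: P_def inner_add_left scaleR_add_left sum.distrib scaleR_sum_right)
  have hB: "B (h a) (h b) = (if a = b then 1 else 0)" if "a \<in> Basis" "b \<in> Basis" for a b
    using E(3)[of "h a" "h b"] h that unfolding bij_betw_def inj_on_def by auto
  have "B (P a) (P b) = a \<bullet> b" for a b
  proof -
    have 1: "B (P a) w = (\<Sum>i\<in>Basis. (a \<bullet> i) * B (h i) w)" for w
      unfolding P_def by (simp add: linear_sum[OF B_lin] linear_scale[OF B_lin])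
    have 2: "B w (P b) = (\<Sum>j\<in>Basis. (b \<bullet> j) * B w (h j))" for w
      unfolding P_def by (simp add: linear_sum[OF B_lin2] linear_scale[OF B_lin2])
    have "B (P a) (P b) = (\<Sum>i\<in>Basis. (a \<bullet> i) * B (h i) (P b))" by (rule 1)
    also have "\<dots> = (\<Sum>i\<in>Basis. (a \<bullet> i) * (\<Sum>j\<in>Basis. (b \<bullet> j) * B (h i) (h j)))"
      unfolding 2 ..
    also have "\<dots> = (\<Sum>i\<in>Basis. (a \<bullet> i) * (b \<bullet> i))"
    proof (intro sum.cong refl arg_cong2[where f="(*)"])
      fix i :: 'e assume i: "i \<in> Basis"
      have "(\<Sum>j\<in>Basis. (b \<bullet> j) * B (h i) (h j)) = (\<Sum>j\<in>Basis. if i = j then b \<bullet> j else 0)"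
        by (rule sum.cong) (use hB i in auto)
      then show "(\<Sum>j\<in>Basis. (b \<bullet> j) * B (h i) (h j)) = b \<bullet> i" using i by simp
    qed
    also have "\<dots> = a \<bullet> b" by (rule euclidean_inner[symmetric])
    finally show ?thesis .
  qed
  with lin show ?thesis by (rule that)
qed

end

text \<open>Invariance of the trace under conjugation. It is needed because
  \<open>tangent_trace\<close> uses the coordinate basis of a chart, while \<open>ric\<close> uses
  the orthonormal frame.\<close>

lemma trace_conjugate:
  fixes P Q L :: "'e::euclidean_space \<Rightarrow> 'e"
  assumes "linear P" "linear Q" "linear L" "\<And>x. Q (P x) = x"
  shows "(\<Sum>b\<in>Basis. P (L (Q b)) \<bullet> b) = (\<Sum>b\<in>Basis. L b \<bullet> b)"
proof -
  have e: "linear F \<Longrightarrow> F v = (\<Sum>j\<in>Basis. (v \<bullet> j) *\<^sub>R F j)" for F :: "'e \<Rightarrow> 'e" and v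
    using linear_Basis_expansion by blast
  have PL: "linear (\<lambda>x. P (L x))" using linear_compose[OF assms(3,1)] by (simp add: o_def)
  have "(\<Sum>b\<in>Basis. P (L (Q b)) \<bullet> b) = (\<Sum>b\<in>Basis. \<Sum>j\<in>Basis. (Q b \<bullet> j) * (P (L j) \<bullet> b))"
    by (intro sum.cong refl) (subst e[OF PL], simp add: inner_sum_left)
  also have "\<dots> = (\<Sum>j\<in>Basis. \<Sum>b\<in>Basis. (P (L j) \<bullet> b) * (Q b \<bullet> j))"
    by (subst sum.swap) (simp add: mult.commute)
  also have "\<dots> = (\<Sum>j\<in>Basis. Q (P (L j)) \<bullet> j)"
  proof (intro sum.cong refl)
    fix j
    show "(\<Sum>b\<in>Basis. (P (L j) \<bullet> b) * (Q b \<bullet> j)) = Q (P (L j)) \<bullet> j"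
      by (subst (2) e[OF assms(2)]) (simp add: inner_sum_left)
  qed
  finally show ?thesis by (simp add: assms(4))
qed

section \<open>The Weyl algebra of a left-invariant Weyl structure\<close>

locale left_invariant_weyl_geometry = lie_grp G A + torsion_free_connection A nab
  for G :: "'g::{t2_space,second_countable_topology} monoid" (structure)
    and A :: "('g, 'e::euclidean_space) chart set" and nab +
  fixes g :: "('g, 'e) bilin_form" and \<theta> :: "('g, 'e) one_form" and P :: "'e \<Rightarrow> 'e"
  assumes metric: "left_invariant_metric G A g"
    and lee: "lee_form A nab g \<theta>" and lee_left: "left_invariant_form G A \<theta>"
    and P_linear: "linear P"
    and P_orthonormal: "g \<one> (lfield (P a) \<one>) (lfield (P b) \<one>) = a \<bullet> b"
begin

section \<open>The orthonormal left-invariant frame\<close>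

definition E :: "'e \<Rightarrow> ('g, 'e) vfield" where "E a = lfield (P a)"

lemma E_smooth: "smooth_vfield A (E a)"
  unfolding E_def by (rule lfield_smooth)

lemma E_tangent: "E a p \<in> tangent_space A p"
  by (rule smooth_vfield_tangent[OF E_smooth])

lemma E_linear: "linear (\<lambda>a. E a p c)"
  using linear_compose[OF P_linear lfield_linear[of p c]] by (simp add: E_def o_def)

lemma E_add: "E (a + b) = vf_add (E a) (E b)"
  by (intro ext) (simp add: vf_add_def linear_add[OF E_linear])

lemma E_scale: "E (r *\<^sub>R a) = vf_scale (\<lambda>p. r) (E a)"
  by (intro ext) (simp add: vf_scale_def linear_scale[OF E_linear])

lemma E_diff: "E (a - b) = vf_diff (E a) (E b)"
  by (intro ext) (simp add: vf_diff_def linear_diff[OF E_linear])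

lemma riem: "riemannian_metric A g"
  using metric by (simp add: left_invariant_metric_def)

lemma g_sym: "u \<in> tangent_space A p \<Longrightarrow> v \<in> tangent_space A p \<Longrightarrow> g p u v = g p v u"
  using riem by (simp add: riemannian_metric_def)

lemma g_lincomb:
  "u \<in> tangent_space A p \<Longrightarrow> v \<in> tangent_space A p \<Longrightarrow> w \<in> tangent_space A p \<Longrightarrow>
    g p (lincomb a u b v) w = a * g p u w + b * g p v w"
  using riem by (simp add: riemannian_metric_def)

lemma g_diff:
  assumes "u \<in> tangent_space A p" "v \<in> tangent_space A p" "w \<in> tangent_space A p"
  shows "g p (\<lambda>c. u c - v c) w = g p u w - g p v w"
  using g_lincomb[OF assms, of 1 "-1"] by (simp add: lincomb_def)

lemma g_scale:
  assumes "u \<in> tangent_space A p" "w \<in> tangent_space A p"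
  shows "g p (\<lambda>c. r *\<^sub>R u c) w = r * g p u w"
  using g_lincomb[OF assms(1,1,2), of r 0] by (simp add: lincomb_def)

lemma g_zero: "w \<in> tangent_space A p \<Longrightarrow> g p (\<lambda>c. 0) w = 0"
  using g_scale[of w p w 0] by simp

text \<open>Orthonormality at the identity spreads to every point by left-invariance of the metric
  and of the frame.\<close>

lemma g_E: "g p (E a p) (E b p) = a \<bullet> b"
proof -
  have "g (p \<otimes> \<one>) (differential A A (\<lambda>q. p \<otimes> q) \<one> (E a \<one>)) (differential A A (\<lambda>q. p \<otimes> q) \<one> (E b \<one>)) = g \<one> (E a \<one>) (E b \<one>)"
    using metric E_tangent unfolding left_invariant_metric_def by blast
  then show ?thesis by (simp add: E_def lfield_left_invariant P_orthonormal)
qed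

lemma E_surj:
  assumes u: "u \<in> tangent_space A p"
  shows "u = E (\<Sum>b\<in>Basis. g p u (E b p) *\<^sub>R b) p"
proof -
  let ?c = "chart_at A p"
  note c = chart_at_props[of p]
  have "inj (\<lambda>a. E a p ?c)"
  proof (subst linear_injective_0[OF E_linear], intro allI impI)
    fix a assume "E a p ?c = 0"
    then have "E a p = (\<lambda>c. 0)" by (intro tangent_eqI[OF E_tangent tangent_zero c])
    with g_E[of p a a] have "a \<bullet> a = g p (\<lambda>c. 0) (\<lambda>c. 0)" by metis
    then show "a = 0" using g_zero[OF tangent_zero, of p] by simp
  qed
  then have "surj (\<lambda>a. E a p ?c)" by (rule linear_inj_imp_surj[OF E_linear])
  then obtain a where "u ?c = E a p ?c" by (rule surjE)
  then have ua: "u = E a p" by (intro tangent_eqI[OF u E_tangent c])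
  show ?thesis unfolding ua g_E euclidean_representation ..
qed

lemma E_inj:
  assumes "E a p = E b p" shows "a = b"
proof -
  have "a \<bullet> x = b \<bullet> x" for x using g_E[of p a x] g_E[of p b x] assms by simp
  then show ?thesis using vector_eq_rdot by blast
qed

lemma P_inj: "inj P"
proof (rule injI)
  fix a b assume "P a = P b"
  then have "E a \<one> = E b \<one>" by (simp add: E_def)
  then show "a = b" by (rule E_inj)
qed

definition Q :: "'e \<Rightarrow> 'e" where "Q = inv_into UNIV P"

lemma Q_P: "Q (P a) = a"
  unfolding Q_def by (rule inv_f_f[OF P_inj])

lemma P_Q: "P (Q a) = a"
  unfolding Q_def using linear_inj_imp_surj[OF P_linear P_inj] by (rule surj_f_inv_f)

lemma Q_linear: "linear Q"
proof (rule linearI)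
  show "Q (a + b) = Q a + Q b" for a b
    using Q_P[of "Q a + Q b"] by (simp add: linear_add[OF P_linear] P_Q)
  show "Q (r *\<^sub>R a) = r *\<^sub>R Q a" for r a
    using Q_P[of "r *\<^sub>R Q a"] by (simp add: linear_scale[OF P_linear] P_Q)
qed

section \<open>Bracket, Lee form and connection in the frame\<close>

definition bracket :: "'e \<Rightarrow> 'e \<Rightarrow> 'e" where "bracket a b = Q (br (P a) (P b))"

lemma lie_bracket_E: "lie_bracket A (E a) (E b) = E (bracket a b)"
  by (simp add: E_def bracket_def P_Q lie_bracket_lfield)

lemma bracket_linear: "linear (\<lambda>a. bracket a b)" "linear (\<lambda>b. bracket a b)"
  unfolding bracket_def
  using linear_compose[OF P_linear linear_compose[OF br_linear(1) Q_linear]]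
    linear_compose[OF P_linear linear_compose[OF br_linear(2) Q_linear]]
  by (simp_all add: o_def)

lemma bracket_skew: "bracket a b = - bracket b a"
  unfolding bracket_def using br_antisym[of "P a" "P b"] by (simp add: linear_neg[OF Q_linear])

definition T :: 'e where "T = (\<Sum>b\<in>Basis. \<theta> \<one> (E b \<one>) *\<^sub>R b)"

lemma theta_lincomb:
  "u \<in> tangent_space A p \<Longrightarrow> v \<in> tangent_space A p \<Longrightarrow> \<theta> p (lincomb a u b v) = a * \<theta> p u + b * \<theta> p v"
  using lee by (simp add: lee_form_def smooth_one_form_def)

lemma theta_linear: "linear (\<lambda>a. \<theta> p (E a p))"
proof (rule linearI)
  fix a b r
  have "E (a + b) p = lincomb 1 (E a p) 1 (E b p)" "E (r *\<^sub>R a) p = lincomb r (E a p) 0 (E a p)"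
    by (simp_all add: E_add E_scale lincomb_def vf_add_def vf_scale_def)
  then show "\<theta> p (E (a + b) p) = \<theta> p (E a p) + \<theta> p (E b p)" "\<theta> p (E (r *\<^sub>R a) p) = r *\<^sub>R \<theta> p (E a p)"
    by (simp_all add: theta_lincomb E_tangent)
qed

lemma theta_E: "\<theta> p (E a p) = T \<bullet> a"
proof -
  have "\<theta> (p \<otimes> \<one>) (differential A A (\<lambda>q. p \<otimes> q) \<one> (E a \<one>)) = \<theta> \<one> (E a \<one>)"
    using lee_left E_tangent unfolding left_invariant_form_def by blast
  then have "\<theta> p (E a p) = \<theta> \<one> (E a \<one>)" by (simp add: E_def lfield_left_invariant)
  also have "\<dots> = (\<Sum>b\<in>Basis. (a \<bullet> b) *\<^sub>R \<theta> \<one> (E b \<one>))"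
    by (rule linear_Basis_expansion[OF theta_linear])
  also have "\<dots> = T \<bullet> a" by (simp add: T_def inner_sum_left inner_commute[of a] mult.commute)
  finally show ?thesis .
qed

text \<open>The connection coefficients in the frame, a priori depending on \<open>p\<close>:
  left-invariance is known for the metric and the Lee form, not for the connection itself.\<close>

definition nab_coeff :: "'g \<Rightarrow> 'e \<Rightarrow> 'e \<Rightarrow> 'e \<Rightarrow> real" where
  "nab_coeff p x y z = g p (nab (E x) (E y) p) (E z p)"

lemma nab_E_tangent: "nab (E x) (E y) p \<in> tangent_space A p"
  by (rule smooth_vfield_tangent[OF nab_smooth[OF E_smooth E_smooth]])

lemma nab_coeff_torsion: "nab_coeff p x y z - nab_coeff p y x z = bracket x y \<bullet> z"
proof -
  have "E (bracket x y) p = (\<lambda>c. nab (E x) (E y) p c - nab (E y) (E x) p c)"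
    unfolding lie_bracket_E[symmetric] lie_bracket_nab[OF E_smooth E_smooth] by (simp add: vf_diff_def)
  then show ?thesis
    unfolding nab_coeff_def g_E[of p, symmetric] by (simp add: g_diff[OF nab_E_tangent nab_E_tangent E_tangent])
qed

lemma nab_coeff_compat: "nab_coeff p x y z + nab_coeff p x z y = 2 * (T \<bullet> x) * (y \<bullet> z)"
proof -
  have "vf_apply A (E x) (\<lambda>q. g q (E y q) (E z q)) p
            - g p (nab (E x) (E y) p) (E z p) - g p (E y p) (nab (E x) (E z) p)
          = - 2 * \<theta> p (E x p) * g p (E y p) (E z p)"
    using lee E_smooth by (simp add: lee_form_def)
  then show ?thesis
    unfolding g_E vf_apply_const theta_E g_sym[OF E_tangent nab_E_tangent] nab_coeff_def by simp
qed

text \<open>The Koszul formula determines the coefficients by data without \<open>p\<close>, so they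
  are constant on the group. This is how the connection turns out to be left-invariant.\<close>

lemma nab_coeff_koszul: "2 * nab_coeff p x y z = bracket x y \<bullet> z - bracket y z \<bullet> x + bracket z x \<bullet> y
     + 2 * (T \<bullet> x) * (y \<bullet> z) + 2 * (T \<bullet> y) * (x \<bullet> z) - 2 * (T \<bullet> z) * (x \<bullet> y)"
  using nab_coeff_compat[of p x y z] nab_coeff_compat[of p y x z] nab_coeff_compat[of p z x y]
    nab_coeff_torsion[of p x y z] nab_coeff_torsion[of p y z x] nab_coeff_torsion[of p z x y]
  by simp

definition N :: "'e \<Rightarrow> 'e \<Rightarrow> 'e" where
  "N x y = (\<Sum>b\<in>Basis. nab_coeff \<one> x y b *\<^sub>R b)"

lemma nab_E: "nab (E x) (E y) = E (N x y)"
proof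
  fix p
  have "nab_coeff p x y b = nab_coeff \<one> x y b" for b using nab_coeff_koszul[of p x y b] nab_coeff_koszul[of \<one> x y b] by simp
  then show "nab (E x) (E y) p = E (N x y) p"
    using E_surj[OF nab_E_tangent[of x y p]] unfolding N_def nab_coeff_def[symmetric] by simp
qed

lemma N_inner: "N x y \<bullet> z = nab_coeff p x y z"
  by (simp add: nab_coeff_def nab_E g_E)

lemma N_linear: "linear (\<lambda>x. N x y)" "linear (\<lambda>y. N x y)"
proof -
  note s = E_smooth nab_add nab_scale smooth_fun_const
  have a: "vf_apply A X (\<lambda>p. r) = (\<lambda>p. 0)" for X and r :: real by (rule ext) (rule vf_apply_const)
  have z: "vf_add (vf_scale (\<lambda>p. 0) X) Y = Y" for X Y :: "('g, 'e) vfield"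
    by (simp add: vf_add_def vf_scale_def)
  have inj: "a = b" if "E a = E b" for a b using E_inj[of a \<one> b] that by simp
  have *: "E (N (x + x') y) = E (N x y + N x' y)" "E (N x (y + y')) = E (N x y + N x y')"
    "E (N (r *\<^sub>R x) y) = E (r *\<^sub>R N x y)" "E (N x (r *\<^sub>R y)) = E (r *\<^sub>R N x y)" for x x' y y' r
    unfolding nab_E[symmetric] E_add E_scale by (simp_all add: s a z)
  show "linear (\<lambda>x. N x y)" by (rule linearI; rule inj; rule *)
  show "linear (\<lambda>y. N x y)" by (rule linearI; rule inj; rule *)
qed

sublocale weyl_algebra bracket N T
proof (intro weyl_algebra.intro skew_algebra.intro weyl_algebra_axioms.intro)
  show "linear (\<lambda>x. bracket x y)" for y by (rule bracket_linear)
  show "linear (\<lambda>y. bracket x y)" for x by (rule bracket_linear)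
  show "bracket x y = - bracket y x" for x y by (rule bracket_skew)
  show "linear (\<lambda>x. N x y)" for y by (rule N_linear)
  show "linear (\<lambda>y. N x y)" for x by (rule N_linear)
  show "N x y - N y x = bracket x y" for x y
    by (rule E_inj[where p = \<one>])
      (simp only: E_diff nab_E[symmetric] lie_bracket_E[symmetric] lie_bracket_nab[OF E_smooth E_smooth])
  show "N x y \<bullet> z + y \<bullet> N x z = 2 * (T \<bullet> x) * (y \<bullet> z)" for x y z
    using nab_coeff_compat[of \<one> x y z] N_inner[of x y z \<one>] N_inner[of x z y \<one>] by (simp add: inner_commute)
qed

section \<open>Curvature and Ricci form in the frame\<close>

definition curv :: "'e \<Rightarrow> 'e \<Rightarrow> 'e \<Rightarrow> 'e" where
  "curv x y z = N (bracket x y) z - N x (N y z) + N y (N x z)"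

lemma curvature_E: "curvature A nab (E x) (E y) (E z) = E (curv x y z)"
  by (simp add: curvature_def curv_def lie_bracket_E nab_E E_add E_diff)

lemma vfield_expansion:
  assumes "smooth_vfield A X"
  shows "X = (\<lambda>q c. \<Sum>b\<in>Basis. g q (X q) (E b q) *\<^sub>R E b q c)"
proof (intro ext)
  fix q c
  have "X q c = E (\<Sum>b\<in>Basis. g q (X q) (E b q) *\<^sub>R b) q c"
    using E_surj[OF smooth_vfield_tangent[OF assms], of q] by (rule fun_cong)
  also have "\<dots> = (\<Sum>b\<in>Basis. g q (X q) (E b q) *\<^sub>R E b q c)"
    by (simp add: linear_sum[OF E_linear] linear_scale[OF E_linear])
  finally show "X q c = (\<Sum>b\<in>Basis. g q (X q) (E b q) *\<^sub>R E b q c)" .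
qed

text \<open>The frame is global, so every smooth field is a combination of the \<open>E b\<close>
  with smooth coefficient functions, and \<open>L X\<close> depends only on their values at
  \<open>p\<close>.\<close>

lemma tensorial_cong:
  fixes L :: "('g, 'e) vfield \<Rightarrow> 'b::real_vector"
  assumes add: "\<And>X Y. smooth_vfield A X \<Longrightarrow> smooth_vfield A Y \<Longrightarrow> L (vf_add X Y) = L X + L Y"
    and scale: "\<And>f X. smooth_fun A f \<Longrightarrow> smooth_vfield A X \<Longrightarrow> L (vf_scale f X) = f p *\<^sub>R L X"
    and X: "smooth_vfield A X" and Y: "smooth_vfield A Y" and eq: "X p = Y p"
  shows "L X = L Y"
proof -
  have "L X = (\<Sum>b\<in>Basis. g p (X p) (E b p) *\<^sub>R L (E b))" if X: "smooth_vfield A X" for X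
  proof -
    have "smooth_fun A (\<lambda>q. g q (X q) (E b q))" for b
      using riem X E_smooth by (simp add: riemannian_metric_def)
    then have "L (\<lambda>q c. \<Sum>b\<in>Basis. g q (X q) (E b q) *\<^sub>R E b q c) = (\<Sum>b\<in>Basis. g p (X p) (E b p) *\<^sub>R L (E b))"
      using tensorial_sum[of L p Basis "\<lambda>b q. g q (X q) (E b q)" E, OF add scale] E_smooth by simp
    then show ?thesis using vfield_expansion[OF X] by simp
  qed
  then show ?thesis using X Y eq by simp
qed

text \<open>\<open>extend_vec\<close> chooses some smooth extension; the frame field shows that one
  exists, and tensoriality replaces the chosen extensions by frame fields one slot at a
  time.\<close>

lemma curvature_at_E: "curvature_at A nab p (E x p) (E y p) (E z p) c = E (curv x y z) p c"
proof -
  have ext: "smooth_vfield A (extend_vec A p (E a p))" "extend_vec A p (E a p) p = E a p" for a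
    unfolding extend_vec_def using someI[of "\<lambda>X. smooth_vfield A X \<and> X p = E a p" "E a"] E_smooth by auto
  let ?X = "\<lambda>a. extend_vec A p (E a p)"
  have "curvature A nab (?X x) (?X y) (?X z) p c = curvature A nab (E x) (?X y) (?X z) p c"
    by (rule tensorial_cong[where p = p and L = "\<lambda>X. curvature A nab X (?X y) (?X z) p c"])
      (simp_all add: curvature_add1 curvature_scale1 ext E_smooth)
  also have "\<dots> = curvature A nab (E x) (E y) (?X z) p c"
    by (rule tensorial_cong[where p = p and L = "\<lambda>Y. curvature A nab (E x) Y (?X z) p c"])
      (simp_all add: curvature_add2 curvature_scale2 ext E_smooth)
  also have "\<dots> = curvature A nab (E x) (E y) (E z) p c"
    by (rule tensorial_cong[where p = p and L = "\<lambda>Z. curvature A nab (E x) (E y) Z p c"])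
      (simp_all add: curvature_add3 curvature_scale3 ext E_smooth)
  finally show ?thesis by (simp add: curvature_at_def curvature_E)
qed

lemma curv_linear: "linear (\<lambda>y. curv x y z)"
  unfolding curv_def
  by (intro linear_compose_add linear_compose_sub
      linear_compose[OF bracket_linear(2) N_linear(1), unfolded o_def]
      linear_compose[OF N_linear(1) N_linear(2), unfolded o_def] N_linear)

text \<open>\<open>c0\<close> is the very chart that \<open>tangent_trace\<close> selects at the
  identity; its coordinate vectors are the frame vectors \<open>E (Q b)\<close>, so the coordinate
  trace is the frame trace conjugated by \<open>P\<close>.\<close>

lemma ricci_E: "ricci A nab \<one> (E x \<one>) (E x \<one>) = ric x"
proof -
  have cv: "coord_vec A c0 \<one> b = E (Q b) \<one>" for b
    by (simp add: E_def P_Q lfield_one_eq)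
  have Ec: "E a \<one> c0 = P a" for a by (simp add: E_def lfield_one)
  have "ricci A nab \<one> (E x \<one>) (E x \<one>) = (\<Sum>b\<in>Basis. P (curv x (Q b) x) \<bullet> b)"
    by (simp add: ricci_def tangent_trace_def Let_def c0_def[symmetric] cv curvature_at_E Ec)
  also have "\<dots> = (\<Sum>b\<in>Basis. curv x b x \<bullet> b)"
    by (rule trace_conjugate[OF P_linear Q_linear curv_linear Q_P])
  finally show ?thesis by (simp add: ric_def curv_def)
qed

text \<open>The two filtrations run in opposite directions: each bracket descends one step in
  \<open>lcs\<close> and uses up one step of \<open>ad_fil\<close>, starting from
  \<open>ad_fil m = UNIV\<close>. At \<open>k = m\<close> this gives \<open>P v = 0\<close>.\<close>

lemma lcs_ad_fil:
  assumes "lower_central G m = {\<one>}" "k \<le> m" "v \<in> lcs k"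
  shows "P v \<in> ad_fil (m - k)"
  using assms(2,3)
proof (induction k arbitrary: v)
  case 0
  then show ?case using ad_fil_UNIV[OF assms(1)] by simp
next
  case (Suc k)
  let ?W = "{v. P v \<in> ad_fil (m - Suc k)}"
  have sub: "subspace ?W"
    using linear_subspace_vimage[OF P_linear ad_fil_subspace[of "m - Suc k"]] by (simp add: vimage_def)
  have "{bracket x v | x v. v \<in> lcs k} \<subseteq> ?W"
  proof clarify
    fix x v assume "v \<in> lcs k"
    then have "P v \<in> ad_fil (Suc (m - Suc k))" using Suc by (simp add: Suc_diff_Suc)
    then show "P (bracket x v) \<in> ad_fil (m - Suc k)" unfolding bracket_def P_Q by (rule br_ad_fil)
  qed
  then have "lcs (Suc k) \<subseteq> ?W" unfolding lcs.simps by (rule span_minimal[OF _ sub])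
  then show ?case using Suc.prems by blast
qed

theorem not_weyl_einstein:
  assumes "connected (UNIV :: 'g set)" "nilpotent_group G" "\<not> comm_group G"
    and ein: "\<And>x. ricci A nab \<one> (E x \<one>) (E x \<one>) = k * g \<one> (E x \<one>) (E x \<one>)"
  shows False
proof -
  obtain m where m: "lower_central G m = {\<one>}" using assms(2) by (auto simp: nilpotent_group_def)
  have nil: "lcs m \<subseteq> {0}"
  proof
    fix v assume "v \<in> lcs m"
    then have "P v = 0" using lcs_ad_fil[OF m order_refl] by simp
    then show "v \<in> {0}" using Q_P[of v] linear_0[OF Q_linear] by simp
  qed
  obtain a b where ab: "br a b \<noteq> 0" using br_nontrivial[OF assms(1,3)] by blast
  have "bracket (Q a) (Q b) \<noteq> 0"
    unfolding bracket_def P_Q using ab P_Q linear_0[OF P_linear] by metis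
  then show False
    by (rule nilpotent_not_einstein[OF nil, of "Q a" "Q b" k]) (use ein in \<open>simp add: ricci_E g_E\<close>)
qed

end

text \<open>\<open>lfield\<close> identifies \<open>'e\<close> with the tangent space at the
  identity, so the metric there pulls back to an inner product on \<open>'e\<close> and Gram-Schmidt
  applies.\<close>

lemma (in lie_grp) orthonormal_frame_exists:
  assumes "left_invariant_metric G A g"
  obtains P :: "'e \<Rightarrow> 'e" where "linear P" "\<And>a b. g \<one> (lfield (P a) \<one>) (lfield (P b) \<one>) = a \<bullet> b"
proof -
  have riem: "riemannian_metric A g" using assms by (simp add: left_invariant_metric_def)
  let ?B = "\<lambda>a b. g \<one> (lfield a \<one>) (lfield b \<one>)"
  interpret inner_form ?B
  proof (rule inner_form.intro)
    show "?B a b = ?B b a" for a b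
      using riem lfield_tangent by (simp add: riemannian_metric_def)
    have "g \<one> (lincomb r (lfield a \<one>) s (lfield a' \<one>)) (lfield b \<one>) = r * ?B a b + s * ?B a' b" for a a' b r s
      using riem lfield_tangent by (simp add: riemannian_metric_def)
    moreover have "lincomb r (lfield a \<one>) s (lfield a' \<one>) = lfield (r *\<^sub>R a + s *\<^sub>R a') \<one>" for r s a a'
      by (rule ext) (simp add: lincomb_def linear_add[OF lfield_linear] linear_scale[OF lfield_linear])
    ultimately have l: "?B (r *\<^sub>R a + s *\<^sub>R a') b = r * ?B a b + s * ?B a' b" for r s a a' b by simp
    show "linear (\<lambda>a. ?B a b)" for b
      using l[of 1 _ 1 _ b] l[of _ _ 0 0 b] by (intro linearI) simp_all
    show "?B a a > 0" if "a \<noteq> 0" for a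
    proof -
      have "lfield a \<one> \<noteq> (\<lambda>c. 0)" using lfield_one[of a] that by auto
      then show ?thesis using riem lfield_tangent[of a \<one>] by (simp add: riemannian_metric_def)
    qed
  qed
  show ?thesis using orthonormalisation that by blast
qed

theorem proposition5p1:
  fixes G :: "'g::{t2_space,second_countable_topology} monoid"
    and A :: "('g, 'e::euclidean_space) chart set"
    and C :: "('g, 'e) bilin_form set"
    and nab :: "('g, 'e) connection"
  assumes "lie_group G A"
    and "connected (UNIV :: 'g set)"
    and "nilpotent_group G"
    and "\<not> comm_group G"
    and "conformal_lie_group G A C"
    and "left_invariant_weyl G A C nab"
  shows "\<not> weyl_einstein A C nab"
proof
  assume "weyl_einstein A C nab"
  then obtain h where h: "h \<in> C" and ein: "\<And>p u v. u \<in> tangent_space A p \<Longrightarrow> v \<in> tangent_space A p \<Longrightarrow>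
      trace_free_part A h (sym_part (ricci A nab)) p u v = 0"
    unfolding weyl_einstein_def by blast
  interpret lie_grp G A
    using assms(1) by (intro lie_grp.intro lie_grp_axioms.intro) (simp_all add: lie_group_def)
  obtain g where g: "g \<in> C" "left_invariant_metric G A g"
    using assms(5) unfolding conformal_lie_group_def by blast
  obtain g0 where C: "C = {h. riemannian_metric A h \<and> conformal_to A g0 h}"
    using assms(5) unfolding conformal_lie_group_def conformal_class_def by blast
  have weyl: "weyl_structure A C nab" using assms(6) by (simp add: left_invariant_weyl_def)
  then obtain \<theta> where \<theta>: "lee_form A nab g \<theta>" using g(1) unfolding weyl_structure_def by blast
  then have \<theta>': "left_invariant_form G A \<theta>" using assms(6) g unfolding left_invariant_weyl_def by blast
  obtain P :: "'e \<Rightarrow> 'e" where P: "linear P" "\<And>a b. g \<one>\<^bsub>G\<^esub> (lfield (P a) \<one>\<^bsub>G\<^esub>) (lfield (P b) \<one>\<^bsub>G\<^esub>) = a \<bullet> b"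
    by (rule orthonormal_frame_exists[OF g(2)], rule that)
  interpret left_invariant_weyl_geometry G A nab g \<theta> P
    using weyl g(2) \<theta> \<theta>' P
    by (intro left_invariant_weyl_geometry.intro torsion_free_connection.intro
        torsion_free_connection_axioms.intro left_invariant_weyl_geometry_axioms.intro
        lie_grp_axioms atlas_axioms) (simp_all add: weyl_structure_def)
  \<comment> \<open>The metric \<open>h\<close> of the Einstein condition need not be the
    left-invariant \<open>g\<close>; both are multiples of \<open>g0\<close>, so at the identity
    they are proportional.\<close>
  have "\<exists>k. \<forall>u\<in>tangent_space A \<one>\<^bsub>G\<^esub>. h \<one>\<^bsub>G\<^esub> u u = k * g \<one>\<^bsub>G\<^esub> u u"
  proof -
    obtain f1 where f1: "\<And>p. f1 p > 0" "\<And>p u v. u \<in> tangent_space A p \<Longrightarrow> v \<in> tangent_space A p \<Longrightarrow> g p u v = f1 p * g0 p u v"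
      using g(1) unfolding C conformal_to_def mem_Collect_eq by metis
    obtain f2 where f2: "\<And>p u v. u \<in> tangent_space A p \<Longrightarrow> v \<in> tangent_space A p \<Longrightarrow> h p u v = f2 p * g0 p u v"
      using h unfolding C conformal_to_def mem_Collect_eq by metis
    have "h \<one>\<^bsub>G\<^esub> u u = (f2 \<one>\<^bsub>G\<^esub> / f1 \<one>\<^bsub>G\<^esub>) * g \<one>\<^bsub>G\<^esub> u u" if "u \<in> tangent_space A \<one>\<^bsub>G\<^esub>" for u
      using f1(1)[of "\<one>\<^bsub>G\<^esub>"] by (simp add: f1(2)[OF that that] f2[OF that that])
    then show ?thesis by blast
  qed
  then obtain k where k: "\<And>u. u \<in> tangent_space A \<one>\<^bsub>G\<^esub> \<Longrightarrow> h \<one>\<^bsub>G\<^esub> u u = k * g \<one>\<^bsub>G\<^esub> u u" by blast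
  \<comment> \<open>At the identity the trace term is one number, so the Ricci diagonal there is a
    constant multiple of \<open>h\<close>, hence of \<open>g\<close>; symmetrisation leaves the
    diagonal unchanged.\<close>
  let ?m = "metric_trace A h (sym_part (ricci A nab)) \<one>\<^bsub>G\<^esub> / real DIM('e)"
  show False
  proof (rule not_weyl_einstein[OF assms(2-4)])
    fix x
    show "ricci A nab \<one>\<^bsub>G\<^esub> (E x \<one>\<^bsub>G\<^esub>) (E x \<one>\<^bsub>G\<^esub>) = (?m * k) * g \<one>\<^bsub>G\<^esub> (E x \<one>\<^bsub>G\<^esub>) (E x \<one>\<^bsub>G\<^esub>)"
      using ein[OF E_tangent[of x "\<one>\<^bsub>G\<^esub>"] E_tangent[of x "\<one>\<^bsub>G\<^esub>"]] k[OF E_tangent[of x "\<one>\<^bsub>G\<^esub>"]]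
      by (simp add: trace_free_part_def sym_part_def)
  qed
qed

end
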